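(* Let $d\ge 2$ and let $n_1,\dots,n_d$ be positive integers. Put $N=\sum_{j=1}^d n_j$ and $n=N+d$, and let $S=S(n_1,\dots,n_d)\subset\mathbb{P}^{n-1}$ be the rational normal scroll. Then the polar degrees (multidegree coefficients of the conormal variety) of $S$ are $$\delta_j(S)=\begin{cases} N, & j=d-1 \text{ or } j=d+1,\\ 2(N-1), & j=d,\\ 0, & \text{otherwise.}\end{cases}$$
   Context: The rational normal scroll $S(n_1,\dots,n_d)\subset\mathbb{P}^{n-1}$, $n=n_1+\dots+n_d+d$, is the projective toric variety whose homogeneous coordinates are $x_{j,k}$ for $1\le j\le d$, $0\le k\le n_j$, and whose ideal is generated by the $2\times 2$ minors of the $2\times N$ matrix $M=[M_{n_1}|\cdots|M_{n_d}]$, where $M_{n_j}$ has first row $(x_{j,0},\dots,x_{j,n_j-1})$ and second row $(x_{j,1},\dots,x_{j,n_j})$. Equivalently it is the toric variety of the $(d+1)\times n$ matrix whose columns are $(1,e_j,k)$ for $1\le j\le d$, $0\le k\le n_j$ ($e_j$ the $j$-th standard basis vector of $\mathbb{Z}^{d-1}$ for $j<d$, and $e_d=0$). It has dimension $d$ and degree $N$. Polar degrees via the conormal variety: for an irreducible projective variety $X\subset\mathbb{P}^m$, the conormal variety is $N_X=\overline{\{(x,u)\in\mathbb{P}^m\times(\mathbb{P}^m)^\vee: x\in\mathrm{Reg}(X),\ \text{the hyperplane } \{\sum u_ix_i=0\}\supseteq T_xX\}}$, of dimension $m-1$. For $1\le j\le m$, $\delta_j(X)$ is the number of points of $N_X\cap(L_1\times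 L_2)$ where $L_1\subset\mathbb{P}^m$ and $L_2\subset(\mathbb{P}^m)^\vee$ are generic linear subspaces of dimensions $m+1-j$ and $j$ respectively. The multidegree of $N_X$ is the polynomial $\sum_j \delta_j(X)\,s^{m+1-j}t^j$. *)

theory Defs
  imports Complex_Main
begin

inductive_set polyfun :: "(('k \<Rightarrow> complex) \<Rightarrow> complex) set" where
  const: "(\<lambda>x. c) \<in> polyfun"
| coord: "(\<lambda>x. x i) \<in> polyfun"
| add: "p \<in> polyfun \<Longrightarrow> q \<in> polyfun \<Longrightarrow> (\<lambda>x. p x + q x) \<in> polyfun"
| mult: "p \<in> polyfun \<Longrightarrow> q \<in> polyfun \<Longrightarrow> (\<lambda>x. p x * q x) \<in> polyfun"

definition zclosure :: "('k \<Rightarrow> complex) set \<Rightarrow> ('k \<Rightarrow> complex) set" where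
  "zclosure A = {y. \<forall>p\<in>polyfun. (\<forall>a\<in>A. p a = 0) \<longrightarrow> p y = 0}"

definition coord_space :: "'i set \<Rightarrow> ('i \<Rightarrow> complex) set" where
  "coord_space I = {x. \<forall>i. i \<notin> I \<longrightarrow> x i = 0}"

definition nonzero :: "('i \<Rightarrow> complex) \<Rightarrow> bool" where
  "nonzero x \<longleftrightarrow> (\<exists>i. x i \<noteq> 0)"

definition pairing :: "'i set \<Rightarrow> ('i \<Rightarrow> complex) \<Rightarrow> ('i \<Rightarrow> complex) \<Rightarrow> complex" where
  "pairing I u v = (\<Sum>i\<in>I. u i * v i)"

definition tangent_space ::
  "'i set \<Rightarrow> ('i \<Rightarrow> complex) set \<Rightarrow> ('i \<Rightarrow> complex) \<Rightarrow> ('i \<Rightarrow> complex) set" where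
  "tangent_space I C x = {v \<in> coord_space I. \<forall>p\<in>polyfun. (\<forall>a\<in>C. p a = 0) \<longrightarrow>
      ((\<lambda>t. p (\<lambda>i. x i + t * v i)) has_field_derivative 0) (at 0)}"

definition lin_indep :: "('i \<Rightarrow> complex) set \<Rightarrow> bool" where
  "lin_indep B \<longleftrightarrow> finite B \<and>
     (\<forall>c. (\<forall>i. (\<Sum>b\<in>B. c b * b i) = 0) \<longrightarrow> (\<forall>b\<in>B. c b = 0))"

definition cdim :: "('i \<Rightarrow> complex) set \<Rightarrow> nat" where
  "cdim V = Max {card B | B. B \<subseteq> V \<and> lin_indep B}"

(* regular points of the projective variety with affine cone C: nonzero points
   of the cone where the tangent space has minimal (= generic) dimension *)
definition reg_points :: "'i set \<Rightarrow> ('i \<Rightarrow> complex) set \<Rightarrow> ('i \<Rightarrow> complex) set" where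
  "reg_points I C = {x \<in> C. nonzero x \<and>
     cdim (tangent_space I C x) = Min {cdim (tangent_space I C y) | y. y \<in> C \<and> nonzero y}}"

definition pr :: "('i \<Rightarrow> complex) \<Rightarrow> ('i \<Rightarrow> complex) \<Rightarrow> ('i + 'i \<Rightarrow> complex)" where
  "pr x u = case_sum x u"

(* affine (bi-)cone over the conormal variety N_X \<subseteq> P^m x (P^m)^dual *)
definition conormal_cone :: "'i set \<Rightarrow> ('i \<Rightarrow> complex) set \<Rightarrow> ('i + 'i \<Rightarrow> complex) set" where
  "conormal_cone I C = zclosure {pr x u | x u. x \<in> reg_points I C \<and> u \<in> coord_space I \<and>
       nonzero u \<and> (\<forall>v\<in>tangent_space I C x. pairing I u v = 0)}"

(* parameters: p(False,r,.) for r < j-1 are the linear forms cutting out the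
   cone over L1 (dim m+1-j), p(True,r,.) for r < m-j those cutting out L2 (dim j),
   where m+1 = card I *)
definition param_space :: "'i set \<Rightarrow> nat \<Rightarrow> (bool \<times> nat \<times> 'i \<Rightarrow> complex) set" where
  "param_space I j = {p. \<forall>b r i. (i \<notin> I \<or> r \<ge> (if b then card I - 1 - j else j - 1))
       \<longrightarrow> p (b, r, i) = 0}"

definition line :: "('i \<Rightarrow> complex) \<Rightarrow> ('i \<Rightarrow> complex) set" where
  "line x = {(\<lambda>i. c * x i) | c. True}"

(* points of N_X \<inter> (L1 x L2), as pairs of projective points (lines) *)
definition sect_points ::
  "'i set \<Rightarrow> ('i \<Rightarrow> complex) set \<Rightarrow> nat \<Rightarrow> (bool \<times> nat \<times> 'i \<Rightarrow> complex)
     \<Rightarrow> (('i \<Rightarrow> complex) set \<times> ('i \<Rightarrow> complex) set) set" where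
  "sect_points I C j p = (\<lambda>(x, u). (line x, line u)) `
     {(x, u). pr x u \<in> conormal_cone I C \<and> nonzero x \<and> nonzero u \<and>
        (\<forall>r < j - 1. pairing I (\<lambda>i. p (False, r, i)) x = 0) \<and>
        (\<forall>r < card I - 1 - j. pairing I (\<lambda>i. p (True, r, i)) u = 0)}"

(* delta_j(X) = k : for generic L1, L2 (all parameters off a proper Zariski closed
   subset of the parameter space) N_X \<inter> (L1 x L2) consists of exactly k points *)
definition has_polar_degree :: "'i set \<Rightarrow> ('i \<Rightarrow> complex) set \<Rightarrow> nat \<Rightarrow> nat \<Rightarrow> bool" where
  "has_polar_degree I C j k \<longleftrightarrow>
     (\<exists>P\<in>polyfun. (\<exists>p\<in>param_space I j. P p \<noteq> 0) \<and>
        (\<forall>p\<in>param_space I j. P p \<noteq> 0 \<longrightarrow>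
            finite (sect_points I C j p) \<and> card (sect_points I C j p) = k))"

definition scroll_coords :: "nat \<Rightarrow> (nat \<Rightarrow> nat) \<Rightarrow> (nat \<times> nat) set" where
  "scroll_coords d ns = {(j, k). 1 \<le> j \<and> j \<le> d \<and> k \<le> ns j}"

(* affine cone: zero set of the 2x2 minors of M = [M_{n_1} | ... | M_{n_d}] *)
definition scroll_cone :: "nat \<Rightarrow> (nat \<Rightarrow> nat) \<Rightarrow> (nat \<times> nat \<Rightarrow> complex) set" where
  "scroll_cone d ns = {x \<in> coord_space (scroll_coords d ns).
     \<forall>j k j' k'. 1 \<le> j \<and> j \<le> d \<and> k < ns j \<and> 1 \<le> j' \<and> j' \<le> d \<and> k' < ns j' \<longrightarrow>
        x (j, k) * x (j', k' + 1) = x (j', k') * x (j, k + 1)}"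

end

theory Submission
  imports Defs "Jordan_Normal_Form.Determinant"
    "HOL-Computational_Algebra.Fundamental_Theorem_Algebra" "HOL-Library.Nat_Bijection"
begin

text \<open>Write a hyperplane \<open>u\<close> as a tuple of binary forms \<open>f\<^sub>i = \<Sum>\<^sub>k u\<^sub>i\<^sub>k T\<^sup>k\<close>. It is tangent to the
  scroll at the point with base coordinate \<open>t\<close> and fibre coordinates \<open>a\<close> iff \<open>f\<^sub>i = (T - t) g\<^sub>i\<close> for all
  \<open>i\<close> and \<open>\<Sum>\<^sub>i a\<^sub>i g\<^sub>i(t) = 0\<close>. So over the base line the conormal variety consists of the pairs
  \<open>(a, g)\<close> in \<open>P\<^bsup>d-1\<^esup> \<times> P\<^bsup>N-1\<^esup>\<close> satisfying one bilinear equation, and the linear sections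
  become linear systems \<open>P(t) a = 0\<close> (\<open>j - 1\<close> rows, entries of degree \<open>n\<^sub>i\<close> in \<open>t\<close>) and \<open>Q(t) g = 0\<close>
  (\<open>N + d - 1 - j\<close> rows, entries linear in \<open>t\<close>). One of them has more rows than unknowns, hence
  generically no solution, unless \<open>|j - d| \<le> 1\<close>. If \<open>j = d + 1\<close> or \<open>j = d - 1\<close>, then \<open>P\<close> or \<open>Q\<close> is square with
  determinant of degree \<open>N\<close>; if \<open>j = d\<close>, the cofactors of \<open>P\<close> give \<open>a(t)\<close>, and \<open>Q\<close> bordered by the row
  \<open>a\<^sub>i(t) t\<^sup>k\<close> has determinant of degree \<open>2 (N - 1)\<close>. The points of the section are the roots, which are
  simple, with a unique pair \<open>(a, g)\<close> over each, because the resultants expressing this do not vanish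
  at suitable explicit sections.\<close>

subsection \<open>Polynomial functions and tangent spaces\<close>

text \<open>The conormal cone is a Zariski closure, which might contain degenerate pairs. It does
  not: the scroll is smooth, and vector fields with polynomial coefficients span enough of its
  tangent spaces, so tangency is already a closed condition wherever the point is nonzero. No
  dimension theory enters the counts. A property is generic as soon as a polynomial in the
  parameters implies it and is nonzero at one section, and different conditions may use different
  sections, since two nonempty open sets of parameters meet. Resultants for formal degrees also keep
  the degree of a determinant from dropping, so no root escapes to [0:1]; that no solution sits
  there is a separate open condition. Simple roots by themselves count values of t, not points:
  uniqueness over a root is a rank condition. For j = d + 1 and j = d - 1 an auxiliary completing
  row certifies it; for j = d the matrix for g is already square, and simplicity of the root itself
  forces a one-dimensional kernel.\<close>

lemma polyfun_sum:
  assumes "finite A" "\<And>a. a \<in> A \<Longrightarrow> f a \<in> polyfun"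
  shows "(\<lambda>x. \<Sum>a\<in>A. f a x) \<in> polyfun"
  using assms by (induction A rule: finite_induct) (auto intro: polyfun.intros)

lemma polyfun_power: "f \<in> polyfun \<Longrightarrow> (\<lambda>x. f x ^ n) \<in> polyfun"
  by (induction n) (auto intro: polyfun.intros)

lemma polyfun_if:
  "f \<in> polyfun \<Longrightarrow> g \<in> polyfun \<Longrightarrow> (\<lambda>x. if P then f x else g x) \<in> polyfun"
  by (cases P) auto

lemma polyfun_uminus:
  assumes "f \<in> polyfun"
  shows "(\<lambda>x. - f x) \<in> polyfun"
  using polyfun.mult[OF polyfun.const[of "-1"] assms] by simp

lemma polyfun_diff:
  assumes "f \<in> polyfun" "g \<in> polyfun"
  shows "(\<lambda>x. f x - g x) \<in> polyfun"
  using polyfun.add[OF assms(1) polyfun_uminus[OF assms(2)]] by simp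

text \<open>A chain rule without partial derivatives: along two curves with the same value and
  velocity at 0, induction on the construction of \<open>p\<close> yields a common derivative. The
  product case is where equality of the values is used.\<close>

lemma polyfun_curve:
  fixes p :: "('k \<Rightarrow> complex) \<Rightarrow> complex"
  assumes "p \<in> polyfun"
    and "\<And>i. ((\<lambda>e. \<gamma> e i) has_field_derivative v i) (at (0::complex))"
    and "\<And>i. ((\<lambda>e. \<eta> e i) has_field_derivative v i) (at 0)"
    and "\<gamma> 0 = \<eta> 0"
  shows "\<exists>D. ((\<lambda>e. p (\<gamma> e)) has_field_derivative D) (at 0) \<and>
             ((\<lambda>e. p (\<eta> e)) has_field_derivative D) (at 0)"
  using assms(1)
proof (induction rule: polyfun.induct)
  case (const c)
  then show ?case by (auto intro!: exI[of _ 0])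
next
  case (coord i)
  then show ?case using assms by auto
next
  case (add p q)
  then obtain D E where "((\<lambda>e. p (\<gamma> e)) has_field_derivative D) (at 0)"
    "((\<lambda>e. p (\<eta> e)) has_field_derivative D) (at 0)"
    "((\<lambda>e. q (\<gamma> e)) has_field_derivative E) (at 0)"
    "((\<lambda>e. q (\<eta> e)) has_field_derivative E) (at 0)" by blast
  then show ?case by (intro exI[of _ "D + E"]) (auto intro: DERIV_add)
next
  case (mult p q)
  then obtain D E where "((\<lambda>e. p (\<gamma> e)) has_field_derivative D) (at 0)"
    "((\<lambda>e. p (\<eta> e)) has_field_derivative D) (at 0)"
    "((\<lambda>e. q (\<gamma> e)) has_field_derivative E) (at 0)"
    "((\<lambda>e. q (\<eta> e)) has_field_derivative E) (at 0)" by blast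
  from DERIV_mult[OF this(1,3)] DERIV_mult[OF this(2,4)] assms(4)
  show ?case by auto
qed

text \<open>The definition of the tangent space differentiates along straight lines, which may leave
  the cone; \<open>polyfun_curve\<close> trades the line for a curve inside the cone, along which
  \<open>p\<close> is constantly 0.\<close>

lemma tangent_space_curve:
  assumes "v \<in> coord_space I" "\<And>e. \<gamma> e \<in> C" "\<gamma> 0 = x"
    and "\<And>i. ((\<lambda>e. \<gamma> e i) has_field_derivative v i) (at 0)"
  shows "v \<in> tangent_space I C x"
  unfolding tangent_space_def
proof (intro CollectI conjI ballI impI)
  fix p :: "('a \<Rightarrow> complex) \<Rightarrow> complex" assume p: "p \<in> polyfun" "\<forall>a\<in>C. p a = 0"
  have "((\<lambda>e. x i + e * v i) has_field_derivative v i) (at 0)" for i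
    by (auto intro!: derivative_eq_intros)
  from polyfun_curve[OF p(1), of "\<lambda>e i. x i + e * v i" v \<gamma>, OF this assms(4)] assms(3) obtain D where
    D: "((\<lambda>e. p (\<lambda>i. x i + e * v i)) has_field_derivative D) (at 0)"
       "((\<lambda>e. p (\<gamma> e)) has_field_derivative D) (at 0)" by auto
  have "((\<lambda>e. p (\<gamma> e)) has_field_derivative 0) (at 0)"
    using p(2) assms(2) by simp
  with D show "((\<lambda>e. p (\<lambda>i. x i + e * v i)) has_field_derivative 0) (at 0)"
    using DERIV_unique by blast
qed (use assms in auto)

text \<open>Serves to compare tangent dimensions at different points: the two sets of cardinalities
  under \<open>Max\<close> coincide, so their value is never computed.\<close>

lemma cdim_linear_image:
  fixes L :: "('j \<Rightarrow> complex) \<Rightarrow> ('i \<Rightarrow> complex)"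
  assumes add: "\<And>u v. L (\<lambda>j. u j + v j) = (\<lambda>i. L u i + L v i)"
    and scale: "\<And>c u. L (\<lambda>j. c * u j) = (\<lambda>i. c * L u i)"
    and inj: "\<And>u. u \<in> coord_space S \<Longrightarrow> L u = (\<lambda>i. 0) \<Longrightarrow> u = (\<lambda>j. 0)"
  shows "cdim (L ` coord_space S) = cdim (coord_space S)"
proof -
  let ?V = "coord_space S :: ('j \<Rightarrow> complex) set"
  have zero: "L (\<lambda>j. 0) = (\<lambda>i. 0)" using scale[of 0 "\<lambda>j. 0"] by simp
  have comb: "L (\<lambda>j. \<Sum>b\<in>B. c b * b j) = (\<lambda>i. \<Sum>b\<in>B. c b * L b i)" if "finite B" for B c
    using that
  proof (induction B rule: finite_induct)
    case empty then show ?case using zero by simp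
  next
    case (insert b B)
    have "L (\<lambda>j. \<Sum>b\<in>insert b B. c b * b j) = L (\<lambda>j. c b * b j + (\<Sum>b\<in>B. c b * b j))"
      using insert by simp
    also have "\<dots> = (\<lambda>i. c b * L b i + (\<Sum>b\<in>B. c b * L b i))"
      unfolding add insert.IH scale by simp
    finally show ?case using insert by simp
  qed
  have closed: "(\<lambda>j. \<Sum>b\<in>B. c b * b j) \<in> ?V" if "B \<subseteq> ?V" for B c
    using that by (auto simp: coord_space_def intro!: sum.neutral)
  have injL: "inj_on L ?V"
  proof (rule inj_onI)
    fix u v assume uv: "u \<in> ?V" "v \<in> ?V" "L u = L v"
    have "L (\<lambda>j. u j + (-1) * v j) = (\<lambda>i. L u i + (-1) * L v i)"
      unfolding add scale by simp
    then have "(\<lambda>j. u j + (-1) * v j) = (\<lambda>j. 0)"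
      using uv by (intro inj) (auto simp: coord_space_def)
    then show "u = v" by (auto simp: fun_eq_iff)
  qed
  have indep: "lin_indep (L ` B) \<longleftrightarrow> lin_indep B" if B: "B \<subseteq> ?V" for B
  proof -
    have inj: "inj_on L B" using injL B inj_on_subset by blast
    have fin: "finite (L ` B) \<longleftrightarrow> finite B" using inj finite_image_iff by blast
    have eq: "(\<forall>i. (\<Sum>y\<in>L ` B. c y * y i) = 0) \<longleftrightarrow> (\<forall>j. (\<Sum>b\<in>B. c (L b) * b j) = 0)"
      if fB: "finite B" for c
    proof -
      define s where "s = (\<lambda>j. \<Sum>b\<in>B. c (L b) * b j)"
      have "s \<in> ?V" unfolding s_def by (rule closed[OF B])
      then have "L s = (\<lambda>i. 0) \<longleftrightarrow> s = (\<lambda>j. 0)" using assms(3)[of s] zero by auto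
      moreover have "(\<lambda>i. \<Sum>y\<in>L ` B. c y * y i) = L s"
        unfolding s_def comb[OF fB, of "\<lambda>b. c (L b)"] by (simp add: sum.reindex[OF inj])
      ultimately show ?thesis unfolding fun_eq_iff s_def by simp
    qed
    show ?thesis
    proof
      assume l: "lin_indep (L ` B)"
      then have fB: "finite B" using fin by (simp add: lin_indep_def)
      show "lin_indep B" unfolding lin_indep_def
      proof (intro conjI allI impI ballI fB)
        fix c b assume c: "\<forall>i. (\<Sum>b\<in>B. c b * b i) = 0" and b: "b \<in> B"
        let ?c = "\<lambda>y. c (the_inv_into B L y)"
        have i: "?c (L b) = c b" if "b \<in> B" for b
          using the_inv_into_f_f[OF inj that] by simp
        have "\<forall>j. (\<Sum>b\<in>B. ?c (L b) * b j) = 0" using c i by simp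
        then have "\<forall>i. (\<Sum>y\<in>L ` B. ?c y * y i) = 0" using eq[OF fB, of ?c] by (rule iffD2[rotated])
        then have "\<forall>y\<in>L ` B. ?c y = 0"
          using l unfolding lin_indep_def by (elim conjE allE[of _ ?c]) (rule mp)
        then show "c b = 0" using i b by force
      qed
    next
      assume l: "lin_indep B"
      then have fB: "finite B" by (simp add: lin_indep_def)
      show "lin_indep (L ` B)" unfolding lin_indep_def
      proof (intro conjI allI impI)
        show "finite (L ` B)" using fB by simp
        fix c assume "\<forall>i. (\<Sum>b\<in>L ` B. c b * b i) = 0"
        then have "\<forall>j. (\<Sum>b\<in>B. c (L b) * b j) = 0" using eq[OF fB] by blast
        then have "\<forall>b\<in>B. c (L b) = 0"
          using l unfolding lin_indep_def by (elim conjE allE[of _ "\<lambda>b. c (L b)"]) auto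
        then show "\<forall>b\<in>L ` B. c b = 0" by blast
      qed
    qed
  qed
  have "{card B | B. B \<subseteq> L ` ?V \<and> lin_indep B} = {card B | B. B \<subseteq> ?V \<and> lin_indep B}"
    (is "?l = ?r")
  proof (intro Set.set_eqI iffI)
    fix n assume "n \<in> ?l"
    then obtain B where "B \<subseteq> L ` ?V" "lin_indep B" "n = card B" by blast
    then obtain B' where B': "B' \<subseteq> ?V" "B = L ` B'" by (auto simp: subset_image_iff)
    then have "card B = card B'" using injL inj_on_subset card_image by blast
    then show "n \<in> ?r" using B' \<open>n = card B\<close> \<open>lin_indep B\<close> indep by blast
  next
    fix n assume "n \<in> ?r"
    then obtain B where B: "B \<subseteq> ?V" "lin_indep B" "n = card B" by blast
    then have "card (L ` B) = card B" using injL inj_on_subset card_image by blast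
    then show "n \<in> ?l" using B indep by (intro CollectI exI[of _ "L ` B"]) auto
  qed
  then show ?thesis by (simp add: cdim_def)
qed

section \<open>Charts of the scroll and of its tangent hyperplanes\<close>

locale scroll =
  fixes d :: nat and ns :: "nat \<Rightarrow> nat"
  assumes d2: "d \<ge> 2" and ns_pos: "\<And>i. i \<in> {1..d} \<Longrightarrow> ns i > 0"
begin

abbreviation "I \<equiv> scroll_coords d ns"
abbreviation "C \<equiv> scroll_cone d ns"

text \<open>Indexes the columns of the matrix of the scroll and, equally, the coefficients of the
  quotients \<open>g_i\<close>, whose degrees are below \<open>ns i\<close>.\<close>

definition J :: "(nat \<times> nat) set" where
  "J = (SIGMA i:{1..d}. {..<ns i})"

lemma I_Sigma: "I = (SIGMA i:{1..d}. {..ns i})"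
  by (auto simp: scroll_coords_def)

lemma finite_I [simp]: "finite I" and finite_J [simp]: "finite J"
  by (auto simp: I_Sigma J_def)

lemma in_I [simp]: "(i, k) \<in> I \<longleftrightarrow> i \<in> {1..d} \<and> k \<le> ns i"
  by (auto simp: I_Sigma)

lemma in_J [simp]: "(i, k) \<in> J \<longleftrightarrow> i \<in> {1..d} \<and> k < ns i"
  by (auto simp: J_def)

text \<open>\<open>X t a\<close> and \<open>U t g\<close> live over the point \<open>[1:t]\<close> of the base line, \<open>Xi a\<close> and \<open>Ui g\<close> over \<open>[0:1]\<close>;
  \<open>u = U t g\<close> means \<open>f\<^sub>i = (T - t) g\<^sub>i\<close>.\<close>

definition X :: "complex \<Rightarrow> (nat \<Rightarrow> complex) \<Rightarrow> nat \<times> nat \<Rightarrow> complex" where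
  "X t a = (\<lambda>(i, k). if (i, k) \<in> I then a i * t ^ k else 0)"

definition Xi :: "(nat \<Rightarrow> complex) \<Rightarrow> nat \<times> nat \<Rightarrow> complex" where
  "Xi a = (\<lambda>(i, k). if (i, k) \<in> I \<and> k = ns i then a i else 0)"

definition U :: "complex \<Rightarrow> (nat \<times> nat \<Rightarrow> complex) \<Rightarrow> nat \<times> nat \<Rightarrow> complex" where
  "U t g = (\<lambda>(i, k). if (i, k) \<in> I
     then (if k = 0 then 0 else g (i, k - 1)) - (if k < ns i then t * g (i, k) else 0) else 0)"

definition Ui :: "(nat \<times> nat \<Rightarrow> complex) \<Rightarrow> nat \<times> nat \<Rightarrow> complex" where
  "Ui g = (\<lambda>y. if y \<in> J then g y else 0)"

text \<open>Tangent vectors; the entry \<open>c 0\<close> is the velocity along the base line.\<close>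

definition V :: "complex \<Rightarrow> (nat \<Rightarrow> complex) \<Rightarrow> (nat \<Rightarrow> complex) \<Rightarrow> nat \<times> nat \<Rightarrow> complex" where
  "V t a c = (\<lambda>(i, k). if (i, k) \<in> I then c i * t ^ k + of_nat k * a i * t ^ (k - 1) * c 0 else 0)"

definition Vi :: "(nat \<Rightarrow> complex) \<Rightarrow> (nat \<Rightarrow> complex) \<Rightarrow> nat \<times> nat \<Rightarrow> complex" where
  "Vi a c = (\<lambda>(i, k). if (i, k) \<in> I
     then (if k = ns i then c i else if Suc k = ns i then a i * c 0 else 0) else 0)"

lemma X_eq: "X t a (i, k) = (if i \<in> {1..d} \<and> k \<le> ns i then a i * t ^ k else 0)"
  by (simp add: X_def)

lemma Xi_eq: "Xi a (i, k) = (if i \<in> {1..d} \<and> k = ns i then a i else 0)"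
  by (auto simp: Xi_def)

lemma pairing_I: "pairing I u v = (\<Sum>i=1..d. \<Sum>k\<le>ns i. u (i, k) * v (i, k))"
  unfolding pairing_def I_Sigma by (subst sum.Sigma) (auto intro!: sum.cong)

lemma sum_J: "(\<Sum>y\<in>J. f y) = (\<Sum>i=1..d. \<Sum>k<ns i. f (i, k))"
  unfolding J_def by (subst sum.Sigma) (auto intro!: sum.cong)

lemma pairing_X: "pairing I w (X t a) = (\<Sum>i=1..d. (\<Sum>k\<le>ns i. w (i, k) * t ^ k) * a i)"
  unfolding pairing_I by (auto simp: X_eq sum_distrib_left sum_distrib_right mult_ac intro!: sum.cong)

lemma pairing_Xi: "pairing I w (Xi a) = (\<Sum>i=1..d. w (i, ns i) * a i)"
  unfolding pairing_I
proof (intro sum.cong refl)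
  fix i assume i: "i \<in> {1..d}"
  have "(\<Sum>k\<le>ns i. w (i, k) * Xi a (i, k)) = (\<Sum>k\<le>ns i. if k = ns i then w (i, k) * a i else 0)"
    using i by (intro sum.cong) (auto simp: Xi_eq)
  then show "(\<Sum>k\<le>ns i. w (i, k) * Xi a (i, k)) = w (i, ns i) * a i" by simp
qed

text \<open>Multiplication by T - t on the coefficients \<open>g\<close> is moved to the weights
  \<open>w\<close>, where its adjoint is a difference.\<close>

lemma sum_by_parts:
  fixes w g :: "nat \<Rightarrow> complex"
  shows "(\<Sum>k\<le>n. w k * ((if k = 0 then 0 else g (k - 1)) - (if k < n then t * g k else 0)))
    = (\<Sum>k<n. (w (Suc k) - t * w k) * g k)"
proof -
  have "(\<Sum>k\<le>n. w k * (if k = 0 then 0 else g (k - 1))) = (\<Sum>k<n. w (Suc k) * g k)"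
    by (subst sum.atMost_shift) simp
  moreover have "(\<Sum>k\<le>n. w k * (if k < n then t * g k else 0)) = (\<Sum>k<n. w k * (t * g k))"
    by (subst lessThan_Suc_atMost[symmetric]) simp
  ultimately show ?thesis
    by (simp add: right_diff_distrib sum_subtractf left_diff_distrib mult_ac)
qed

text \<open>Turns a linear form on \<open>u\<close> into a linear form on \<open>g\<close> with
  entries linear in \<open>t\<close>; these entries become the rows of Q(t).\<close>

lemma pairing_U: "pairing I w (U t g) = (\<Sum>y\<in>J. (w (fst y, Suc (snd y)) - t * w y) * g y)"
proof -
  have "(\<Sum>k\<le>ns i. w (i, k) * U t g (i, k)) = (\<Sum>k<ns i. (w (i, Suc k) - t * w (i, k)) * g (i, k))"
    if "i \<in> {1..d}" for i
  proof -
    have "(\<Sum>k\<le>ns i. w (i, k) * U t g (i, k)) = (\<Sum>k\<le>ns i. w (i, k) *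
        ((if k = 0 then 0 else g (i, k - 1)) - (if k < ns i then t * g (i, k) else 0)))"
      using that by (intro sum.cong) (auto simp: U_def)
    then show ?thesis by (simp add: sum_by_parts[where w = "\<lambda>k. w (i, k)" and g = "\<lambda>k. g (i, k)"])
  qed
  then show ?thesis unfolding pairing_I sum_J by simp
qed

lemma pairing_Ui: "pairing I w (Ui g) = (\<Sum>y\<in>J. w y * g y)"
proof -
  have "J \<subseteq> I" by auto
  then show ?thesis unfolding pairing_def
    by (intro sum.mono_neutral_cong_right) (auto simp: Ui_def)
qed

subsection \<open>Points and tangent spaces of the scroll\<close>

lemma X_in_C: "X t a \<in> C"
  by (auto simp: scroll_cone_def coord_space_def X_def algebra_simps)

lemma Xi_in_C: "Xi a \<in> C"
  by (auto simp: scroll_cone_def coord_space_def Xi_def algebra_simps)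

lemma C_coord: "x \<in> C \<Longrightarrow> x \<in> coord_space I"
  by (simp add: scroll_cone_def)

lemma coord_spaceD: "x \<in> coord_space S \<Longrightarrow> y \<notin> S \<Longrightarrow> x y = 0"
  by (simp add: coord_space_def)

text \<open>If some entry of the first row of the matrix is nonzero, the minors force one common
  ratio \<open>t\<close> between the rows. Otherwise only the last coordinate of each block can
  survive.\<close>

lemma C_param:
  assumes "x \<in> C"
  shows "(\<exists>t a. x = X t a) \<or> (\<exists>a. x = Xi a)"
proof -
  have minors: "x (j, k) * x (j', Suc k') = x (j', k') * x (j, Suc k)"
    if "(j, k) \<in> J" "(j', k') \<in> J" for j k j' k'
    using assms that by (auto simp: scroll_cone_def)
  have supp: "x y = 0" if "y \<notin> I" for y
    using assms that unfolding scroll_cone_def coord_space_def by blast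
  show ?thesis
  proof (cases "\<exists>i k. (i, k) \<in> J \<and> x (i, k) \<noteq> 0")
    case True
    then obtain i k where ik: "(i, k) \<in> J" "x (i, k) \<noteq> 0" by blast
    define t where "t = x (i, Suc k) / x (i, k)"
    have step: "x (j, Suc l) = t * x (j, l)" if "(j, l) \<in> J" for j l
      using minors[OF ik(1) that] ik(2) by (simp add: t_def field_simps)
    have gen: "x (j, l) = x (j, 0) * t ^ l" if "j \<in> {1..d}" "l \<le> ns j" for j l
      using that(2)
    proof (induction l)
      case (Suc l)
      then show ?case using step[of j l] that(1) by simp
    qed simp
    have "x (j, l) = X t (\<lambda>i. x (i, 0)) (j, l)" if "(j, l) \<in> I" for j l
    proof -
      have jl: "j \<in> {1..d}" "l \<le> ns j" using that by auto
      then have "X t (\<lambda>i. x (i, 0)) (j, l) = x (j, 0) * t ^ l" by (simp add: X_eq)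
      then show ?thesis using gen[OF jl] by (rule trans[OF _ sym, rotated])
    qed
    moreover have "X t (\<lambda>i. x (i, 0)) y = 0" if "y \<notin> I" for y using that by (cases y) (auto simp: X_def)
    ultimately have "x y = X t (\<lambda>i. x (i, 0)) y" for y
      using supp by (cases "y \<in> I"; cases y) metis+
    then have "x = X t (\<lambda>i. x (i, 0))" ..
    then show ?thesis by blast
  next
    case False
    have "x = Xi (\<lambda>i. x (i, ns i))"
    proof
      fix y :: "nat \<times> nat"
      show "x y = Xi (\<lambda>i. x (i, ns i)) y"
        using False supp[of y] by (cases y) (force simp: Xi_def)
    qed
    then show ?thesis by blast
  qed
qed

lemma nonzero_X: "nonzero (X t a) \<longleftrightarrow> (\<exists>i\<in>{1..d}. a i \<noteq> 0)"
proof
  assume "\<exists>i\<in>{1..d}. a i \<noteq> 0"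
  then obtain i where "i \<in> {1..d}" "a i \<noteq> 0" by blast
  then have "X t a (i, 0) \<noteq> 0" by (simp add: X_def)
  then show "nonzero (X t a)" unfolding nonzero_def by blast
qed (auto simp: nonzero_def X_def split: if_splits)

lemma nonzero_Xi: "nonzero (Xi a) \<longleftrightarrow> (\<exists>i\<in>{1..d}. a i \<noteq> 0)"
proof
  assume "\<exists>i\<in>{1..d}. a i \<noteq> 0"
  then obtain i where "i \<in> {1..d}" "a i \<noteq> 0" by blast
  then have "Xi a (i, ns i) \<noteq> 0" by (simp add: Xi_def)
  then show "nonzero (Xi a)" unfolding nonzero_def by blast
qed (auto simp: nonzero_def Xi_def split: if_splits)

lemma tangent_minors:
  assumes v: "v \<in> tangent_space I C x" and y: "(j, k) \<in> J" "(j', k') \<in> J"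
  shows "v (j, k) * x (j', Suc k') + x (j, k) * v (j', Suc k')
       = v (j', k') * x (j, Suc k) + x (j', k') * v (j, Suc k)"
proof -
  let ?p = "\<lambda>x. x (j, k) * x (j', Suc k') - x (j', k') * x (j, Suc k) :: complex"
  have "?p \<in> polyfun" by (intro polyfun_diff polyfun.intros)
  moreover have "\<forall>a\<in>C. ?p a = 0" using y by (auto simp: scroll_cone_def)
  moreover have "\<forall>p\<in>polyfun. (\<forall>a\<in>C. p a = 0) \<longrightarrow>
      ((\<lambda>t. p (\<lambda>i. x i + t * v i)) has_field_derivative 0) (at 0)"
    using v by (simp add: tangent_space_def)
  ultimately have "((\<lambda>t. ?p (\<lambda>i. x i + t * v i)) has_field_derivative 0) (at 0)"
    by (elim ballE[of _ _ ?p]) auto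
  moreover have "((\<lambda>t. ?p (\<lambda>i. x i + t * v i)) has_field_derivative
      (v (j, k) * x (j', Suc k') + x (j, k) * v (j', Suc k')
       - (v (j', k') * x (j, Suc k) + x (j', k') * v (j, Suc k)))) (at 0)"
    by (auto intro!: derivative_eq_intros simp: algebra_simps)
  ultimately show ?thesis using DERIV_unique by fastforce
qed

text \<open>The linearized minors against a pivot column with \<open>a i \<noteq> 0\<close> give a
  recursion along each block, which bounds the tangent space from above. Varying \<open>t\<close>
  and \<open>a\<close> linearly gives curves realizing every vector of the bound.\<close>

lemma tangent_X:
  assumes a: "\<exists>i\<in>{1..d}. a i \<noteq> 0"
  shows "tangent_space I C (X t a) = V t a ` coord_space {0..d}"
proof (intro Set.set_eqI iffI)
  fix v assume v: "v \<in> tangent_space I C (X t a)"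
  obtain i where i: "i \<in> {1..d}" "a i \<noteq> 0" using a by blast
  have i0: "(i, 0) \<in> J" using i ns_pos by simp
  \<comment> \<open>Velocity of the ratio \<open>x (i, 1) / x (i, 0)\<close>, that is, of
    \<open>t\<close>.\<close>
  define \<tau> where "\<tau> = (v (i, 1) - t * v (i, 0)) / a i"
  define c where "c = (\<lambda>j. if j = 0 then \<tau> else if j \<in> {1..d} then v (j, 0) else 0)"
  have arith: "ai * w = ai * (t * vl + aj * T * z)"
    if "v0 * (aj * (t * T)) + ai * w = vl * (ai * t) + aj * T * v1" "ai * z = v1 - t * v0"
    for ai aj t T w v0 v1 vl z :: complex
  proof -
    have "v1 = ai * z + t * v0" using that(2) by simp
    with that(1) show ?thesis by (simp add: algebra_simps)
  qed
  have step: "v (j, Suc l) = t * v (j, l) + a j * t ^ l * \<tau>" if "(j, l) \<in> J" for j l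
  proof -
    have "v (i, 0) * X t a (j, Suc l) + X t a (i, 0) * v (j, Suc l)
       = v (j, l) * X t a (i, Suc 0) + X t a (j, l) * v (i, Suc 0)"
      by (rule tangent_minors[OF v i0 that])
    then have "v (i, 0) * (a j * t ^ Suc l) + a i * v (j, Suc l)
       = v (j, l) * (a i * t) + a j * t ^ l * v (i, Suc 0)"
      using that i i0 by (simp add: X_eq)
    moreover have "a i * \<tau> = v (i, Suc 0) - t * v (i, 0)" using i by (simp add: \<tau>_def)
    ultimately have "a i * v (j, Suc l) = a i * (t * v (j, l) + a j * t ^ l * \<tau>)"
      using arith[of "v (i, 0)" "a j" t "t ^ l" "a i" "v (j, Suc l)" "v (j, l)" "v (i, Suc 0)" \<tau>] by simp
    then show ?thesis using i by simp
  qed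
  have gen: "v (j, l) = v (j, 0) * t ^ l + of_nat l * a j * t ^ (l - 1) * \<tau>"
    if "j \<in> {1..d}" "l \<le> ns j" for j l
    using that(2)
  proof (induction l)
    case (Suc l)
    then have "v (j, Suc l) = t * (v (j, 0) * t ^ l + of_nat l * a j * t ^ (l - 1) * \<tau>) + a j * t ^ l * \<tau>"
      using step[of j l] that(1) by simp
    then show ?case by (cases l) (simp_all add: algebra_simps)
  qed simp
  have "v (j, l) = V t a c (j, l)" if "(j, l) \<in> I" for j l
  proof -
    have jl: "j \<in> {1..d}" "l \<le> ns j" using that by auto
    then have "V t a c (j, l) = v (j, 0) * t ^ l + of_nat l * a j * t ^ (l - 1) * \<tau>"
      by (simp add: V_def c_def)
    then show ?thesis using gen[OF jl] by (rule trans[OF _ sym, rotated])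
  qed
  moreover have "v y = V t a c y" if "y \<notin> I" for y
    using v that by (cases y) (auto simp: V_def tangent_space_def coord_space_def)
  ultimately have "v y = V t a c y" for y
    by (cases "y \<in> I"; cases y) metis+
  then have "v = V t a c" ..
  moreover have "c \<in> coord_space {0..d}" by (auto simp: c_def coord_space_def)
  ultimately show "v \<in> V t a ` coord_space {0..d}" by blast
next
  fix v assume "v \<in> V t a ` coord_space {0..d}"
  then obtain c where c: "v = V t a c" by blast
  show "v \<in> tangent_space I C (X t a)"
  proof (rule tangent_space_curve)
    show "v \<in> coord_space I" by (auto simp: c V_def coord_space_def)
    show "X (t + e * c 0) (\<lambda>i. a i + e * c i) \<in> C" for e by (rule X_in_C)
    show "((\<lambda>e. X (t + e * c 0) (\<lambda>i. a i + e * c i) y) has_field_derivative v y) (at 0)" for y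
      by (cases y) (auto simp: X_def c V_def intro!: derivative_eq_intros)
  qed simp
qed

lemma tangent_Xi:
  assumes a: "\<exists>i\<in>{1..d}. a i \<noteq> 0"
  shows "tangent_space I C (Xi a) = Vi a ` coord_space {0..d}"
proof (intro Set.set_eqI iffI)
  fix v assume v: "v \<in> tangent_space I C (Xi a)"
  obtain i where i: "i \<in> {1..d}" "a i \<noteq> 0" using a by blast
  obtain m where m: "ns i = Suc m" using i ns_pos[of i] by (cases "ns i") auto
  have i0: "(i, m) \<in> J" using i m by simp
  define c where "c = (\<lambda>j. if j = 0 then v (i, m) / a i else if j \<in> {1..d} then v (j, ns j) else 0)"
  have "v (j, l) = (if Suc l = ns j then a j * (v (i, m) / a i) else 0)" if "(j, l) \<in> J" for j l
  proof -
    have "v (i, m) * Xi a (j, Suc l) + Xi a (i, m) * v (j, Suc l)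
       = v (j, l) * Xi a (i, Suc m) + Xi a (j, l) * v (i, Suc m)"
      by (rule tangent_minors[OF v i0 that])
    then show ?thesis using that i m by (auto simp: Xi_eq field_simps split: if_splits)
  qed
  then have "v = Vi a c"
    using v by (auto simp: fun_eq_iff Vi_def c_def tangent_space_def coord_space_def)
  moreover have "c \<in> coord_space {0..d}" by (auto simp: c_def coord_space_def)
  ultimately show "v \<in> Vi a ` coord_space {0..d}" by blast
next
  fix v assume "v \<in> Vi a ` coord_space {0..d}"
  then obtain c where c: "v = Vi a c" by blast
  \<comment> \<open>A curve leaving [0:1] in the opposite chart, with base coordinate
    \<open>e * c 0\<close>. At \<open>e = 0\<close> the convention \<open>0 ^ 0 = 1\<close> leaves
    exactly the last entry of each block.\<close>
  define \<gamma> where "\<gamma> = (\<lambda>e (i, k). if (i, k) \<in> I then (a i + e * c i) * (e * c 0) ^ (ns i - k) else 0)"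
  have inC: "\<gamma> e \<in> C" for e
  proof -
    have "\<gamma> e (j, k) * \<gamma> e (j', Suc k') = \<gamma> e (j', k') * \<gamma> e (j, Suc k)"
      if "(j, k) \<in> J" "(j', k') \<in> J" for j k j' k'
    proof -
      have "ns j - k = Suc (ns j - Suc k)" "ns j' - k' = Suc (ns j' - Suc k')" using that by auto
      then show ?thesis using that by (simp add: \<gamma>_def)
    qed
    moreover have "\<gamma> e y = 0" if "y \<notin> I" for y using that by (cases y) (auto simp: \<gamma>_def)
    ultimately show ?thesis unfolding scroll_cone_def coord_space_def by simp
  qed
  show "v \<in> tangent_space I C (Xi a)"
  proof (rule tangent_space_curve)
    show "v \<in> coord_space I" by (auto simp: c Vi_def coord_space_def)
    show "\<gamma> e \<in> C" for e by (rule inC)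
    show "\<gamma> 0 = Xi a" by (auto simp: fun_eq_iff \<gamma>_def Xi_def)
    show "((\<lambda>e. \<gamma> e y) has_field_derivative v y) (at 0)" for y
    proof (cases y)
      case (Pair i k)
      consider "(i, k) \<notin> I" | "(i, k) \<in> I" "k = ns i" | "(i, k) \<in> I" "Suc k = ns i"
        | "(i, k) \<in> I" "Suc (Suc k) \<le> ns i" by force
      then show ?thesis
      proof cases
        case 1
        then have "(\<lambda>e. \<gamma> e y) = (\<lambda>e. 0)" "v y = 0" by (auto simp: Pair \<gamma>_def c Vi_def)
        then show ?thesis by simp
      next
        case 2
        then have "(\<lambda>e. \<gamma> e y) = (\<lambda>e. a i + e * c i)" "v y = c i" by (auto simp: Pair \<gamma>_def c Vi_def)
        then show ?thesis by (auto intro!: derivative_eq_intros)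
      next
        case 3
        then have "ns i - k = 1" by simp
        then have "(\<lambda>e. \<gamma> e y) = (\<lambda>e. (a i + e * c i) * (e * c 0))" "v y = a i * c 0"
          using 3 by (auto simp: Pair \<gamma>_def c Vi_def)
        then show ?thesis by (auto intro!: derivative_eq_intros)
      next
        case 4
        define n where "n = ns i - k - 2"
        have n: "ns i - k = Suc (Suc n)" using 4 by (simp add: n_def)
        then have "(\<lambda>e. \<gamma> e y) = (\<lambda>e. (a i + e * c i) * (e * c 0) ^ Suc (Suc n))" "v y = 0"
          using 4 by (auto simp: Pair \<gamma>_def c Vi_def)
        then show ?thesis by (auto intro!: derivative_eq_intros)
      qed
    qed
  qed
qed

lemma cdim_tangent:
  assumes "x \<in> C" "nonzero x"
  shows "cdim (tangent_space I C x) = cdim (coord_space {0..d} :: (nat \<Rightarrow> complex) set)"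
proof -
  consider t a where "x = X t a" | a where "x = Xi a" using C_param[OF assms(1)] by blast
  then show ?thesis
  proof cases
    case 1
    with assms obtain i where i: "i \<in> {1..d}" "a i \<noteq> 0" by (auto simp: nonzero_X)
    have "cdim (V t a ` coord_space {0..d}) = cdim (coord_space {0..d} :: (nat \<Rightarrow> complex) set)"
    proof (rule cdim_linear_image)
      fix u assume u: "u \<in> coord_space {0..d}" and z: "V t a u = (\<lambda>i. 0)"
      have *: "V t a u (j, 0) = 0" "V t a u (j, 1) = 0" for j using z by (auto simp: fun_eq_iff)
      have u1: "u j = 0" if "j \<in> {1..d}" for j using *(1)[of j] that by (auto simp: V_def)
      moreover have "u 0 = 0" using *(2)[of i] u1[of i] i ns_pos[of i] by (auto simp: V_def)
      ultimately show "u = (\<lambda>j. 0)" using u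
        by (auto simp: fun_eq_iff coord_space_def) (metis not_less_eq_eq le_zero_eq One_nat_def)
    qed (auto simp: V_def fun_eq_iff algebra_simps)
    moreover have "\<exists>i\<in>{1..d}. a i \<noteq> 0" using i by blast
    ultimately show ?thesis using 1 tangent_X[of a t] by simp
  next
    case 2
    with assms obtain i where i: "i \<in> {1..d}" "a i \<noteq> 0" by (auto simp: nonzero_Xi)
    obtain m where m: "ns i = Suc m" using i ns_pos[of i] by (cases "ns i") auto
    have "cdim (Vi a ` coord_space {0..d}) = cdim (coord_space {0..d} :: (nat \<Rightarrow> complex) set)"
    proof (rule cdim_linear_image)
      fix u assume u: "u \<in> coord_space {0..d}" and z: "Vi a u = (\<lambda>i. 0)"
      have *: "Vi a u (j, ns j) = 0" "Vi a u (i, m) = 0" for j using z by (auto simp: fun_eq_iff)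
      have u1: "u j = 0" if "j \<in> {1..d}" for j using *(1)[of j] that by (auto simp: Vi_def)
      moreover have "u 0 = 0" using *(2) i m by (auto simp: Vi_def)
      ultimately show "u = (\<lambda>j. 0)" using u
        by (auto simp: fun_eq_iff coord_space_def) (metis not_less_eq_eq le_zero_eq One_nat_def)
    qed (auto simp: Vi_def fun_eq_iff algebra_simps)
    moreover have "\<exists>i\<in>{1..d}. a i \<noteq> 0" using i by blast
    ultimately show ?thesis using 2 tangent_Xi[of a] by simp
  qed
qed

text \<open>Smoothness: the tangent dimension is constant on nonzero points, so its minimum is
  attained everywhere. Positivity of all \<open>ns i\<close> excludes the vertex that a cone would
  have.\<close>

lemma reg_points_C: "reg_points I C = {x \<in> C. nonzero x}"
proof -
  have "cdim (tangent_space I C x) = Min {cdim (tangent_space I C y) | y. y \<in> C \<and> nonzero y}"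
    if "x \<in> C" "nonzero x" for x
  proof -
    have "{cdim (tangent_space I C y) | y. y \<in> C \<and> nonzero y} = {cdim (tangent_space I C x)}"
      using that cdim_tangent by (auto intro!: exI[of _ x])
    then show ?thesis by simp
  qed
  then show ?thesis unfolding reg_points_def by blast
qed

subsection \<open>The conormal variety\<close>

lemma U_surj:
  assumes u: "u \<in> coord_space I" and root: "\<And>i. i \<in> {1..d} \<Longrightarrow> (\<Sum>k\<le>ns i. u (i, k) * t ^ k) = 0"
  shows "\<exists>g. u = U t g"
proof -
  \<comment> \<open>Horner's scheme: \<open>h i (Suc k)\<close> are the coefficients of the quotient
    by T - t, and \<open>h i 0\<close> is the remainder.\<close>
  define h where "h = (\<lambda>i k. \<Sum>l=k..ns i. u (i, l) * t ^ (l - k))"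
  have h: "h i k = u (i, k) + t * h i (Suc k)" if "k \<le> ns i" for i k
  proof -
    have "h i k = u (i, k) + (\<Sum>l=Suc k..ns i. u (i, l) * t ^ (l - k))"
      using that by (simp add: h_def sum.atLeast_Suc_atMost)
    also have "(\<Sum>l=Suc k..ns i. u (i, l) * t ^ (l - k)) = t * h i (Suc k)"
      unfolding h_def sum_distrib_left
    proof (intro sum.cong refl)
      fix l assume "l \<in> {Suc k..ns i}"
      then have "l - k = Suc (l - Suc k)" by auto
      then show "u (i, l) * t ^ (l - k) = t * (u (i, l) * t ^ (l - Suc k))" by simp
    qed
    finally show ?thesis .
  qed
  have h0: "h i 0 = 0" if "i \<in> {1..d}" for i
    using root[OF that] by (simp add: h_def atMost_atLeast0)
  have hn: "h i (Suc (ns i)) = 0" for i by (simp add: h_def)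
  have "u y = U t (\<lambda>(i, k). h i (Suc k)) y" for y
  proof (cases y)
    case (Pair i k)
    show ?thesis
    proof (cases "(i, k) \<in> I")
      case False
      then have "u (i, k) = 0" using u unfolding coord_space_def by blast
      moreover have "U t (\<lambda>(i, k). h i (Suc k)) (i, k) = 0" using False by (auto simp: U_def)
      ultimately show ?thesis using Pair by simp
    next
      case True
      then have "u (i, k) = h i k - t * h i (Suc k)" using h[of k i] by simp
      moreover have "k < ns i \<or> k = ns i" using True by auto
      ultimately show ?thesis using True Pair h0[of i] hn[of i] ns_pos[of i]
        by (cases k) (auto simp: U_def)
    qed
  qed
  then show ?thesis by blast
qed

lemma U_in_coord: "U t g \<in> coord_space I"
  by (auto simp: U_def coord_space_def)

lemma Ui_in_coord: "Ui g \<in> coord_space I"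
  by (auto simp: Ui_def coord_space_def)

text \<open>Vanishing at [0:1] means vanishing top coefficients. Dividing by the linear form of that
  point leaves the other coefficients unchanged, so \<open>u\<close> is its own quotient.\<close>

lemma Ui_self:
  assumes "u \<in> coord_space I" "\<And>i. i \<in> {1..d} \<Longrightarrow> u (i, ns i) = 0"
  shows "u = Ui u"
proof
  fix y show "u y = Ui u y"
  proof (cases "y \<in> J")
    case False
    then have "y \<notin> I \<or> (fst y \<in> {1..d} \<and> y = (fst y, ns (fst y)))" by (cases y) auto
    then have "u y = 0"
    proof (elim disjE conjE)
      assume "y \<notin> I" then show ?thesis using assms(1) unfolding coord_space_def by blast
    next
      assume "fst y \<in> {1..d}" and y: "y = (fst y, ns (fst y))"
      from assms(2)[OF this(1)] show ?thesis by (subst y)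
    qed
    then show ?thesis using False by (simp add: Ui_def)
  qed (simp add: Ui_def)
qed

lemma pairing_commute: "pairing A u v = pairing A v u"
  by (simp add: pairing_def mult.commute)

lemma pairing_U_V: "pairing I (U t g) (V t a c) = c 0 * (\<Sum>y\<in>J. a (fst y) * t ^ snd y * g y)"
  unfolding pairing_commute[of _ "U t g"] pairing_U sum_distrib_left
proof (intro sum.cong refl)
  fix y assume "y \<in> J"
  then obtain i k where y: "y = (i, k)" "i \<in> {1..d}" "k < ns i" by (cases y) auto
  then have "V t a c (i, Suc k) - t * V t a c (i, k) = c 0 * (a i * t ^ k)"
    by (cases k) (simp_all add: V_def algebra_simps)
  then show "(V t a c (fst y, Suc (snd y)) - t * V t a c y) * g y = c 0 * (a (fst y) * t ^ snd y * g y)"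
    using y by simp
qed

lemma pairing_V_unit: "i \<in> {1..d} \<Longrightarrow> pairing I u (V t a (\<lambda>j. if j = i then 1 else 0)) = (\<Sum>k\<le>ns i. u (i, k) * t ^ k)"
  unfolding pairing_I
  by (subst sum.remove[of _ i]) (auto simp: V_def intro!: sum.neutral sum.cong)

text \<open>Fibre directions force every \<open>f_i\<close> to vanish at \<open>t\<close>; the base
  direction then contributes the derivatives, and the derivative of (T - t) \<open>g_i\<close> at
  \<open>t\<close> is the value of \<open>g_i\<close> there.\<close>

lemma perp_X:
  assumes "\<exists>i\<in>{1..d}. a i \<noteq> 0" and "u \<in> coord_space I"
  shows "(\<forall>v\<in>tangent_space I C (X t a). pairing I u v = 0) \<longleftrightarrow>
    (\<exists>g. u = U t g \<and> (\<Sum>y\<in>J. a (fst y) * t ^ snd y * g y) = 0)" (is "?l \<longleftrightarrow> ?r")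
proof
  assume ?l
  then have *: "pairing I u (V t a c) = 0" if "c \<in> coord_space {0..d}" for c
    using that tangent_X[OF assms(1)] by blast
  have "(\<Sum>k\<le>ns i. u (i, k) * t ^ k) = 0" if "i \<in> {1..d}" for i
    using *[of "\<lambda>j. if j = i then 1 else 0"] that by (simp add: pairing_V_unit coord_space_def)
  then obtain g where g: "u = U t g" using U_surj[OF assms(2)] by blast
  with *[of "\<lambda>j. if j = 0 then 1 else 0"]
  show ?r by (auto simp: pairing_U_V coord_space_def)
qed (auto simp: tangent_X[OF assms(1)] pairing_U_V)

lemma pairing_Ui_Vi: "pairing I (Ui g) (Vi a c) = c 0 * (\<Sum>i=1..d. a i * g (i, ns i - 1))"
  unfolding pairing_commute[of _ "Ui g"] pairing_Ui sum_distrib_left sum_J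
proof (intro sum.cong refl)
  fix i assume i: "i \<in> {1..d}"
  have "(\<Sum>k<ns i. Vi a c (i, k) * g (i, k)) = (\<Sum>k<ns i. if k = ns i - 1 then c 0 * (a i * g (i, k)) else 0)"
    using i by (intro sum.cong) (auto simp: Vi_def)
  then show "(\<Sum>k<ns i. Vi a c (i, k) * g (i, k)) = c 0 * (a i * g (i, ns i - 1))"
    using ns_pos[OF i] by simp
qed

lemma pairing_Vi_unit: "i \<in> {1..d} \<Longrightarrow> pairing I u (Vi a (\<lambda>j. if j = i then 1 else 0)) = u (i, ns i)"
proof -
  assume i: "i \<in> {1..d}"
  have "(\<Sum>k\<le>ns i'. u (i', k) * Vi a (\<lambda>j. if j = i then 1 else 0) (i', k))
      = (\<Sum>k\<le>ns i'. if k = ns i' then if i' = i then u (i, ns i) else 0 else 0)"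
    if "i' \<in> {1..d}" for i'
    using that i by (intro sum.cong) (auto simp: Vi_def)
  then have "pairing I u (Vi a (\<lambda>j. if j = i then 1 else 0)) = (\<Sum>i'=1..d. if i' = i then u (i, ns i) else 0)"
    unfolding pairing_I by simp
  then show ?thesis using i by simp
qed

lemma perp_Xi:
  assumes "\<exists>i\<in>{1..d}. a i \<noteq> 0" and "u \<in> coord_space I"
  shows "(\<forall>v\<in>tangent_space I C (Xi a). pairing I u v = 0) \<longleftrightarrow>
    (\<exists>g. u = Ui g \<and> (\<Sum>i=1..d. a i * g (i, ns i - 1)) = 0)" (is "?l \<longleftrightarrow> ?r")
proof
  assume ?l
  then have *: "pairing I u (Vi a c) = 0" if "c \<in> coord_space {0..d}" for c
    using that tangent_Xi[OF assms(1)] by blast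
  have z: "u (i, ns i) = 0" if "i \<in> {1..d}" for i
    using *[of "\<lambda>j. if j = i then 1 else 0"] that by (simp add: pairing_Vi_unit coord_space_def)
  then have g: "u = Ui u" by (rule Ui_self[OF assms(2)])
  have "pairing I (Ui u) (Vi a (\<lambda>j. if j = 0 then 1 else 0)) = 0"
    using *[of "\<lambda>j. if j = 0 then 1 else 0"] g by (simp add: coord_space_def)
  with g show ?r unfolding pairing_Ui_Vi by auto
qed (auto simp: tangent_Xi[OF assms(1)] pairing_Ui_Vi)

lemma conormal_cone_eq: "conormal_cone I C = zclosure {pr x u | x u. x \<in> C \<and> nonzero x \<and>
    u \<in> coord_space I \<and> nonzero u \<and> (\<forall>v\<in>tangent_space I C x. pairing I u v = 0)}"
  unfolding conormal_cone_def reg_points_C by (simp add: conj_assoc)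

lemma conormal_coneD:
  assumes "pr x u \<in> conormal_cone I C" "p \<in> polyfun"
    and "\<And>x u. x \<in> C \<Longrightarrow> nonzero x \<Longrightarrow> u \<in> coord_space I \<Longrightarrow>
      (\<forall>v\<in>tangent_space I C x. pairing I u v = 0) \<Longrightarrow> p (pr x u) = 0"
  shows "p (pr x u) = 0"
proof -
  have "(\<forall>a\<in>{pr x u | x u. x \<in> C \<and> nonzero x \<and>
    u \<in> coord_space I \<and> nonzero u \<and> (\<forall>v\<in>tangent_space I C x. pairing I u v = 0)}. p a = 0)"
    using assms(3) by blast
  then show ?thesis using assms(1,2) unfolding conormal_cone_eq zclosure_def by blast
qed

text \<open>If a field depends polynomially on the point and is tangent at each nonzero point of the
  cone, orthogonality to it is a polynomial equation in the pair and so passes to the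
  closure.\<close>

lemma conormal_tangent_field:
  assumes "pr x u \<in> conormal_cone I C"
    and "\<And>y. (\<lambda>z :: (nat \<times> nat) + (nat \<times> nat) \<Rightarrow> complex. f (\<lambda>y. z (Inl y)) y) \<in> polyfun"
    and "\<And>x. x \<in> C \<Longrightarrow> nonzero x \<Longrightarrow> f x \<in> tangent_space I C x"
  shows "pairing I u (f x) = 0"
proof -
  let ?p = "\<lambda>z. \<Sum>i\<in>I. z (Inr i) * f (\<lambda>y. z (Inl y)) i"
  have "?p \<in> polyfun"
    by (intro polyfun_sum polyfun.mult polyfun.coord assms(2) finite_I)
  from conormal_coneD[OF assms(1) this] assms(3) show ?thesis
    by (simp add: pr_def pairing_def)
qed

lemma conormal_in_C:
  assumes "pr x u \<in> conormal_cone I C"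
  shows "x \<in> C" "u \<in> coord_space I"
proof -
  have "x y = 0" if "y \<notin> I" for y
  proof -
    have "pr x u (Inl y) = 0"
      by (rule conormal_coneD[OF assms polyfun.coord])
         (simp add: pr_def coord_spaceD[OF C_coord that])
    then show ?thesis by (simp add: pr_def)
  qed
  moreover have "x (j, k) * x (j', Suc k') = x (j', k') * x (j, Suc k)"
    if "(j, k) \<in> J" "(j', k') \<in> J" for j k j' k'
  proof -
    have "(\<lambda>z. z (Inl (j, k)) * z (Inl (j', Suc k')) - z (Inl (j', k')) * z (Inl (j, Suc k))) \<in> polyfun"
      by (intro polyfun_diff polyfun.intros)
    from conormal_coneD[OF assms this] that show ?thesis by (simp add: pr_def scroll_cone_def)
  qed
  ultimately show "x \<in> C" by (simp add: scroll_cone_def coord_space_def)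
  have "u y = 0" if "y \<notin> I" for y
  proof -
    have "pr x u (Inr y) = 0"
      by (rule conormal_coneD[OF assms polyfun.coord])
         (simp add: pr_def coord_spaceD[OF _ that])
    then show ?thesis by (simp add: pr_def)
  qed
  then show "u \<in> coord_space I" by (simp add: coord_space_def)
qed

lemma tangent_cases:
  assumes "x \<in> C" "nonzero x"
    and "\<And>t a. x = X t a \<Longrightarrow> \<exists>c\<in>coord_space {0..d}. v = V t a c"
    and "\<And>a. x = Xi a \<Longrightarrow> \<exists>c\<in>coord_space {0..d}. v = Vi a c"
  shows "v \<in> tangent_space I C x"
proof -
  consider t a where "x = X t a" | a where "x = Xi a" using C_param[OF assms(1)] by blast
  then show ?thesis
  proof cases
    case 1
    then have a: "\<exists>i\<in>{1..d}. a i \<noteq> 0" using assms(2) nonzero_X by blast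
    show ?thesis unfolding 1 tangent_X[OF a] using assms(3)[OF 1] by blast
  next
    case 2
    then have a: "\<exists>i\<in>{1..d}. a i \<noteq> 0" using assms(2) nonzero_Xi by blast
    show ?thesis unfolding 2 tangent_Xi[OF a] using assms(4)[OF 2] by blast
  qed
qed

text \<open>Three polynomial vector fields tangent to the scroll; together they span enough of each
  tangent space that orthogonality to them is a closed condition cutting out the conormal variety.\<close>

lemma tangent_field_power:
  assumes x: "x \<in> C" "nonzero x" and "(i, l) \<in> J" "j \<in> {1..d}"
  shows "(\<lambda>y. if fst y = j \<and> snd y \<le> ns j then x (i, Suc l) ^ snd y * x (i, l) ^ (ns j - snd y) else 0)
     \<in> tangent_space I C x"
proof (rule tangent_cases[OF x])
  fix t a assume xa: "x = X t a"
  let ?c = "\<lambda>m. if m = j then (a i * t ^ l) ^ ns j else 0"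
  have "(a i * t ^ Suc l) ^ k * (a i * t ^ l) ^ (ns j - k) = (a i * t ^ l) ^ ns j * t ^ k"
    if "k \<le> ns j" for k
  proof -
    have "(a i * t ^ Suc l) ^ k * (a i * t ^ l) ^ (ns j - k)
      = (a i * t ^ l) ^ k * (a i * t ^ l) ^ (ns j - k) * t ^ k"
      by (simp add: power_mult_distrib mult_ac)
    also have "(a i * t ^ l) ^ k * (a i * t ^ l) ^ (ns j - k) = (a i * t ^ l) ^ ns j"
      using that by (simp flip: power_add)
    finally show ?thesis .
  qed
  then show "\<exists>c\<in>coord_space {0..d}. (\<lambda>y. if fst y = j \<and> snd y \<le> ns j
      then x (i, Suc l) ^ snd y * x (i, l) ^ (ns j - snd y) else 0) = V t a c"
    using assms(3,4) by (intro bexI[of _ ?c]) (auto simp: xa V_def X_eq coord_space_def fun_eq_iff)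
next
  fix a assume xa: "x = Xi a"
  let ?c = "\<lambda>m. if m = j then x (i, Suc l) ^ ns j else 0"
  have "x (i, l) = 0" using assms by (simp add: xa Xi_eq)
  then show "\<exists>c\<in>coord_space {0..d}. (\<lambda>y. if fst y = j \<and> snd y \<le> ns j
      then x (i, Suc l) ^ snd y * x (i, l) ^ (ns j - snd y) else 0) = Vi a c"
    using assms(3,4) by (intro bexI[of _ ?c]) (auto simp: Vi_def coord_space_def power_0_left fun_eq_iff)
qed

text \<open>The velocity of the translations of the base line, with \<open>t\<close> moving at speed
  1. It vanishes over [0:1], so it yields the incidence equation only over finite
  \<open>t\<close>.\<close>

lemma tangent_field_down:
  assumes x: "x \<in> C" "nonzero x"
  shows "(\<lambda>y. if y \<in> I then of_nat (snd y) * x (fst y, snd y - 1) else 0) \<in> tangent_space I C x"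
proof (rule tangent_cases[OF x])
  fix t a assume xa: "x = X t a"
  show "\<exists>c\<in>coord_space {0..d}. (\<lambda>y. if y \<in> I then of_nat (snd y) * x (fst y, snd y - 1) else 0) = V t a c"
    by (intro bexI[of _ "\<lambda>m. if m = 0 then 1 else 0"]) (auto simp: xa V_def X_eq coord_space_def fun_eq_iff)
next
  fix a assume xa: "x = Xi a"
  have "of_nat k * x (i, k - 1) = 0" if "(i, k) \<in> I" for i k
    using that ns_pos[of i] by (cases k) (auto simp: xa Xi_eq)
  then show "\<exists>c\<in>coord_space {0..d}. (\<lambda>y. if y \<in> I then of_nat (snd y) * x (fst y, snd y - 1) else 0) = Vi a c"
    by (intro bexI[of _ "\<lambda>m. 0"]) (auto simp: Vi_def coord_space_def)
qed

text \<open>The translation field of the opposite chart: over finite \<open>t\<close> its base speed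
  is \<open>- (t ^ 2)\<close>, and over [0:1], where the previous field vanishes, it is the pure
  base direction.\<close>

lemma tangent_field_up:
  assumes x: "x \<in> C" "nonzero x"
  shows "(\<lambda>y. if y \<in> J then of_nat (ns (fst y) - snd y) * x (fst y, Suc (snd y)) else 0) \<in> tangent_space I C x"
proof (rule tangent_cases[OF x])
  fix t a assume xa: "x = X t a"
  let ?c = "\<lambda>m. if m = 0 then - (t ^ 2) else if m \<in> {1..d} then of_nat (ns m) * a m * t else 0"
  have id: "of_nat (n - k) * (b * t ^ Suc k) = of_nat n * b * t * t ^ k + of_nat k * b * t ^ (k - 1) * (- (t ^ 2))"
    if "k \<le> n" for n k b using that
    by (cases k) (simp_all add: of_nat_diff algebra_simps power2_eq_square)
  have "(if (i, k) \<in> J then of_nat (ns i - k) * x (i, Suc k) else 0) = V t a ?c (i, k)" for i k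
  proof (cases "(i, k) \<in> I")
    case True
    then have "V t a ?c (i, k) = of_nat (ns i - k) * (a i * t ^ Suc k)"
      using id[of k "ns i" "a i"] by (simp add: V_def)
    then show ?thesis using True by (auto simp: xa X_eq)
  next
    case False
    then show ?thesis by (auto simp: V_def)
  qed
  then have "(\<lambda>y. if y \<in> J then of_nat (ns (fst y) - snd y) * x (fst y, Suc (snd y)) else 0) = V t a ?c"
    unfolding fun_eq_iff by (simp only: split_paired_All fst_conv snd_conv) blast
  moreover have "?c \<in> coord_space {0..d}" by (auto simp: coord_space_def)
  ultimately show "\<exists>c\<in>coord_space {0..d}.
      (\<lambda>y. if y \<in> J then of_nat (ns (fst y) - snd y) * x (fst y, Suc (snd y)) else 0) = V t a c"
    by blast
next
  fix a assume xa: "x = Xi a"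
  show "\<exists>c\<in>coord_space {0..d}.
      (\<lambda>y. if y \<in> J then of_nat (ns (fst y) - snd y) * x (fst y, Suc (snd y)) else 0) = Vi a c"
    by (intro bexI[of _ "\<lambda>m. if m = 0 then 1 else 0"]) (auto simp: xa Xi_eq Vi_def coord_space_def fun_eq_iff simp del: of_nat_diff dest!: sym[of "Suc _"])
qed

text \<open>Taking the closure adds nothing over a nonzero \<open>x\<close>: the power fields return
  the common root of the forms, and the down field (over finite \<open>t\<close>) or the up field
  (over [0:1]) returns the incidence equation.\<close>

lemma conormal_perp:
  assumes xu: "pr x u \<in> conormal_cone I C" and x: "nonzero x"
  shows "\<forall>v\<in>tangent_space I C x. pairing I u v = 0"
proof -
  note xC = conormal_in_C(1)[OF xu]
  have e1: "pairing I u (\<lambda>y. if fst y = j \<and> snd y \<le> ns j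
      then x (i, Suc l) ^ snd y * x (i, l) ^ (ns j - snd y) else 0) = 0"
    if "(i, l) \<in> J" "j \<in> {1..d}" for i j l
    by (rule conormal_tangent_field[OF xu _ tangent_field_power[OF _ _ that]])
       (intro polyfun_if polyfun.mult polyfun_power polyfun.coord polyfun.const)
  have e2: "pairing I u (\<lambda>y. if y \<in> I then of_nat (snd y) * x (fst y, snd y - 1) else 0) = 0"
    by (rule conormal_tangent_field[OF xu _ tangent_field_down])
       (intro polyfun_if polyfun.mult polyfun_power polyfun.coord polyfun.const)
  have e3: "pairing I u (\<lambda>y. if y \<in> J then of_nat (ns (fst y) - snd y) * x (fst y, Suc (snd y)) else 0) = 0"
    by (rule conormal_tangent_field[OF xu _ tangent_field_up])
       (intro polyfun_if polyfun.mult polyfun_power polyfun.coord polyfun.const)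
  have block: "pairing I u (\<lambda>y. if fst y = j \<and> snd y \<le> ns j then h (snd y) else 0)
      = (\<Sum>k\<le>ns j. u (j, k) * h k)" if "j \<in> {1..d}" for j and h :: "nat \<Rightarrow> complex"
    unfolding pairing_I using that
    by (subst sum.remove[of _ j]) (auto intro!: sum.neutral sum.cong)
  consider t a where "x = X t a" | a where "x = Xi a" using C_param[OF xC] by blast
  then show ?thesis
  proof cases
    case 1
    then have a: "\<exists>i\<in>{1..d}. a i \<noteq> 0" using x nonzero_X by blast
    then obtain i where i: "i \<in> {1..d}" "a i \<noteq> 0" by blast
    have root: "(\<Sum>k\<le>ns j. u (j, k) * t ^ k) = 0" if j: "j \<in> {1..d}" for j
    proof -
      \<comment> \<open>The first column of block \<open>i\<close> is the pivot: its upper entry is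
        \<open>a i\<close>, nonzero even if \<open>t = 0\<close>.\<close>
      have "(\<Sum>k\<le>ns j. u (j, k) * (x (i, Suc 0) ^ k * x (i, 0) ^ (ns j - k))) = 0"
        using e1[of i 0 j] i ns_pos[of i] block[OF j, of "\<lambda>k. x (i, Suc 0) ^ k * x (i, 0) ^ (ns j - k)"] j
        by simp
      moreover have "u (j, k) * (x (i, Suc 0) ^ k * x (i, 0) ^ (ns j - k)) = a i ^ ns j * (u (j, k) * t ^ k)"
        if "k \<le> ns j" for k
      proof -
        have "a i ^ k * a i ^ (ns j - k) = a i ^ ns j" using that by (simp flip: power_add)
        then show ?thesis using i ns_pos[of i]
          by (simp add: 1 X_eq power_mult_distrib)
      qed
      ultimately have "a i ^ ns j * (\<Sum>k\<le>ns j. u (j, k) * t ^ k) = 0"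
        by (simp add: sum_distrib_left)
      then show ?thesis using i by simp
    qed
    obtain g where g: "u = U t g" using U_surj[OF conormal_in_C(2)[OF xu] root] by blast
    have "(\<lambda>y. if y \<in> I then of_nat (snd y) * x (fst y, snd y - 1) else 0) = V t a (\<lambda>m. if m = 0 then 1 else 0)"
      by (auto simp: 1 V_def X_eq fun_eq_iff)
    then have "(\<Sum>y\<in>J. a (fst y) * t ^ snd y * g y) = 0"
      using e2 pairing_U_V[of t g a "\<lambda>m. if m = 0 then 1 else 0"] g by simp
    then show ?thesis unfolding 1 perp_X[OF a conormal_in_C(2)[OF xu]] using g by blast
  next
    case 2
    then have a: "\<exists>i\<in>{1..d}. a i \<noteq> 0" using x nonzero_Xi by blast
    then obtain i where i: "i \<in> {1..d}" "a i \<noteq> 0" by blast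
    obtain m where m: "ns i = Suc m" using i ns_pos[of i] by (cases "ns i") auto
    have z: "u (j, ns j) = 0" if j: "j \<in> {1..d}" for j
    proof -
      \<comment> \<open>Over [0:1] the pivot is the last column of block \<open>i\<close>, with
        upper entry 0, so only the term \<open>k = ns j\<close> remains.\<close>
      have "(\<Sum>k\<le>ns j. u (j, k) * (x (i, Suc m) ^ k * x (i, m) ^ (ns j - k))) = 0"
        using e1[of i m j] i m block[OF j, of "\<lambda>k. x (i, Suc m) ^ k * x (i, m) ^ (ns j - k)"] j
        by simp
      moreover have "u (j, k) * (x (i, Suc m) ^ k * x (i, m) ^ (ns j - k))
          = (if k = ns j then u (j, k) * a i ^ ns j else 0)" if "k \<le> ns j" for k
        using i m that by (auto simp: 2 Xi_eq)
      ultimately have "(\<Sum>k\<le>ns j. if k = ns j then u (j, k) * a i ^ ns j else 0) = 0" by simp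
      then show ?thesis using i by simp
    qed
    then have g: "u = Ui u" by (rule Ui_self[OF conormal_in_C(2)[OF xu]])
    have "(\<lambda>y. if y \<in> J then of_nat (ns (fst y) - snd y) * x (fst y, Suc (snd y)) else 0)
        = Vi a (\<lambda>m. if m = 0 then 1 else 0)"
      by (auto simp: 2 Xi_eq Vi_def fun_eq_iff simp del: of_nat_diff dest!: sym[of "Suc _"])
    then have "pairing I (Ui u) (Vi a (\<lambda>m. if m = 0 then 1 else 0)) = 0"
      using e3 g by simp
    then have "(\<Sum>i=1..d. a i * u (i, ns i - 1)) = 0" unfolding pairing_Ui_Vi by simp
    then show ?thesis unfolding 2 perp_Xi[OF a conormal_in_C(2)[OF xu]] using g by blast
  qed
qed

theorem conormal_cone_iff:
  assumes "nonzero x" "nonzero u"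
  shows "pr x u \<in> conormal_cone I C \<longleftrightarrow>
     (\<exists>t a g. x = X t a \<and> u = U t g \<and> (\<Sum>y\<in>J. a (fst y) * t ^ snd y * g y) = 0) \<or>
     (\<exists>a g. x = Xi a \<and> u = Ui g \<and> (\<Sum>i=1..d. a i * g (i, ns i - 1)) = 0)" (is "?l \<longleftrightarrow> ?r")
proof
  assume l: ?l
  note in_C = conormal_in_C[OF l] and perp = conormal_perp[OF l assms(1)]
  consider t a where "x = X t a" | a where "x = Xi a" using C_param[OF in_C(1)] by blast
  then show ?r
  proof cases
    case 1
    then have "\<exists>i\<in>{1..d}. a i \<noteq> 0" using assms(1) nonzero_X by blast
    then show ?thesis using perp_X in_C(2) perp 1 by blast
  next
    case 2
    then have "\<exists>i\<in>{1..d}. a i \<noteq> 0" using assms(1) nonzero_Xi by blast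
    then show ?thesis using perp_Xi in_C(2) perp 2 by blast
  qed
next
  assume ?r
  then have "x \<in> C \<and> u \<in> coord_space I \<and> (\<forall>v\<in>tangent_space I C x. pairing I u v = 0)"
  proof (elim disjE exE conjE)
    fix t a g assume *: "x = X t a" "u = U t g" "(\<Sum>y\<in>J. a (fst y) * t ^ snd y * g y) = 0"
    then have a: "\<exists>i\<in>{1..d}. a i \<noteq> 0" using assms(1) nonzero_X by blast
    then show ?thesis using perp_X[OF a U_in_coord[of t g], of t] * X_in_C U_in_coord by blast
  next
    fix a g assume *: "x = Xi a" "u = Ui g" "(\<Sum>i=1..d. a i * g (i, ns i - 1)) = 0"
    then have a: "\<exists>i\<in>{1..d}. a i \<noteq> 0" using assms(1) nonzero_Xi by blast
    then show ?thesis using perp_Xi[OF a Ui_in_coord[of g]] * Xi_in_C Ui_in_coord by blast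
  qed
  with assms show ?l unfolding conormal_cone_eq zclosure_def by blast
qed

end

subsection \<open>Determinants of families of rows\<close>

text \<open>Columns are indexed by an arbitrary finite set, enumerated by \<open>e\<close>.\<close>

definition rdet :: "(nat \<Rightarrow> 'b) \<Rightarrow> nat \<Rightarrow> (nat \<Rightarrow> 'b \<Rightarrow> 'a) \<Rightarrow> 'a :: comm_ring_1" where
  "rdet e n R = det (mat n n (\<lambda>(r, c). R r (e c)))"

text \<open>A cofactor as a determinant with a unit row, so that facts about \<open>rdet\<close> on
  evaluation, degree and polynomial dependence apply to it directly.\<close>

definition cof :: "(nat \<Rightarrow> 'b) \<Rightarrow> nat \<Rightarrow> (nat \<Rightarrow> 'b \<Rightarrow> 'a) \<Rightarrow> nat \<Rightarrow> 'b \<Rightarrow> 'a :: comm_ring_1" where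
  "cof e n R r y = rdet e n (R(r := (\<lambda>z. if z = y then 1 else 0)))"

lemma poly_rdet: "poly (rdet e n R) t = rdet e n (\<lambda>r y. poly (R r y) t)"
proof -
  interpret comm_ring_hom "\<lambda>p :: 'a poly. poly p t" by unfold_locales auto
  have "map_mat (\<lambda>p. poly p t) (mat n n (\<lambda>(r, c). R r (e c))) = mat n n (\<lambda>(r, c). poly (R r (e c)) t)"
    by auto
  then show ?thesis unfolding rdet_def hom_det[symmetric] by simp
qed

lemma poly_cof: "poly (cof e n R r y) t = cof e n (\<lambda>r y. poly (R r y) t) r y"
  unfolding cof_def poly_rdet by (auto intro!: arg_cong[of _ _ "rdet e n"] simp: fun_eq_iff)

lemma rdet_identical_rows:
  assumes "r < n" "r' < n" "r \<noteq> r'" "R r = R r'"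
  shows "rdet e n R = 0"
  unfolding rdet_def by (rule det_identical_rows[of _ n r r']) (use assms in auto)

context
  fixes e :: "nat \<Rightarrow> 'b" and n :: nat and S :: "'b set"
  assumes e: "bij_betw e {..<n} S"
begin

lemma rdet_cong:
  assumes "\<And>r y. r < n \<Longrightarrow> y \<in> S \<Longrightarrow> R r y = R' r y"
  shows "rdet e n R = rdet e n R'"
proof -
  have "e c \<in> S" if "c < n" for c using e that by (auto simp: bij_betw_def)
  then have "mat n n (\<lambda>(r, c). R r (e c)) = mat n n (\<lambda>(r, c). R' r (e c))"
    using assms by auto
  then show ?thesis by (simp add: rdet_def)
qed

lemma rdet_expand_row:
  assumes r: "r < n"
  shows "rdet e n (R(r := w)) = (\<Sum>y\<in>S. w y * cof e n R r y)"
proof -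
  let ?M = "\<lambda>w. mat n n (\<lambda>(r', c). (R(r := w)) r' (e c))"
  have del: "mat_delete (?M w) r c = mat_delete (?M w') r c" if "c < n" for w w' c
    using r that by (intro eq_matI) (auto simp: mat_delete_def)
  \<comment> \<open>Cofactors along row \<open>r\<close> do not see that row, so the ones of
    \<open>w\<close> serve for every replacement row.\<close>
  define K where "K c = cofactor (?M w) r c" for c
  have K: "rdet e n (R(r := w')) = (\<Sum>c<n. w' (e c) * K c)" for w'
  proof -
    have "rdet e n (R(r := w')) = (\<Sum>c<n. ?M w' $$ (r, c) * cofactor (?M w') r c)"
      unfolding rdet_def by (rule laplace_expansion_row) (use r in auto)
    also have "\<dots> = (\<Sum>c<n. w' (e c) * K c)"
      using r del[of _ w' w] by (intro sum.cong) (auto simp: K_def cofactor_def)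
    finally show ?thesis .
  qed
  have inj: "inj_on e {..<n}" using e by (simp add: bij_betw_def)
  have "cof e n R r (e c) = K c" if c: "c < n" for c
  proof -
    have "cof e n R r (e c) = (\<Sum>c'<n. (if e c' = e c then 1 else 0) * K c')"
      unfolding cof_def K ..
    also have "\<dots> = (\<Sum>c'<n. if c' = c then K c' else 0)"
      using c inj by (intro sum.cong) (auto simp: inj_on_def)
    finally show ?thesis using c by simp
  qed
  then have "rdet e n (R(r := w)) = (\<Sum>c<n. w (e c) * cof e n R r (e c))"
    unfolding K by simp
  also have "\<dots> = (\<Sum>y\<in>S. w y * cof e n R r y)"
    by (rule sum.reindex_bij_betw[OF e])
  finally show ?thesis .
qed

lemma rdet_zero_row:
  assumes "r < n" "\<And>y. y \<in> S \<Longrightarrow> R r y = 0"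
  shows "rdet e n R = 0"
  using rdet_expand_row[OF assms(1), of R "R r"] assms(2) by simp

lemma cof_kernel:
  assumes "r < n" "r' < n"
  shows "(\<Sum>y\<in>S. R r' y * cof e n R r y) = (if r' = r then rdet e n R else 0)"
  unfolding rdet_expand_row[OF assms(1), symmetric] using assms
  by (auto intro!: rdet_identical_rows[of r n r'])

text \<open>Each Leibniz term meets every row and every column once, so row and column weights add
  up. Column weights \<open>ns\<close> serve the rows on \<open>a\<close>, row weights the rows on
  \<open>g\<close>.\<close>

lemma degree_rdet:
  fixes R :: "nat \<Rightarrow> 'b \<Rightarrow> 'a :: idom poly"
  assumes "\<And>r y. r < n \<Longrightarrow> y \<in> S \<Longrightarrow> degree (R r y) \<le> \<alpha> r + \<beta> y"
  shows "degree (rdet e n R) \<le> (\<Sum>r<n. \<alpha> r) + (\<Sum>y\<in>S. \<beta> y)"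
proof -
  have "degree (signof p * (\<Prod>r = 0..<n. R r (e (p r)))) \<le> (\<Sum>r<n. \<alpha> r) + (\<Sum>y\<in>S. \<beta> y)"
    if p: "p permutes {0..<n}" for p
  proof -
    have "degree (signof p * (\<Prod>r = 0..<n. R r (e (p r)))) \<le> degree (\<Prod>r = 0..<n. R r (e (p r)))"
      by (simp add: sign_def)
    also have "\<dots> \<le> (\<Sum>r = 0..<n. degree (R r (e (p r))))"
      using degree_prod_sum_le[of "{0..<n}" "\<lambda>r. R r (e (p r))"] by (simp add: o_def)
    also have "\<dots> \<le> (\<Sum>r = 0..<n. \<alpha> r + \<beta> (e (p r)))"
    proof (intro sum_mono)
      fix r assume "r \<in> {0..<n}"
      then have "r < n" "p r < n" using permutes_in_image[OF p, of r] by auto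
      then show "degree (R r (e (p r))) \<le> \<alpha> r + \<beta> (e (p r))"
        using assms e by (auto simp: bij_betw_def)
    qed
    also have "\<dots> = (\<Sum>r<n. \<alpha> r) + (\<Sum>r = 0..<n. \<beta> (e (p r)))"
      by (simp add: sum.distrib atLeast0LessThan)
    also have "(\<Sum>r = 0..<n. \<beta> (e (p r))) = (\<Sum>c = 0..<n. \<beta> (e c))"
      using sum.permute[OF p, of "\<lambda>c. \<beta> (e c)"] by (simp add: o_def)
    also have "\<dots> = (\<Sum>y\<in>S. \<beta> y)"
      unfolding atLeast0LessThan by (rule sum.reindex_bij_betw[OF e])
    finally show ?thesis .
  qed
  moreover have "rdet e n R = (\<Sum>p\<in>{p. p permutes {0..<n}}. signof p * (\<Prod>r = 0..<n. R r (e (p r))))"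
  proof -
    have "(\<Prod>r = 0..<n. mat n n (\<lambda>(r, c). R r (e c)) $$ (r, p r)) = (\<Prod>r = 0..<n. R r (e (p r)))"
      if "p permutes {0..<n}" for p
      using permutes_in_image[OF that] by (intro prod.cong) auto
    then show ?thesis unfolding rdet_def by (subst det_def'[of _ n]) auto
  qed
  ultimately show ?thesis by (auto intro!: degree_sum_le finite_permutations)
qed

lemma rdet_zero_iff:
  fixes R :: "nat \<Rightarrow> 'b \<Rightarrow> 'a :: field"
  shows "rdet e n R = 0 \<longleftrightarrow> (\<exists>v. (\<exists>y\<in>S. v y \<noteq> 0) \<and> (\<forall>r<n. (\<Sum>y\<in>S. R r y * v y) = 0))"
proof -
  let ?M = "mat n n (\<lambda>(r, c). R r (e c))"
  have M: "?M \<in> carrier_mat n n" by simp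
  have S: "S = e ` {..<n}" and inj: "inj_on e {..<n}" using e by (auto simp: bij_betw_def)
  have sum_S: "(\<Sum>y\<in>S. f y) = (\<Sum>c = 0..<n. f (e c))" for f :: "'b \<Rightarrow> 'a"
    unfolding atLeast0LessThan by (rule sum.reindex_bij_betw[OF e, symmetric])
  show ?thesis unfolding rdet_def det_0_iff_vec_prod_zero_field[OF M]
  proof (intro iffI; elim exE conjE)
    fix v assume v: "v \<in> carrier_vec n" "v \<noteq> 0\<^sub>v n" "?M *\<^sub>v v = 0\<^sub>v n"
    define v' where "v' y = v $ (the_inv_into {..<n} e y)" for y
    have v': "v' (e c) = v $ c" if "c < n" for c
      using that by (simp add: v'_def the_inv_into_f_f[OF inj])
    have "(\<Sum>c = 0..<n. R r (e c) * v $ c) = 0" if "r < n" for r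
    proof -
      have "(?M *\<^sub>v v) $ r = 0" using v that by simp
      then show ?thesis using v(1) that by (simp add: scalar_prod_def)
    qed
    then have "\<forall>r<n. (\<Sum>y\<in>S. R r y * v' y) = 0" unfolding sum_S by (simp add: v')
    moreover obtain c where "c < n" "v $ c \<noteq> 0"
      using v(1,2) by (metis carrier_vecD eq_vecI index_zero_vec)
    then have "\<exists>y\<in>S. v' y \<noteq> 0" using v' S by force
    ultimately show "\<exists>v. (\<exists>y\<in>S. v y \<noteq> 0) \<and> (\<forall>r<n. (\<Sum>y\<in>S. R r y * v y) = 0)" by blast
  next
    fix v assume v: "\<exists>y\<in>S. v y \<noteq> 0" "\<forall>r<n. (\<Sum>y\<in>S. R r y * v y) = 0"
    define w where "w = vec n (\<lambda>c. v (e c))"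
    have "w \<in> carrier_vec n" by (simp add: w_def)
    moreover have "w \<noteq> 0\<^sub>v n"
    proof
      assume "w = 0\<^sub>v n"
      then have "v (e c) = 0" if "c < n" for c
        using that by (metis w_def index_vec index_zero_vec(1))
      then show False using v(1) S by auto
    qed
    moreover have "?M *\<^sub>v w = 0\<^sub>v n"
      using v(2) unfolding sum_S by (intro eq_vecI) (auto simp: w_def scalar_prod_def)
    ultimately show "\<exists>v. v \<in> carrier_vec n \<and> v \<noteq> 0\<^sub>v n \<and> ?M *\<^sub>v v = 0\<^sub>v n" by blast
  qed
qed

lemma rdet_left_kernel:
  fixes R :: "nat \<Rightarrow> 'b \<Rightarrow> 'a :: field"
  assumes "rdet e n R = 0"
  obtains l where "\<exists>r<n. l r \<noteq> 0" "\<And>y. y \<in> S \<Longrightarrow> (\<Sum>r<n. l r * R r y) = 0"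
proof -
  let ?M = "mat n n (\<lambda>(r, c). R r (e c))"
  have "det (transpose_mat ?M) = 0" using assms by (simp add: rdet_def det_transpose[of _ n])
  then obtain v where v: "v \<in> carrier_vec n" "v \<noteq> 0\<^sub>v n" "transpose_mat ?M *\<^sub>v v = 0\<^sub>v n"
    using det_0_iff_vec_prod_zero_field[of "transpose_mat ?M" n] by auto
  have "(\<Sum>r<n. v $ r * R r y) = 0" if "y \<in> S" for y
  proof -
    have "y \<in> e ` {..<n}" using that e by (simp add: bij_betw_def)
    then obtain c where c: "c < n" "y = e c" by auto
    have "(transpose_mat ?M *\<^sub>v v) $ c = 0" using v c by simp
    then show ?thesis using v(1) c by (simp add: scalar_prod_def mult.commute atLeast0LessThan)
  qed
  moreover have "\<exists>r<n. v $ r \<noteq> 0"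
    using v(1,2) by (metis carrier_vecD eq_vecI index_zero_vec)
  ultimately show ?thesis using that by blast
qed

lemma finite_S: "finite S"
  using e bij_betw_finite by blast

text \<open>The completing row \<open>w\<close> is a coordinate on the kernel of the first
  \<open>n - 1\<close> rows: a kernel vector with \<open>w\<close>-value 0 vanishes, so the kernel
  is at most a line.\<close>

lemma kernel_unique:
  fixes R :: "nat \<Rightarrow> 'b \<Rightarrow> 'a :: field"
  assumes "n > 0" and ext: "rdet e n (R(n - 1 := w)) \<noteq> 0"
    and v: "\<And>r. r < n - 1 \<Longrightarrow> (\<Sum>y\<in>S. R r y * v y) = 0"
    and v': "\<And>r. r < n - 1 \<Longrightarrow> (\<Sum>y\<in>S. R r y * v' y) = 0" "\<exists>y\<in>S. v' y \<noteq> 0"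
  shows "\<exists>c. \<forall>y\<in>S. v y = c * v' y"
proof -
  define p where "p v = (\<Sum>y\<in>S. w y * v y)" for v :: "'b \<Rightarrow> 'a"
  have ker: "\<forall>y\<in>S. z y = 0" if z: "\<And>r. r < n - 1 \<Longrightarrow> (\<Sum>y\<in>S. R r y * z y) = 0" "p z = 0" for z
  proof -
    have "(\<Sum>y\<in>S. (R(n - 1 := w)) r y * z y) = 0" if "r < n" for r
      using that z by (cases "r = n - 1") (auto simp: p_def)
    then show ?thesis using ext rdet_zero_iff by blast
  qed
  have p': "p v' \<noteq> 0" using ker[OF v'(1)] v'(2) by blast
  define z where "z y = p v' * v y - p v * v' y" for y
  have lin: "(\<Sum>y\<in>S. f y * z y) = p v' * (\<Sum>y\<in>S. f y * v y) - p v * (\<Sum>y\<in>S. f y * v' y)" for f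
    by (simp add: z_def sum_distrib_left sum_subtractf algebra_simps)
  have "\<forall>y\<in>S. z y = 0"
  proof (rule ker)
    show "p z = 0" using lin[of w] by (simp add: p_def)
  qed (simp add: lin v v')
  then have "\<forall>y\<in>S. v y = (p v / p v') * v' y" using p' by (simp add: z_def field_simps)
  then show ?thesis by blast
qed

text \<open>A nonzero cofactor says that a unit row completes the system, so
  \<open>kernel_unique\<close> applies; the cofactor vector is itself in the kernel by repeated
  rows.\<close>

lemma kernel_cof:
  fixes R :: "nat \<Rightarrow> 'b \<Rightarrow> 'a :: field"
  assumes "n > 0" "\<exists>y\<in>S. cof e n R (n - 1) y \<noteq> 0"
    and v: "\<And>r. r < n - 1 \<Longrightarrow> (\<Sum>y\<in>S. R r y * v y) = 0"
  shows "\<exists>c. \<forall>y\<in>S. v y = c * cof e n R (n - 1) y"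
proof -
  obtain y where "y \<in> S" "cof e n R (n - 1) y \<noteq> 0" using assms(2) by blast
  then show ?thesis unfolding cof_def[of _ _ _ _ y]
    by (rule_tac kernel_unique[OF assms(1) _ v _ assms(2)]) (use assms(1) in \<open>auto simp: cof_kernel\<close>)
qed

text \<open>If two independent vectors lay in the kernel, the adjugate would vanish at \<open>t\<close>; dividing
  \<open>M adj(M) = det M\<close> by \<open>X - t\<close> would make \<open>M(t)\<close> surjective.\<close>

lemma simple_root_kernel:
  fixes R :: "nat \<Rightarrow> 'b \<Rightarrow> 'a :: {field, ring_char_0} poly"
  assumes root: "poly (rdet e n R) t = 0" "poly (pderiv (rdet e n R)) t \<noteq> 0"
    and v: "\<And>r. r < n \<Longrightarrow> (\<Sum>y\<in>S. poly (R r y) t * v y) = 0"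
    and v': "\<And>r. r < n \<Longrightarrow> (\<Sum>y\<in>S. poly (R r y) t * v' y) = 0" "\<exists>y\<in>S. v' y \<noteq> 0"
  shows "\<exists>c. \<forall>y\<in>S. v y = c * v' y"
proof -
  let ?Rt = "\<lambda>r y. poly (R r y) t"
  obtain y0 where y0: "y0 \<in> S" "v' y0 \<noteq> 0" using v'(2) by blast
  define z where "z y = v' y0 * v y - v y0 * v' y" for y
  have lin: "(\<Sum>y\<in>S. f y * (a * x y - b * x' y)) = a * (\<Sum>y\<in>S. f y * x y) - b * (\<Sum>y\<in>S. f y * x' y)"
    for f a b and x x' :: "'b \<Rightarrow> 'a"
    by (simp add: sum_distrib_left sum_subtractf algebra_simps)
  have z: "(\<Sum>y\<in>S. ?Rt r y * z y) = 0" if "r < n" for r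
    unfolding z_def lin using v v' that by simp
  have "\<forall>y\<in>S. z y = 0"
  proof (rule ccontr)
    assume "\<not> ?thesis"
    then obtain y1 where y1: "y1 \<in> S" "z y1 \<noteq> 0" by blast
    have cof0: "poly (cof e n R r y) t = 0" if r: "r < n" and y: "y \<in> S" for r y
    proof -
      define x where "x = (if z y = 0 then z else (\<lambda>y'. v' y * z y' - z y * v' y'))"
      have "x y = 0" by (simp add: x_def)
      moreover have "\<exists>y\<in>S. x y \<noteq> 0"
      proof (cases "z y = 0")
        case False
        then have "x y0 = - (z y * v' y0)" by (simp add: x_def z_def)
        then show ?thesis using False y0 by force
      qed (use y1 x_def in auto)
      moreover have "(\<Sum>y\<in>S. ?Rt r y * x y) = 0" if "r < n" for r
        unfolding x_def using z[OF that] v'(1)[OF that] by (simp add: lin)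
      moreover have "(\<Sum>y'\<in>S. (if y' = y then 1 else 0) * x y') = x y"
        using y finite_S by (simp add: if_distrib[of "\<lambda>a. a * _"] cong: if_cong)
      ultimately have "\<forall>r'<n. (\<Sum>y'\<in>S. (?Rt(r := \<lambda>z. if z = y then 1 else 0)) r' y' * x y') = 0"
        by simp
      then have "cof e n ?Rt r y = 0"
        unfolding cof_def rdet_zero_iff using \<open>\<exists>y\<in>S. x y \<noteq> 0\<close> by blast
      then show ?thesis unfolding poly_cof .
    qed
    obtain D where D: "rdet e n R = [:- t, 1:] * D" using root(1) by (auto simp: poly_eq_0_iff_dvd)
    then have D0: "poly D t \<noteq> 0" using root(2) unfolding D pderiv_mult by (simp add: pderiv_pCons del: mult_pCons_left)
    have "\<exists>b. \<forall>r'<n. (\<Sum>y\<in>S. ?Rt r' y * b y) = (if r' = r then poly D t else 0)" if r: "r < n" for r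
    proof -
      have "\<forall>y\<in>S. \<exists>B. cof e n R r y = [:- t, 1:] * B"
        using cof0[OF r] unfolding poly_eq_0_iff_dvd dvd_def by blast
      then obtain B where B: "\<And>y. y \<in> S \<Longrightarrow> cof e n R r y = [:- t, 1:] * B y" by metis
      have "(\<Sum>y\<in>S. ?Rt r' y * poly (B y) t) = (if r' = r then poly D t else 0)" if r': "r' < n" for r'
      proof -
        have "[:- t, 1:] * (\<Sum>y\<in>S. R r' y * B y) = (\<Sum>y\<in>S. R r' y * cof e n R r y)"
          unfolding sum_distrib_left using B by (intro sum.cong refl) (simp only: mult.left_commute)
        also have "\<dots> = [:- t, 1:] * (if r' = r then D else 0)"
          using cof_kernel[OF r r', of R] D by simp
        finally have "(\<Sum>y\<in>S. R r' y * B y) = (if r' = r then D else 0)"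
          by (subst (asm) mult_left_cancel) auto
        then have "poly (\<Sum>y\<in>S. R r' y * B y) t = poly (if r' = r then D else 0) t" by simp
        then show ?thesis by (simp add: poly_sum split: if_splits)
      qed
      then show ?thesis by (intro exI[of _ "\<lambda>y. poly (B y) t"] allI impI)
    qed
    then have "\<forall>r. \<exists>b. r < n \<longrightarrow> (\<forall>r'<n. (\<Sum>y\<in>S. ?Rt r' y * b y) = (if r' = r then poly D t else 0))"
      by simp
    from choice[OF this] obtain b where b: "\<And>r r'. r < n \<Longrightarrow> r' < n \<Longrightarrow>
        (\<Sum>y\<in>S. ?Rt r' y * b r y) = (if r' = r then poly D t else 0)" by auto
    obtain l where l: "\<exists>r<n. l r \<noteq> 0" "\<And>y. y \<in> S \<Longrightarrow> (\<Sum>r<n. l r * ?Rt r y) = 0"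
      using rdet_left_kernel[of ?Rt] root(1) by (auto simp: poly_rdet)
    then obtain r where r: "r < n" "l r \<noteq> 0" by blast
    have "(\<Sum>r'<n. l r' * (\<Sum>y\<in>S. ?Rt r' y * b r y)) = (\<Sum>r'<n. if r' = r then l r' * poly D t else 0)"
      using b[OF r(1)] by (intro sum.cong) auto
    also have "\<dots> = l r * poly D t" using r by simp
    finally have "l r * poly D t = (\<Sum>r'<n. l r' * (\<Sum>y\<in>S. ?Rt r' y * b r y))" ..
    also have "\<dots> = (\<Sum>y\<in>S. (\<Sum>r'<n. l r' * ?Rt r' y) * b r y)"
      unfolding sum_distrib_left sum_distrib_right by (subst sum.swap) (simp add: mult_ac)
    also have "\<dots> = 0" using l(2) by simp
    finally show False using r D0 by simp
  qed
  then have "\<forall>y\<in>S. v y = (v y0 / v' y0) * v' y" using y0 by (simp add: z_def field_simps)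
  then show ?thesis by blast
qed

end

text \<open>The common form of the cases j = d + 1 and j = d - 1, which exchange the roles of
  \<open>a\<close> and \<open>g\<close>. The hypothesis \<open>nonsing\<close> acts twice: it
  prevents the cofactor vector from vanishing, as that would give a zero row, and it leaves only a
  line of solutions in the second factor.\<close>

lemma bilinear_system:
  fixes R1 :: "nat \<Rightarrow> 'b \<Rightarrow> 'a :: field" and R2 :: "nat \<Rightarrow> 'c \<Rightarrow> 'a"
  assumes e1: "bij_betw e1 {..<n1} S1" and e2: "bij_betw e2 {..<n2} S2" and n: "n1 > 0" "n2 \<ge> 2"
    and hom: "\<And>a a' c y. (\<And>x. x \<in> S1 \<Longrightarrow> a' x = c * a x) \<Longrightarrow> y \<in> S2 \<Longrightarrow> \<rho> a' y = c * \<rho> a y"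
    and sing: "rdet e1 n1 R1 = 0"
    and nonsing: "rdet e2 n2 (R2(n2 - 2 := \<rho> (cof e1 n1 R1 (n1 - 1)), n2 - 1 := w)) \<noteq> 0"
  defines "sol \<equiv> \<lambda>a g. (\<exists>x\<in>S1. a x \<noteq> 0) \<and> (\<exists>y\<in>S2. g y \<noteq> 0) \<and>
     (\<forall>r<n1. (\<Sum>x\<in>S1. R1 r x * a x) = 0) \<and> (\<forall>r<n2 - 2. (\<Sum>y\<in>S2. R2 r y * g y) = 0) \<and>
     (\<Sum>y\<in>S2. \<rho> a y * g y) = 0"
  shows "\<exists>a0 g0. sol a0 g0 \<and> (\<forall>a g. sol a g \<longrightarrow>
     (\<exists>c. \<forall>x\<in>S1. a x = c * a0 x) \<and> (\<exists>c. \<forall>y\<in>S2. g y = c * g0 y))"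
proof -
  define a0 where "a0 = cof e1 n1 R1 (n1 - 1)"
  have a0: "\<exists>x\<in>S1. a0 x \<noteq> 0"
  proof (rule ccontr)
    assume "\<not> ?thesis"
    then have "\<rho> a0 y = 0" if "y \<in> S2" for y using hom[of a0 0 a0, OF _ that] by simp
    then have "rdet e2 n2 (R2(n2 - 2 := \<rho> a0, n2 - 1 := w)) = 0"
      using n by (intro rdet_zero_row[OF e2, of "n2 - 2"]) auto
    then show False using nonsing by (simp add: a0_def)
  qed
  have a0_ker: "(\<Sum>x\<in>S1. R1 r x * a0 x) = 0" if "r < n1" for r
    using cof_kernel[OF e1, of "n1 - 1" r R1] n sing that by (simp add: a0_def split: if_splits)
  \<comment> \<open>Padding \<open>n2 - 1\<close> equations by a zero row shows that they have a
    nonzero solution in \<open>n2\<close> unknowns.\<close>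
  have "rdet e2 n2 (R2(n2 - 2 := \<rho> a0, n2 - 1 := (\<lambda>y. 0))) = 0"
    using n by (intro rdet_zero_row[OF e2, of "n2 - 1"]) auto
  then obtain g0 where g0: "\<exists>y\<in>S2. g0 y \<noteq> 0"
    "\<And>r. r < n2 \<Longrightarrow> (\<Sum>y\<in>S2. (R2(n2 - 2 := \<rho> a0, n2 - 1 := (\<lambda>y. 0))) r y * g0 y) = 0"
    unfolding rdet_zero_iff[OF e2] by blast
  have g0_ker: "(\<Sum>y\<in>S2. (R2(n2 - 2 := \<rho> a0)) r y * g0 y) = 0" if "r < n2 - 1" for r
    using g0(2)[of r] that by simp
  have "(\<Sum>y\<in>S2. R2 r y * g0 y) = 0" if "r < n2 - 2" for r
    using g0_ker[of r] that by simp
  moreover have "(\<Sum>y\<in>S2. \<rho> a0 y * g0 y) = 0" using g0_ker[of "n2 - 2"] n by simp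
  ultimately have "sol a0 g0" unfolding sol_def using a0 a0_ker g0(1) by blast
  moreover have "(\<exists>c. \<forall>x\<in>S1. a x = c * a0 x) \<and> (\<exists>c. \<forall>y\<in>S2. g y = c * g0 y)" if s: "sol a g" for a g
  proof -
    obtain c where c: "\<forall>x\<in>S1. a x = c * a0 x"
      using kernel_cof[OF e1 n(1), of R1 a] a0 s by (auto simp: sol_def a0_def)
    then have "c \<noteq> 0" using s by (auto simp: sol_def)
    have \<rho>: "\<rho> a y = c * \<rho> a0 y" if "y \<in> S2" for y using hom c that by blast
    have "c * (\<Sum>y\<in>S2. \<rho> a0 y * g y) = (\<Sum>y\<in>S2. \<rho> a y * g y)"
      unfolding sum_distrib_left by (intro sum.cong refl) (simp add: \<rho>)
    then have "(\<Sum>y\<in>S2. \<rho> a0 y * g y) = 0" using s \<open>c \<noteq> 0\<close> by (simp add: sol_def)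
    then have "(\<Sum>y\<in>S2. (R2(n2 - 2 := \<rho> a0)) r y * g y) = 0" if "r < n2 - 1" for r
      using s that by (cases "r = n2 - 2") (auto simp: sol_def)
    then have "\<exists>c. \<forall>y\<in>S2. g y = c * g0 y"
      using n nonsing g0_ker g0(1)
      by (intro kernel_unique[OF e2, of "R2(n2 - 2 := \<rho> a0)" w]) (auto simp: a0_def)
    then show ?thesis using c by blast
  qed
  ultimately show ?thesis by blast
qed

subsection \<open>Generic properties\<close>

text \<open>The quantifier pattern of \<open>has_polar_degree\<close>, isolated so that open
  conditions can be intersected.\<close>

definition generically :: "('k \<Rightarrow> complex) set \<Rightarrow> (('k \<Rightarrow> complex) \<Rightarrow> bool) \<Rightarrow> bool" where
  "generically S \<Phi> \<longleftrightarrow> (\<exists>P\<in>polyfun. (\<exists>p\<in>S. P p \<noteq> 0) \<and> (\<forall>p\<in>S. P p \<noteq> 0 \<longrightarrow> \<Phi> p))"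

lemma generically_mono:
  assumes "generically S \<Phi>" "\<And>p. p \<in> S \<Longrightarrow> \<Phi> p \<Longrightarrow> \<Psi> p"
  shows "generically S \<Psi>"
  using assms unfolding generically_def by blast

lemma generically_nonzero: "P \<in> polyfun \<Longrightarrow> p \<in> S \<Longrightarrow> P p \<noteq> 0 \<Longrightarrow> generically S (\<lambda>p. P p \<noteq> 0)"
  unfolding generically_def by blast

lemma polyfun_line:
  assumes "P \<in> polyfun"
  shows "\<exists>f. \<forall>t. P (\<lambda>i. p i + t * v i) = poly f t"
  using assms
proof (induction rule: polyfun.induct)
  case (const c)
  show ?case by (intro exI[of _ "[:c:]"]) simp
next
  case (coord i)
  show ?case by (intro exI[of _ "[:p i, v i:]"]) (simp add: mult.commute)
next
  case (add P Q)
  then obtain f g where "\<forall>t. P (\<lambda>i. p i + t * v i) = poly f t" "\<forall>t. Q (\<lambda>i. p i + t * v i) = poly g t"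
    by blast
  then show ?case by (intro exI[of _ "f + g"]) simp
next
  case (mult P Q)
  then obtain f g where "\<forall>t. P (\<lambda>i. p i + t * v i) = poly f t" "\<forall>t. Q (\<lambda>i. p i + t * v i) = poly g t"
    by blast
  then show ?case by (intro exI[of _ "f * g"]) simp
qed

text \<open>Irreducibility of an affine space: two nonempty open subsets meet, as one sees on the
  line through a point of the first and a point of the second.\<close>

lemma generically_conj:
  assumes "generically S \<Phi>" "generically S \<Psi>"
    and affine: "\<And>p q t. p \<in> S \<Longrightarrow> q \<in> S \<Longrightarrow> (\<lambda>i. p i + t * (q i - p i)) \<in> S"
  shows "generically S (\<lambda>p. \<Phi> p \<and> \<Psi> p)"
proof -
  obtain P p where P: "P \<in> polyfun" "p \<in> S" "P p \<noteq> 0" "\<And>p. p \<in> S \<Longrightarrow> P p \<noteq> 0 \<Longrightarrow> \<Phi> p"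
    using assms(1) unfolding generically_def by blast
  obtain Q q where Q: "Q \<in> polyfun" "q \<in> S" "Q q \<noteq> 0" "\<And>p. p \<in> S \<Longrightarrow> Q p \<noteq> 0 \<Longrightarrow> \<Psi> p"
    using assms(2) unfolding generically_def by blast
  let ?l = "\<lambda>t i. p i + t * (q i - p i)"
  obtain f where f: "\<And>t. P (?l t) = poly f t"
    using polyfun_line[OF P(1), of p "\<lambda>i. q i - p i"] by blast
  obtain g where g: "\<And>t. Q (?l t) = poly g t"
    using polyfun_line[OF Q(1), of p "\<lambda>i. q i - p i"] by blast
  have "f \<noteq> 0" using f[of 0] P(3) by auto
  moreover have "g \<noteq> 0" using g[of 1] Q(3) by auto
  ultimately have "f * g \<noteq> 0" by simp
  then have "finite {t. poly (f * g) t = 0}" by (rule poly_roots_finite)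
  then obtain t where "poly (f * g) t \<noteq> 0"
    using infinite_UNIV_char_0 by (metis (mono_tags, lifting) UNIV_eq_I mem_Collect_eq)
  then have "P (?l t) * Q (?l t) \<noteq> 0" unfolding f g by simp
  moreover have "(\<lambda>x. P x * Q x) \<in> polyfun" using P(1) Q(1) by (rule polyfun.mult)
  moreover have "?l t \<in> S" by (rule affine[OF P(2) Q(2)])
  ultimately show ?thesis
    unfolding generically_def using P(4) Q(4)
    by (intro bexI[of _ "\<lambda>x. P x * Q x"]) auto
qed

text \<open>The uniform degree bound supplies a fixed formal degree, hence a resultant matrix whose
  size does not depend on the parameter.\<close>

definition polyfam :: "(('k \<Rightarrow> complex) \<Rightarrow> complex poly) \<Rightarrow> bool" where
  "polyfam F \<longleftrightarrow> (\<forall>k. (\<lambda>p. coeff (F p) k) \<in> polyfun) \<and> (\<exists>m. \<forall>p. degree (F p) \<le> m)"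

lemma polyfam_const: "polyfam (\<lambda>p. f)"
  by (auto simp: polyfam_def intro: polyfun.const)

lemma polyfam_monom:
  assumes "P \<in> polyfun"
  shows "polyfam (\<lambda>p. monom (P p) k)"
  unfolding polyfam_def
proof (intro conjI allI exI)
  show "(\<lambda>p. coeff (monom (P p) k) n) \<in> polyfun" for n
    using assms by (cases "n = k") (auto intro: polyfun.const)
  show "degree (monom (P p) k) \<le> k" for p by (rule degree_monom_le)
qed

lemma polyfam_add:
  assumes "polyfam F" "polyfam G"
  shows "polyfam (\<lambda>p. F p + G p)"
proof -
  obtain m n where "\<forall>p. degree (F p) \<le> m" "\<forall>p. degree (G p) \<le> n"
    using assms by (auto simp: polyfam_def)
  then have "\<forall>p. degree (F p + G p) \<le> max m n" by (meson degree_add_le max.cobounded1 max.cobounded2 order_trans)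
  moreover have "(\<lambda>p. coeff (F p + G p) k) \<in> polyfun" for k
    unfolding coeff_add using assms by (intro polyfun.add) (auto simp: polyfam_def)
  ultimately show ?thesis unfolding polyfam_def by blast
qed

lemma polyfam_mult:
  assumes "polyfam F" "polyfam G"
  shows "polyfam (\<lambda>p. F p * G p)"
proof -
  obtain m n where "\<forall>p. degree (F p) \<le> m" "\<forall>p. degree (G p) \<le> n"
    using assms by (auto simp: polyfam_def)
  then have "\<forall>p. degree (F p * G p) \<le> m + n" by (meson degree_mult_le add_mono order_trans)
  moreover have "(\<lambda>p. coeff (F p * G p) k) \<in> polyfun" for k
    unfolding coeff_mult using assms by (intro polyfun_sum polyfun.mult) (auto simp: polyfam_def)
  ultimately show ?thesis unfolding polyfam_def by blast
qed

lemma polyfam_sum: "(\<And>a. a \<in> A \<Longrightarrow> polyfam (F a)) \<Longrightarrow> polyfam (\<lambda>p. \<Sum>a\<in>A. F a p)"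
  by (induction A rule: infinite_finite_induct) (simp_all add: polyfam_const polyfam_add)

lemma polyfam_prod: "(\<And>a. a \<in> A \<Longrightarrow> polyfam (F a)) \<Longrightarrow> polyfam (\<lambda>p. \<Prod>a\<in>A. F a p)"
  by (induction A rule: infinite_finite_induct) (simp_all add: polyfam_const polyfam_mult)

lemma polyfam_rdet:
  assumes "\<And>r y. polyfam (\<lambda>p. R p r y)"
  shows "polyfam (\<lambda>p. rdet e n (R p))"
proof -
  have "rdet e n (R p) = (\<Sum>\<sigma>\<in>{\<sigma>. \<sigma> permutes {0..<n}}. signof \<sigma> * (\<Prod>r = 0..<n. R p r (e (\<sigma> r))))" for p
  proof -
    have "(\<Prod>r = 0..<n. mat n n (\<lambda>(r, c). R p r (e c)) $$ (r, \<sigma> r)) = (\<Prod>r = 0..<n. R p r (e (\<sigma> r)))"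
      if "\<sigma> permutes {0..<n}" for \<sigma>
      using permutes_in_image[OF that] by (intro prod.cong) auto
    then show ?thesis unfolding rdet_def by (subst det_def'[of _ n]) auto
  qed
  then show ?thesis by (simp only:) (intro polyfam_sum polyfam_mult polyfam_prod polyfam_const assms)
qed

lemma polyfam_pderiv:
  assumes "polyfam F"
  shows "polyfam (\<lambda>p. pderiv (F p))"
proof -
  obtain m where "\<forall>p. degree (F p) \<le> m" using assms by (auto simp: polyfam_def)
  then have "\<forall>p. degree (pderiv (F p)) \<le> m" unfolding degree_pderiv by (meson diff_le_self order_trans)
  moreover have "(\<lambda>p. coeff (pderiv (F p)) k) \<in> polyfun" for k
    unfolding coeff_pderiv using assms by (intro polyfun.mult polyfun.const) (auto simp: polyfam_def)
  ultimately show ?thesis unfolding polyfam_def by blast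
qed

lemma polyfam_if: "polyfam F \<Longrightarrow> polyfam G \<Longrightarrow> polyfam (\<lambda>p. if b then F p else G p)"
  by (cases b) auto

lemma polyfam_fun_upd:
  assumes "polyfam (\<lambda>p. R p r y)" "polyfam (\<lambda>p. w p y)"
  shows "polyfam (\<lambda>p. ((R p)(r0 := w p)) r y)"
  using assms by (cases "r = r0") auto

lemma polyfun_rdet_const:
  assumes "\<And>r y. (\<lambda>p. R p r y) \<in> polyfun"
  shows "(\<lambda>p. rdet e n (R p)) \<in> polyfun"
proof -
  have "polyfam (\<lambda>p. rdet e n (\<lambda>r y. monom (R p r y) 0))"
    by (intro polyfam_rdet polyfam_monom assms)
  moreover have "rdet e n (R p) = coeff (rdet e n (\<lambda>r y. monom (R p r y) 0)) 0" for p
    using poly_rdet[of e n "\<lambda>r y. monom (R p r y) 0" 0] by (simp add: poly_monom poly_0_coeff_0)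
  ultimately show ?thesis by (simp add: polyfam_def)
qed

text \<open>The determinant is that of \<open>(A, B) \<mapsto> A F + B G\<close> with
  \<open>deg A < m\<close> and \<open>deg B < n\<close>, i.e. the Sylvester resultant for the formal degrees \<open>n\<close>, \<open>m\<close>.\<close>

lemma generically_no_common_root:
  assumes F: "polyfam F" "\<And>p. p \<in> S \<Longrightarrow> degree (F p) \<le> n" and G: "polyfam G"
    and p0: "p0 \<in> S" "F p0 \<noteq> 0" "n \<le> card {t. poly (F p0) t = 0}"
      "\<And>t. poly (F p0) t = 0 \<Longrightarrow> poly (G p0) t \<noteq> 0"
  shows "generically S (\<lambda>p. F p \<noteq> 0 \<and> degree (F p) = n \<and> (\<forall>t. poly (F p) t = 0 \<longrightarrow> poly (G p) t \<noteq> 0))"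
proof -
  obtain m where m: "\<And>p. degree (G p) \<le> m" using G by (auto simp: polyfam_def)
  define R where "R p r c = coeff (if c < m then monom 1 c * F p else monom 1 (c - m) * G p) r" for p r c
  define AB where "AB v i j = (\<Sum>c<j. monom (v (i + c)) c)" for v :: "nat \<Rightarrow> complex" and i j :: nat
  have R_sum: "(\<Sum>c\<in>{..<m+n}. R p r c * v c) = coeff (AB v 0 m * F p + AB v m n * G p) r" for p r v
  proof -
    have "(\<Sum>c\<in>{..<m+n}. R p r c * v c) = (\<Sum>c<m. R p r c * v c) + (\<Sum>c<n. R p r (m + c) * v (m + c))"
      by (induction n) (simp_all add: algebra_simps)
    also have "(\<Sum>c<m. R p r c * v c) = coeff (AB v 0 m * F p) r"
      unfolding AB_def R_def sum_distrib_right coeff_sum by (intro sum.cong) (auto simp: coeff_monom_mult)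
    also have "(\<Sum>c<n. R p r (m + c) * v (m + c)) = coeff (AB v m n * G p) r"
      unfolding AB_def R_def sum_distrib_right coeff_sum by (intro sum.cong) (auto simp: coeff_monom_mult)
    also have "coeff (AB v 0 m * F p) r + coeff (AB v m n * G p) r = coeff (AB v 0 m * F p + AB v m n * G p) r"
      by simp
    finally show ?thesis .
  qed
  have AB_coeff: "coeff (AB v i j) c = (if c < j then v (i + c) else 0)" for v i j c
    by (simp add: AB_def coeff_sum)
  have deg_AB: "AB v i j = 0 \<or> degree (AB v i j) < j" for v i j
  proof (cases "j = 0")
    case False
    then show ?thesis by (auto intro!: degree_lessI simp: AB_coeff)
  qed (simp add: AB_def)
  \<comment> \<open>The extra leading coefficient makes \<open>D p \<noteq> 0\<close> force the full
    degree \<open>n\<close>.\<close>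
  define D where "D p = coeff (F p) n * rdet id (m + n) (R p)" for p
  have bij: "bij_betw id {..<m+n} {..<m+n}" by simp
  have "(\<lambda>p. R p r c) \<in> polyfun" for r c
  proof -
    have "polyfam (\<lambda>p. if c < m then monom 1 c * F p else monom 1 (c - m) * G p)"
      by (intro polyfam_if polyfam_mult polyfam_const F(1) G)
    then show ?thesis by (simp add: R_def polyfam_def)
  qed
  then have "D \<in> polyfun" unfolding D_def
    using F(1) by (intro polyfun.mult polyfun_rdet_const) (auto simp: polyfam_def)
  moreover have "D p0 \<noteq> 0"
  proof -
    have fin: "finite {t. poly (F p0) t = 0}" using p0(2) by (rule poly_roots_finite)
    have n: "degree (F p0) = n" using card_poly_roots_bound[OF p0(2)] p0(3) F(2)[OF p0(1)] by linarith
    have "rdet id (m + n) (R p0) \<noteq> 0"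
    proof
      assume "rdet id (m + n) (R p0) = 0"
      then obtain v where v: "\<exists>c<m+n. v c \<noteq> 0" "\<And>r. r < m + n \<Longrightarrow> (\<Sum>c\<in>{..<m+n}. R p0 r c * v c) = 0"
        unfolding rdet_zero_iff[OF bij] by auto
      let ?A = "AB v 0 m" and ?B = "AB v m n"
      have "coeff (?A * F p0 + ?B * G p0) r = 0" for r
      proof (cases "r < m + n")
        case False
        have "degree (?A * F p0) < m + n \<or> ?A * F p0 = 0"
          using deg_AB[of v 0 m] degree_mult_le[of ?A "F p0"] n by auto
        moreover have "degree (?B * G p0) < m + n \<or> ?B * G p0 = 0"
          using deg_AB[of v m n] degree_mult_le[of ?B "G p0"] m[of p0] by auto
        ultimately have "coeff (?A * F p0) r = 0" "coeff (?B * G p0) r = 0"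
          using False by (auto intro: coeff_eq_0)
        then show ?thesis by simp
      qed (use v(2) R_sum in auto)
      then have eq: "?A * F p0 + ?B * G p0 = 0" by (simp add: poly_eq_iff)
      \<comment> \<open>\<open>B\<close> has degree below \<open>n\<close> but vanishes at the
        \<open>n\<close> roots of \<open>F p0\<close>, because \<open>G p0\<close> is nonzero at
        each of them.\<close>
      have "?B = 0"
      proof (rule ccontr)
        assume B: "?B \<noteq> 0"
        have "poly ?B t = 0" if t: "poly (F p0) t = 0" for t
        proof -
          have "poly (?A * F p0 + ?B * G p0) t = 0" unfolding eq by simp
          then show ?thesis using t p0(4)[OF t] by simp
        qed
        then have "card {t. poly (F p0) t = 0} \<le> card {t. poly ?B t = 0}"
          by (intro card_mono poly_roots_finite[OF B]) auto
        then show False using card_poly_roots_bound[OF B] deg_AB[of v m n] B p0(3) by linarith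
      qed
      moreover from this eq p0(2) have "?A = 0" by simp
      ultimately have "v c = 0" if "c < m + n" for c
        using that AB_coeff[of v 0 m c] AB_coeff[of v m n "c - m"] by (cases "c < m") (auto split: if_splits)
      then show False using v(1) by blast
    qed
    then show ?thesis using n p0(2) by (auto simp: D_def)
  qed
  moreover have "F p \<noteq> 0 \<and> degree (F p) = n \<and> (\<forall>t. poly (F p) t = 0 \<longrightarrow> poly (G p) t \<noteq> 0)"
    if p: "p \<in> S" and Dp: "D p \<noteq> 0" for p
  proof (intro conjI allI impI notI)
    show F0: False if "F p = 0" using Dp that by (simp add: D_def)
    show n: "degree (F p) = n"
      using F(2)[OF p] Dp le_degree[of "F p" n] by (auto simp: D_def)
    fix t assume t: "poly (F p) t = 0" "poly (G p) t = 0"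
    obtain F1 where F1: "F p = [:- t, 1:] * F1" using t(1) by (auto simp: poly_eq_0_iff_dvd)
    obtain G1 where G1: "G p = [:- t, 1:] * G1" using t(2) by (auto simp: poly_eq_0_iff_dvd)
    have "F1 \<noteq> 0" using F1 F0 by auto
    then have dF: "degree F1 < n" unfolding n[symmetric] F1 by (subst degree_mult_eq) auto
    have dG: "coeff G1 c = 0" if "c \<ge> m" for c
    proof (cases "G1 = 0")
      case False
      then have "degree G1 < m" using m[of p] unfolding G1 by (subst (asm) degree_mult_eq) auto
      then show ?thesis using that by (simp add: coeff_eq_0)
    qed simp
    \<comment> \<open>A common root gives the syzygy \<open>G1 * F p - F1 * G p = 0\<close>, whose
      coefficients form a kernel vector.\<close>
    define v where "v c = (if c < m then coeff G1 c else - coeff F1 (c - m))" for c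
    have "AB v 0 m = G1" by (rule poly_eqI) (auto simp: AB_coeff v_def dG)
    moreover have "AB v m n = - F1"
      using dF by (intro poly_eqI) (auto simp: AB_coeff v_def coeff_eq_0)
    ultimately have "AB v 0 m * F p + AB v m n * G p = 0" by (simp add: F1 G1 algebra_simps del: mult_pCons_left mult_pCons_right)
    then have "\<forall>r<m + n. (\<Sum>c\<in>{..<m+n}. R p r c * v c) = 0" unfolding R_sum by simp
    moreover have "v (m + degree F1) \<noteq> 0" using \<open>F1 \<noteq> 0\<close> by (simp add: v_def)
    then have "\<exists>c\<in>{..<m+n}. v c \<noteq> 0" using dF by (intro bexI[of _ "m + degree F1"]) auto
    ultimately have "rdet id (m + n) (R p) = 0" unfolding rdet_zero_iff[OF bij] by blast
    then show False using Dp by (simp add: D_def)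
  qed
  ultimately show ?thesis unfolding generically_def using p0(1) by blast
qed

lemma card_roots_squarefree:
  fixes f :: "complex poly"
  assumes "f \<noteq> 0"
  shows "card {t. poly f t = 0} = degree f \<longleftrightarrow> (\<forall>t. poly f t = 0 \<longrightarrow> poly (pderiv f) t \<noteq> 0)"
proof
  assume card: "card {t. poly f t = 0} = degree f"
  show "\<forall>t. poly f t = 0 \<longrightarrow> poly (pderiv f) t \<noteq> 0"
  proof (intro allI impI notI)
    fix t assume t: "poly f t = 0" "poly (pderiv f) t = 0"
    obtain q where q: "f = [:- t, 1:] * q" using t(1) unfolding poly_eq_0_iff_dvd dvd_def by blast
    have "q \<noteq> 0" using assms q by auto
    have "poly q t = 0" using t(2) unfolding q pderiv_mult by (simp add: pderiv_pCons del: mult_pCons_left)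
    \<comment> \<open>Removing one copy of a double root keeps the root set but lowers the
      degree.\<close>
    then have "{t. poly f t = 0} = {t. poly q t = 0}" unfolding q by (auto simp del: mult_pCons_left)
    then have "degree f \<le> degree q" using card_poly_roots_bound[OF \<open>q \<noteq> 0\<close>] card by simp
    moreover have "degree f = Suc (degree q)" unfolding q using \<open>q \<noteq> 0\<close> by (subst degree_mult_eq) auto
    ultimately show False by simp
  qed
next
  assume "\<forall>t. poly f t = 0 \<longrightarrow> poly (pderiv f) t \<noteq> 0"
  then have "rsquarefree f" unfolding rsquarefree_roots by blast
  then have "f = smult (lead_coeff f) (\<Prod>z | poly f z = 0. [:- z, 1:])"
    by (rule complex_poly_decompose_rsquarefree[symmetric])
  then have "degree f = degree (\<Prod>z | poly f z = 0. [:- z, 1:])"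
    using assms by (metis degree_smult_eq leading_coeff_0_iff)
  also have "\<dots> = card {t. poly f t = 0}" by (subst degree_prod_eq_sum_degree) auto
  finally show "card {t. poly f t = 0} = degree f" ..
qed

text \<open>The discriminant as the resultant of \<open>F\<close> and its derivative: at the
  witness, as many roots as the formal degree means that all of them are simple.\<close>

lemma generically_simple_roots:
  assumes F: "polyfam F" "\<And>p. p \<in> S \<Longrightarrow> degree (F p) \<le> n"
    and p0: "p0 \<in> S" "F p0 \<noteq> 0" "n \<le> card {t. poly (F p0) t = 0}"
  shows "generically S (\<lambda>p. F p \<noteq> 0 \<and> degree (F p) = n \<and> card {t. poly (F p) t = 0} = n \<and>
    (\<forall>t. poly (F p) t = 0 \<longrightarrow> poly (pderiv (F p)) t \<noteq> 0))"
proof -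
  have "card {t. poly (F p0) t = 0} = degree (F p0)"
    using card_poly_roots_bound[OF p0(2)] p0(3) F(2)[OF p0(1)] by linarith
  then have "generically S (\<lambda>p. F p \<noteq> 0 \<and> degree (F p) = n \<and>
      (\<forall>t. poly (F p) t = 0 \<longrightarrow> poly (pderiv (F p)) t \<noteq> 0))"
    using p0 card_roots_squarefree by (intro generically_no_common_root[OF F polyfam_pderiv[OF F(1)]]) auto
  then show ?thesis
    by (rule generically_mono) (use card_roots_squarefree in auto)
qed

section \<open>Linear sections as linear systems over the base line\<close>

context scroll begin

definition N :: nat where "N = (\<Sum>i=1..d. ns i)"

lemma card_J: "card J = N"
  unfolding J_def N_def by (subst card_SigmaI) auto

lemma card_I: "card I = N + d"
  unfolding I_Sigma N_def by (subst card_SigmaI) (auto simp: sum_Suc)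

lemma N_ge_d: "N \<ge> d"
proof -
  have "(\<Sum>i=1..d. 1) \<le> N" unfolding N_def using ns_pos by (intro sum_mono) (simp add: Suc_leI)
  then show ?thesis by simp
qed

definition PR :: "(bool \<times> nat \<times> nat \<times> nat \<Rightarrow> complex) \<Rightarrow> nat \<Rightarrow> nat \<Rightarrow> complex poly" where
  "PR p r i = (\<Sum>k\<le>ns i. monom (p (False, r, i, k)) k)"

definition QR :: "(bool \<times> nat \<times> nat \<times> nat \<Rightarrow> complex) \<Rightarrow> nat \<Rightarrow> nat \<times> nat \<Rightarrow> complex poly" where
  "QR p r y = monom (p (True, r, fst y, Suc (snd y))) 0 + monom (- p (True, r, y)) 1"

text \<open>The equations over [0:1] come from coefficients of top formal degree in
  \<open>t\<close>: that of degree \<open>ns i\<close> in \<open>PR\<close> here, and minus the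
  linear one of \<open>QR\<close> in \<open>QI\<close>.\<close>

definition PI :: "(bool \<times> nat \<times> nat \<times> nat \<Rightarrow> complex) \<Rightarrow> nat \<Rightarrow> nat \<Rightarrow> complex" where
  "PI p r i = p (False, r, i, ns i)"

definition QI :: "(bool \<times> nat \<times> nat \<times> nat \<Rightarrow> complex) \<Rightarrow> nat \<Rightarrow> nat \<times> nat \<Rightarrow> complex" where
  "QI p r y = p (True, r, y)"

definition \<rho> :: "complex \<Rightarrow> (nat \<Rightarrow> complex) \<Rightarrow> nat \<times> nat \<Rightarrow> complex" where
  "\<rho> t a y = a (fst y) * t ^ snd y"

definition \<rho>I :: "(nat \<Rightarrow> complex) \<Rightarrow> nat \<times> nat \<Rightarrow> complex" where
  "\<rho>I a y = (if Suc (snd y) = ns (fst y) then a (fst y) else 0)"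

definition sol where
  "sol j p t a g \<longleftrightarrow> (\<exists>i\<in>{1..d}. a i \<noteq> 0) \<and> (\<exists>y\<in>J. g y \<noteq> 0) \<and>
     (\<forall>r<j - 1. (\<Sum>i=1..d. poly (PR p r i) t * a i) = 0) \<and>
     (\<forall>r<N + d - 1 - j. (\<Sum>y\<in>J. poly (QR p r y) t * g y) = 0) \<and>
     (\<Sum>y\<in>J. \<rho> t a y * g y) = 0"

definition solI where
  "solI j p a g \<longleftrightarrow> (\<exists>i\<in>{1..d}. a i \<noteq> 0) \<and> (\<exists>y\<in>J. g y \<noteq> 0) \<and>
     (\<forall>r<j - 1. (\<Sum>i=1..d. PI p r i * a i) = 0) \<and>
     (\<forall>r<N + d - 1 - j. (\<Sum>y\<in>J. QI p r y * g y) = 0) \<and>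
     (\<Sum>y\<in>J. \<rho>I a y * g y) = 0"

lemma poly_PR: "poly (PR p r i) t = (\<Sum>k\<le>ns i. p (False, r, i, k) * t ^ k)"
  by (simp add: PR_def poly_sum poly_monom)

lemma poly_QR: "poly (QR p r y) t = p (True, r, fst y, Suc (snd y)) - t * p (True, r, y)"
  by (simp add: QR_def poly_monom)

lemma pairing_PR: "pairing I (\<lambda>i. p (False, r, i)) (X t a) = (\<Sum>i=1..d. poly (PR p r i) t * a i)"
  by (simp add: pairing_X poly_PR)

lemma pairing_QR: "pairing I (\<lambda>i. p (True, r, i)) (U t g) = (\<Sum>y\<in>J. poly (QR p r y) t * g y)"
  by (simp add: pairing_U poly_QR)

lemma pairing_PI: "pairing I (\<lambda>i. p (False, r, i)) (Xi a) = (\<Sum>i=1..d. PI p r i * a i)"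
  by (simp add: pairing_Xi PI_def)

lemma pairing_QI: "pairing I (\<lambda>i. p (True, r, i)) (Ui g) = (\<Sum>y\<in>J. QI p r y * g y)"
  by (simp add: pairing_Ui QI_def)

lemma sum_\<rho>I: "(\<Sum>y\<in>J. \<rho>I a y * g y) = (\<Sum>i=1..d. a i * g (i, ns i - 1))"
  unfolding sum_J
proof (intro sum.cong refl)
  fix i assume i: "i \<in> {1..d}"
  have "(\<Sum>k<ns i. \<rho>I a (i, k) * g (i, k)) = (\<Sum>k<ns i. if k = ns i - 1 then a i * g (i, k) else 0)"
    by (intro sum.cong) (auto simp: \<rho>I_def)
  then show "(\<Sum>k<ns i. \<rho>I a (i, k) * g (i, k)) = a i * g (i, ns i - 1)"
    using ns_pos[OF i] by simp
qed

text \<open>Multiplication by T - t is injective: the coefficients of each \<open>g_i\<close> are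
  recovered from the top down.\<close>

lemma nonzero_U: "nonzero (U t g) \<longleftrightarrow> (\<exists>y\<in>J. g y \<noteq> 0)"
proof
  assume "nonzero (U t g)"
  then obtain i k where ik: "U t g (i, k) \<noteq> 0" by (auto simp: nonzero_def)
  show "\<exists>y\<in>J. g y \<noteq> 0"
  proof (rule ccontr)
    assume "\<not> ?thesis"
    then have "U t g (i, k) = 0" by (auto simp: U_def)
    with ik show False by simp
  qed
next
  assume "\<exists>y\<in>J. g y \<noteq> 0"
  then obtain i k where ik: "(i, k) \<in> J" "g (i, k) \<noteq> 0" by force
  show "nonzero (U t g)"
  proof (rule ccontr)
    assume "\<not> nonzero (U t g)"
    then have z: "U t g (i, Suc l) = 0" for l by (simp add: nonzero_def)
    have "g (i, ns i - 1 - l) = 0" if "l < ns i" for l using that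
    proof (induction l)
      case 0
      then show ?case using z[of "ns i - 1"] ik(1) by (auto simp: U_def)
    next
      case (Suc l)
      then have "Suc (ns i - 1 - Suc l) = ns i - 1 - l" by simp
      then show ?case using z[of "ns i - 1 - Suc l"] Suc ik(1) by (auto simp: U_def)
    qed
    from this[of "ns i - 1 - k"] ik show False by simp
  qed
qed

lemma nonzero_Ui: "nonzero (Ui g) \<longleftrightarrow> (\<exists>y\<in>J. g y \<noteq> 0)"
  unfolding nonzero_def Ui_def by metis

lemma line_scale:
  assumes "c \<noteq> 0"
  shows "line (\<lambda>i. c * x i) = line x"
proof -
  have "(\<lambda>i. b * x i) \<in> line (\<lambda>i. c * x i)" for b
    using assms by (auto simp: line_def fun_eq_iff intro!: exI[of _ "b / c"])
  moreover have "(\<lambda>i. b * (c * x i)) \<in> line x" for b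
    by (auto simp: line_def fun_eq_iff intro!: exI[of _ "b * c"])
  ultimately show ?thesis by (auto simp: line_def)
qed

lemma line_self: "x \<in> line x"
  by (auto simp: line_def intro!: exI[of _ 1])

text \<open>The factors \<open>a\<close> and \<open>g\<close> are scaled independently, since a
  solution stands for a point of a product of two projective spaces.\<close>

definition unique_sol where
  "unique_sol j p t \<longleftrightarrow> (\<exists>a0 g0. sol j p t a0 g0 \<and> (\<forall>a g. sol j p t a g \<longrightarrow>
     (\<exists>c. \<forall>i\<in>{1..d}. a i = c * a0 i) \<and> (\<exists>c. \<forall>y\<in>J. g y = c * g0 y)))"

definition count_sols where
  "count_sols j p k \<longleftrightarrow> (\<exists>Z. finite Z \<and> card Z = k \<and>
     (\<forall>t a g. sol j p t a g \<longrightarrow> t \<in> Z) \<and> (\<forall>t\<in>Z. unique_sol j p t))"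

text \<open>With nothing over [0:1], sending \<open>t\<close> to its unique pair of lines is a
  bijection from the root set. It is injective because \<open>t\<close> is the ratio of two
  coordinates of the first point.\<close>

lemma sect_points_card:
  assumes inf: "\<forall>a g. \<not> solI j p a g" and count: "count_sols j p k"
  shows "finite (sect_points I C j p) \<and> card (sect_points I C j p) = k"
proof -
  obtain Z where Z: "finite Z" "card Z = k" and fin: "\<And>t a g. sol j p t a g \<Longrightarrow> t \<in> Z"
    and uniq: "\<And>t. t \<in> Z \<Longrightarrow> unique_sol j p t"
    using count unfolding count_sols_def by blast
  obtain A G where AG: "\<And>t. t \<in> Z \<Longrightarrow> sol j p t (A t) (G t)"
    "\<And>t a g. t \<in> Z \<Longrightarrow> sol j p t a g \<Longrightarrow>
        (\<exists>c. \<forall>i\<in>{1..d}. a i = c * A t i) \<and> (\<exists>c. \<forall>y\<in>J. g y = c * G t y)"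
    using uniq unfolding unique_sol_def by metis
  have X_scale: "X t a = (\<lambda>y. c * X t b y)" if "\<forall>i\<in>{1..d}. a i = c * b i" for t a b c
    using that by (auto simp: X_def fun_eq_iff)
  have U_scale: "U t a = (\<lambda>y. c * U t b y)" if "\<forall>y\<in>J. a y = c * b y" for t a b c
    using that by (auto simp: U_def fun_eq_iff algebra_simps)
  let ?\<phi> = "\<lambda>t. (line (X t (A t)), line (U t (G t)))"
  have "sect_points I C j p = ?\<phi> ` Z"
  proof (rule equalityI; rule subsetI)
    fix l assume "l \<in> sect_points I C j p"
    then obtain x u where l: "l = (line x, line u)" and xu: "pr x u \<in> conormal_cone I C"
      and nz: "nonzero x" "nonzero u"
      and rows: "\<forall>r < j - 1. pairing I (\<lambda>i. p (False, r, i)) x = 0"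
        "\<forall>r < N + d - 1 - j. pairing I (\<lambda>i. p (True, r, i)) u = 0"
      by (auto simp: sect_points_def card_I)
    from xu consider t a g where "x = X t a" "u = U t g" "(\<Sum>y\<in>J. a (fst y) * t ^ snd y * g y) = 0"
      | a g where "x = Xi a" "u = Ui g" "(\<Sum>i=1..d. a i * g (i, ns i - 1)) = 0"
      unfolding conormal_cone_iff[OF nz] by blast
    then show "l \<in> ?\<phi> ` Z"
    proof cases
      case 1
      then have s: "sol j p t a g"
        using nz rows by (simp add: sol_def nonzero_X nonzero_U pairing_PR pairing_QR \<rho>_def)
      then have t: "t \<in> Z" by (rule fin)
      obtain c c' where c: "\<forall>i\<in>{1..d}. a i = c * A t i" and c': "\<forall>y\<in>J. g y = c' * G t y"
        using AG(2)[OF t s] by blast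
      then have "c \<noteq> 0" "c' \<noteq> 0" using s by (auto simp: sol_def)
      then have "l = ?\<phi> t" unfolding l 1 X_scale[OF c] U_scale[OF c'] by (simp add: line_scale)
      then show ?thesis using t by blast
    next
      case 2
      then have "solI j p a g"
        using nz rows by (simp add: solI_def nonzero_Xi nonzero_Ui pairing_PI pairing_QI sum_\<rho>I)
      then show ?thesis using inf by blast
    qed
  next
    fix l assume "l \<in> ?\<phi> ` Z"
    then obtain t where t: "t \<in> Z" "l = ?\<phi> t" by blast
    have s: "sol j p t (A t) (G t)" by (rule AG(1)[OF t(1)])
    then have nz: "nonzero (X t (A t))" "nonzero (U t (G t))"
      by (auto simp: sol_def nonzero_X nonzero_U)
    have "(\<Sum>y\<in>J. A t (fst y) * t ^ snd y * G t y) = 0" using s by (simp add: sol_def \<rho>_def)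
    then have "pr (X t (A t)) (U t (G t)) \<in> conormal_cone I C"
      unfolding conormal_cone_iff[OF nz] by blast
    then show "l \<in> sect_points I C j p"
      unfolding sect_points_def t(2) using s nz
      by (intro image_eqI[of _ _ "(X t (A t), U t (G t))"])
         (auto simp: sol_def pairing_PR pairing_QR card_I)
  qed
  moreover have "inj_on ?\<phi> Z"
  proof (rule inj_onI)
    fix t s assume ts: "t \<in> Z" "s \<in> Z" "?\<phi> t = ?\<phi> s"
    obtain i where i: "i \<in> {1..d}" "A t i \<noteq> 0" using AG(1)[OF ts(1)] by (auto simp: sol_def)
    have "X t (A t) \<in> line (X s (A s))" using ts(3) line_self by auto
    then obtain c where c: "X t (A t) = (\<lambda>y. c * X s (A s) y)" by (auto simp: line_def)
    have "X t (A t) (i, 0) = c * X s (A s) (i, 0)" "X t (A t) (i, 1) = c * X s (A s) (i, 1)"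
      unfolding c by simp_all
    then have "A t i = c * A s i" "A t i * t = c * A s i * s"
      using i ns_pos[OF i(1)] by (simp_all add: X_eq)
    then have "A t i * t = A t i * s" by simp
    then show "t = s" using i by simp
  qed
  ultimately show ?thesis using Z by (simp add: card_image)
qed

lemma param_space_affine:
  "p \<in> param_space I j \<Longrightarrow> q \<in> param_space I j \<Longrightarrow> (\<lambda>i. p i + t * (q i - p i)) \<in> param_space I j"
  by (auto simp: param_space_def)

lemma has_polar_degreeI:
  assumes "generically (param_space I j) (\<lambda>p. \<forall>a g. \<not> solI j p a g)"
    and "generically (param_space I j) (\<lambda>p. count_sols j p k)"
  shows "has_polar_degree I C j k"
proof -
  have "generically (param_space I j) (\<lambda>p. finite (sect_points I C j p) \<and> card (sect_points I C j p) = k)"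
    by (rule generically_mono[OF generically_conj[OF assms param_space_affine]]) (assumption+, elim conjE, rule sect_points_card)
  then show ?thesis unfolding has_polar_degree_def generically_def .
qed

subsection \<open>Families of rows\<close>

lemma polyfam_PR: "polyfam (\<lambda>p. PR p r i)"
  unfolding PR_def by (intro polyfam_sum polyfam_monom polyfun.coord)

lemma polyfam_QR: "polyfam (\<lambda>p. QR p r y)"
  unfolding QR_def by (intro polyfam_add polyfam_monom polyfun.coord polyfun_uminus)

lemma degree_PR: "degree (PR p r i) \<le> ns i"
  unfolding PR_def by (intro degree_sum_le) (auto intro: order_trans[OF degree_monom_le])

lemma degree_QR: "degree (QR p r y) \<le> 1"
  unfolding QR_def by (intro degree_add_le) (auto intro: order_trans[OF degree_monom_le])

lemma bij_Suc: "bij_betw Suc {..<d} {1..d}"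
  by (auto simp: bij_betw_def image_Suc_lessThan)

text \<open>The last entry of the enumeration of \<open>J\<close> is fixed: the witnesses below leave out
  the corresponding evaluation functional.\<close>

definition eJ :: "nat \<Rightarrow> nat \<times> nat" where
  "eJ = (SOME e. bij_betw e {..<N} J \<and> e (N - 1) = (d, ns d - 1))"

lemma eJ: "bij_betw eJ {..<N} J" "eJ (N - 1) = (d, ns d - 1)"
proof -
  let ?y = "(d, ns d - 1)"
  have y: "?y \<in> J" using d2 ns_pos[of d] by simp
  have N: "{..<N} = insert (N - 1) {..<N - 1}" using N_ge_d d2 by auto
  obtain e where e: "bij_betw e {..<N - 1} (J - {?y})"
    using ex_bij_betw_nat_finite[of "J - {?y}"] y by (auto simp: card_J atLeast0LessThan)
  have "bij_betw (e(N - 1 := ?y)) {..<N - 1} (J - {?y})"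
    using e by (rule bij_betw_cong[THEN iffD1, rotated]) auto
  then have "bij_betw (e(N - 1 := ?y)) ({..<N - 1} \<union> {N - 1}) ((J - {?y}) \<union> {(e(N - 1 := ?y)) (N - 1)})"
    by (intro notIn_Un_bij_betw) auto
  moreover have "J - {?y} \<union> {?y} = J" using y by blast
  ultimately have "\<exists>e. bij_betw e {..<N} J \<and> e (N - 1) = ?y"
    by (intro exI[of _ "e(N - 1 := ?y)"]) (simp add: N)
  then show "bij_betw eJ {..<N} J" "eJ (N - 1) = (d, ns d - 1)"
    unfolding eJ_def by (metis (mono_tags, lifting) someI_ex)+
qed

lemma eJ_in: "r < N \<Longrightarrow> eJ r \<in> J"
  using eJ(1) by (auto simp: bij_betw_def)

definition PD :: "(bool \<times> nat \<times> nat \<times> nat \<Rightarrow> complex) \<Rightarrow> complex poly" where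
  "PD p = rdet Suc d (PR p)"

definition QD :: "(bool \<times> nat \<times> nat \<times> nat \<Rightarrow> complex) \<Rightarrow> complex poly" where
  "QD p = rdet eJ N (QR p)"

text \<open>Signed maximal minors of the first \<open>d - 1\<close> rows on \<open>a\<close>; at
  every \<open>t\<close> they form a vector in the kernel of these rows.\<close>

definition pa :: "(bool \<times> nat \<times> nat \<times> nat \<Rightarrow> complex) \<Rightarrow> nat \<Rightarrow> complex poly" where
  "pa p i = cof Suc d (PR p) (d - 1) i"

definition qg :: "(bool \<times> nat \<times> nat \<times> nat \<Rightarrow> complex) \<Rightarrow> nat \<times> nat \<Rightarrow> complex poly" where
  "qg p y = cof eJ N (QR p) (N - 1) y"

definition \<rho>P :: "(bool \<times> nat \<times> nat \<times> nat \<Rightarrow> complex) \<Rightarrow> nat \<times> nat \<Rightarrow> complex poly" where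
  "\<rho>P p y = pa p (fst y) * monom 1 (snd y)"

definition ev :: "(nat \<times> nat \<Rightarrow> complex) \<Rightarrow> nat \<Rightarrow> complex \<Rightarrow> complex" where
  "ev g i t = (\<Sum>k<ns i. g (i, k) * t ^ k)"

text \<open>The coefficient of \<open>a i\<close> in the incidence equation when \<open>g\<close> is
  the cofactor vector \<open>qg\<close>.\<close>

definition \<sigma>P :: "(bool \<times> nat \<times> nat \<times> nat \<Rightarrow> complex) \<Rightarrow> nat \<Rightarrow> complex poly" where
  "\<sigma>P p i = (\<Sum>k<ns i. qg p (i, k) * monom 1 k)"

definition ED :: "(bool \<times> nat \<times> nat \<times> nat \<Rightarrow> complex) \<Rightarrow> complex poly" where
  "ED p = rdet eJ N ((QR p)(N - 1 := \<rho>P p))"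

lemma polyfam_PD: "polyfam PD" and polyfam_QD: "polyfam QD"
  unfolding PD_def[abs_def] QD_def[abs_def] by (intro polyfam_rdet polyfam_PR polyfam_QR)+

lemma polyfam_pa: "polyfam (\<lambda>p. pa p i)"
  unfolding pa_def cof_def by (intro polyfam_rdet polyfam_fun_upd polyfam_PR polyfam_const)

lemma polyfam_qg: "polyfam (\<lambda>p. qg p y)"
  unfolding qg_def cof_def by (intro polyfam_rdet polyfam_fun_upd polyfam_QR polyfam_const)

lemma polyfam_\<rho>P: "polyfam (\<lambda>p. \<rho>P p y)"
  unfolding \<rho>P_def by (intro polyfam_mult polyfam_pa polyfam_const)

lemma polyfam_\<sigma>P: "polyfam (\<lambda>p. \<sigma>P p i)"
  unfolding \<sigma>P_def by (intro polyfam_sum polyfam_mult polyfam_qg polyfam_const)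

lemma polyfam_ED: "polyfam ED"
  unfolding ED_def[abs_def] by (intro polyfam_rdet polyfam_fun_upd polyfam_QR polyfam_\<rho>P)

lemma degree_PD: "degree (PD p) \<le> N"
  unfolding PD_def N_def
  using degree_rdet[OF bij_Suc, of "PR p" "\<lambda>r. 0" ns] degree_PR by simp

lemma degree_QD: "degree (QD p) \<le> N"
  unfolding QD_def using degree_rdet[OF eJ(1), of "QR p" "\<lambda>r. 1" "\<lambda>y. 0"] degree_QR by simp

text \<open>Putting a monomial of degree \<open>ns i\<close> in place of the unit entry gives a
  determinant with column weights \<open>ns\<close>, of degree at most \<open>N\<close>; that
  monomial is then divided off.\<close>

lemma degree_pa:
  assumes i: "i \<in> {1..d}"
  shows "pa p i = 0 \<or> degree (pa p i) + ns i \<le> N"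
proof (cases "pa p i = 0")
  case False
  let ?w = "\<lambda>i'. if i' = i then monom 1 (ns i) else 0 :: complex poly"
  have "rdet Suc d ((PR p)(d - 1 := ?w)) = (\<Sum>y=1..d. ?w y * pa p y)"
    unfolding pa_def using d2 by (intro rdet_expand_row[OF bij_Suc]) auto
  also have "\<dots> = monom 1 (ns i) * pa p i"
    using i by (simp add: if_distrib[of "\<lambda>a. a * _"] cong: if_cong)
  finally have "degree (monom 1 (ns i) * pa p i) = degree (rdet Suc d ((PR p)(d - 1 := ?w)))" by simp
  also have "\<dots> \<le> N" unfolding N_def
    using degree_rdet[OF bij_Suc, of "(PR p)(d - 1 := ?w)" "\<lambda>r. 0" ns] degree_PR
    by (auto simp: degree_monom_eq)
  finally show ?thesis using False by (simp add: degree_mult_eq degree_monom_eq)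
qed simp

lemma degree_\<rho>P:
  assumes y: "y \<in> J"
  shows "degree (\<rho>P p y) \<le> N - 1"
proof -
  obtain i k where ik: "y = (i, k)" "i \<in> {1..d}" "k < ns i" using y by (cases y) auto
  have "degree (\<rho>P p y) \<le> degree (pa p i) + k" if "pa p i \<noteq> 0"
    unfolding \<rho>P_def ik using degree_mult_le[of "pa p i" "monom 1 k"] by (simp add: degree_monom_eq)
  then show ?thesis using degree_pa[OF ik(2), of p] ik by (cases "pa p i = 0") (auto simp: \<rho>P_def)
qed

text \<open>There are \<open>N - 1\<close> linear rows and one row of degree
  \<open>N - 1\<close>.\<close>

lemma degree_ED: "degree (ED p) \<le> 2 * (N - 1)"
proof -
  have "degree (ED p) \<le> (\<Sum>r<N. if r = N - 1 then N - 1 else 1) + (\<Sum>y\<in>J. 0)"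
    unfolding ED_def using degree_\<rho>P degree_QR
    by (intro degree_rdet[OF eJ(1)]) (auto simp del: One_nat_def)
  also have "\<dots> = 2 * (N - 1)"
  proof -
    have "{..<N} = insert (N - 1) {..<N - 1}" using N_ge_d d2 by auto
    then show ?thesis by simp
  qed
  finally show ?thesis .
qed

lemma poly_PD: "poly (PD p) t = rdet Suc d (\<lambda>r i. poly (PR p r i) t)"
  by (simp add: PD_def poly_rdet)

lemma poly_QD: "poly (QD p) t = rdet eJ N (\<lambda>r y. poly (QR p r y) t)"
  by (simp add: QD_def poly_rdet)

lemma poly_pa: "(\<lambda>i. poly (pa p i) t) = cof Suc d (\<lambda>r i. poly (PR p r i) t) (d - 1)"
  by (simp add: pa_def poly_cof fun_eq_iff)

lemma poly_qg: "(\<lambda>y. poly (qg p y) t) = cof eJ N (\<lambda>r y. poly (QR p r y) t) (N - 1)"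
  by (simp add: qg_def poly_cof fun_eq_iff)

lemma poly_\<rho>P: "(\<lambda>y. poly (\<rho>P p y) t) = \<rho> t (\<lambda>i. poly (pa p i) t)"
  by (simp add: \<rho>P_def \<rho>_def poly_monom fun_eq_iff)

lemma poly_\<sigma>P: "(\<lambda>i. poly (\<sigma>P p i) t) = (\<lambda>i. ev (\<lambda>y. poly (qg p y) t) i t)"
  by (simp add: \<sigma>P_def ev_def poly_monom poly_sum fun_eq_iff)

lemma poly_fun_upd: "(\<lambda>r y. poly ((R(r0 := w)) r y) t) = (\<lambda>r y. poly (R r y) t)(r0 := (\<lambda>y. poly (w y) t))"
  by (auto simp: fun_eq_iff)

lemma poly_ED: "poly (ED p) t = rdet eJ N ((\<lambda>r y. poly (QR p r y) t)(N - 1 := \<rho> t (\<lambda>i. poly (pa p i) t)))"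
  unfolding ED_def poly_rdet poly_fun_upd poly_\<rho>P ..

lemma sum_\<rho>: "(\<Sum>y\<in>J. \<rho> t a y * g y) = (\<Sum>i=1..d. ev g i t * a i)"
  unfolding sum_J ev_def sum_distrib_right by (intro sum.cong refl) (simp add: \<rho>_def)

end

section \<open>Interpolation nodes for the explicit sections\<close>

lemma poly_zero_by_roots:
  fixes f :: "complex poly"
  assumes "\<And>k. k \<ge> m \<Longrightarrow> coeff f k = 0" "m \<le> card Z" "\<And>z. z \<in> Z \<Longrightarrow> poly f z = 0"
  shows "f = 0"
proof (rule ccontr)
  assume f: "f \<noteq> 0"
  have "degree f < m"
  proof (rule ccontr)
    assume "\<not> degree f < m"
    then have "lead_coeff f = 0" using assms(1) by simp
    then show False using f by simp
  qed
  moreover have "card Z \<le> card {z. poly f z = 0}"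
    using assms(3) poly_roots_finite[OF f] by (intro card_mono) auto
  ultimately show False using card_poly_roots_bound[OF f] assms(2) by linarith
qed

text \<open>Odd integers here and even ones in \<open>mu\<close> give two disjoint families of
  distinct nonzero nodes. The \<open>lam\<close> are evaluation points for rows on \<open>g\<close>;
  the \<open>mu\<close> become roots of the determinant of the rows on \<open>a\<close>.\<close>

definition lam :: "nat \<times> nat \<Rightarrow> complex" where
  "lam y = of_nat (2 * prod_encode y + 1)"

definition mu :: "nat \<times> nat \<Rightarrow> complex" where
  "mu y = of_nat (2 * prod_encode y + 2)"

lemma lam_eq [simp]: "lam y = lam y' \<longleftrightarrow> y = y'"
proof -
  have "lam y = lam y' \<longleftrightarrow> 2 * prod_encode y + 1 = 2 * prod_encode y' + 1"
    unfolding lam_def of_nat_eq_iff ..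
  then show ?thesis by simp
qed

lemma mu_eq [simp]: "mu y = mu y' \<longleftrightarrow> y = y'"
proof -
  have "mu y = mu y' \<longleftrightarrow> 2 * prod_encode y + 2 = 2 * prod_encode y' + 2"
    unfolding mu_def of_nat_eq_iff ..
  then show ?thesis by simp
qed

lemma lam_neq_mu: "lam y \<noteq> mu y'"
proof -
  have "2 * prod_encode y + 1 \<noteq> 2 * prod_encode y' + 2" by presburger
  then show ?thesis unfolding lam_def mu_def of_nat_eq_iff .
qed

lemma lam_nonzero: "lam y \<noteq> 0"
  unfolding lam_def of_nat_eq_0_iff by simp

lemma inj_lam: "inj lam" and inj_mu: "inj mu"
  by (auto simp: inj_def)

context scroll begin

definition MU :: "nat \<Rightarrow> complex poly" where
  "MU i = (\<Prod>k<ns i. [:- mu (i, k), 1:])"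

lemma degree_MU: "degree (MU i) = ns i"
  unfolding MU_def by (subst degree_prod_eq_sum_degree) auto

lemma poly_MU_0: "poly (MU i) t = 0 \<longleftrightarrow> (\<exists>k<ns i. t = mu (i, k))"
  by (auto simp: MU_def poly_prod)

definition evp :: "(nat \<times> nat \<Rightarrow> complex) \<Rightarrow> nat \<Rightarrow> complex poly" where
  "evp g i = (\<Sum>k<ns i. monom (g (i, k)) k)"

lemma poly_evp: "poly (evp g i) t = ev g i t"
  by (simp add: evp_def ev_def poly_sum poly_monom)

lemma coeff_evp: "coeff (evp g i) k = (if k < ns i then g (i, k) else 0)"
  by (simp add: evp_def coeff_sum)

text \<open>Interpolation: the coefficients from \<open>m\<close> on are compared directly, and
  \<open>m\<close> values determine the rest.\<close>

lemma ev_eq_poly: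
  assumes "\<And>k. k \<ge> m \<Longrightarrow> coeff (evp g i) k = coeff q k" "m \<le> card Z" "\<And>z. z \<in> Z \<Longrightarrow> ev g i z = poly q z"
  shows "ev g i t = poly q t"
proof -
  have "evp g i - q = 0"
    by (rule poly_zero_by_roots[OF _ assms(2)]) (use assms in \<open>auto simp: poly_evp\<close>)
  then show ?thesis by (simp flip: poly_evp)
qed

lemma ev_zero:
  assumes "\<And>t. ev g i t = 0" "k < ns i"
  shows "g (i, k) = 0"
proof -
  have "evp g i = 0" using assms(1) by (simp add: poly_all_0_iff_0[symmetric] poly_evp)
  then show ?thesis using coeff_evp[of g i k] assms(2) by simp
qed

lemma ev_zero_J:
  assumes "\<And>i t. i \<in> {1..d} \<Longrightarrow> ev g i t = 0" "y \<in> J"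
  shows "g y = 0"
proof -
  obtain i k where y: "y = (i, k)" by (cases y)
  then have ik: "i \<in> {1..d}" "k < ns i" using assms(2) by auto
  show ?thesis unfolding y by (rule ev_zero[OF assms(1)[OF ik(1)] ik(2)])
qed

lemma sum_block:
  assumes "i \<in> {1..d}"
  shows "(\<Sum>y\<in>J. (if fst y = i then z ^ snd y else 0) * g y) = ev g i z"
  unfolding sum_J ev_def using assms
  by (subst sum.remove[of _ i]) (auto simp: mult.commute intro!: sum.neutral)

definition wit :: "nat \<Rightarrow> (nat \<Rightarrow> nat \<times> nat \<Rightarrow> complex) \<Rightarrow> (nat \<Rightarrow> nat \<times> nat \<Rightarrow> complex)
    \<Rightarrow> bool \<times> nat \<times> nat \<times> nat \<Rightarrow> complex" where
  "wit j Pf Qf = (\<lambda>(b, r, y). if y \<in> I \<and> r < (if b then card I - 1 - j else j - 1)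
     then (if b then Qf r y else Pf r y) else 0)"

lemma wit_in: "wit j Pf Qf \<in> param_space I j"
  by (auto simp: wit_def param_space_def)

lemma poly_PR_wit:
  "r < j - 1 \<Longrightarrow> i \<in> {1..d} \<Longrightarrow> poly (PR (wit j Pf Qf) r i) t = (\<Sum>k\<le>ns i. Pf r (i, k) * t ^ k)"
  unfolding poly_PR by (intro sum.cong refl) (simp add: wit_def)

lemma poly_QR_wit:
  "r < N + d - 1 - j \<Longrightarrow> y \<in> J \<Longrightarrow>
    poly (QR (wit j Pf Qf) r y) t = Qf r (fst y, Suc (snd y)) - t * Qf r y"
  unfolding poly_QR by (cases y) (auto simp: wit_def card_I)

lemma PI_wit: "r < j - 1 \<Longrightarrow> i \<in> {1..d} \<Longrightarrow> PI (wit j Pf Qf) r i = Pf r (i, ns i)"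
  by (simp add: PI_def wit_def)

lemma QI_wit: "r < N + d - 1 - j \<Longrightarrow> y \<in> J \<Longrightarrow> QI (wit j Pf Qf) r y = Qf r y"
  by (cases y) (simp add: QI_def wit_def card_I)

lemma rdet_nonzeroI:
  assumes "bij_betw e {..<n} S" and "\<And>v. (\<And>r. r < n \<Longrightarrow> (\<Sum>y\<in>S. R r y * v y) = 0) \<Longrightarrow> \<forall>y\<in>S. v y = 0"
  shows "rdet e n R \<noteq> (0 :: complex)"
  using assms(2) unfolding rdet_zero_iff[OF assms(1)] by blast

subsection \<open>Rows for the first factor\<close>

text \<open>Row \<open>r < d\<close> is \<open>MU\<^sub>r\<^sub>+\<^sub>1 e\<^sub>r\<^sub>+\<^sub>1 + e\<^sub>r\<^sub>+\<^sub>2\<close> (the second term only if \<open>r < d - 1\<close>). The kernel of the first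
  \<open>d - 1\<close> of them is then a line for every \<open>t\<close>, spanned by a vector with first entry 1.\<close>

definition Pf1 :: "nat \<Rightarrow> nat \<times> nat \<Rightarrow> complex" where
  "Pf1 r = (\<lambda>(i, k). if r = d then (if i = 1 \<and> k = 0 then 1 else 0)
     else if i = Suc r then coeff (MU i) k else if i = Suc (Suc r) \<and> k = 0 then 1 else 0)"

lemma Pf1_sum: "(\<Sum>k\<le>ns i. Pf1 r (i, k) * t ^ k) = (if r = d then (if i = 1 then 1 else 0)
     else if i = Suc r then poly (MU i) t else if i = Suc (Suc r) then 1 else 0)"
proof -
  have "(\<Sum>k\<le>ns i. coeff (MU i) k * t ^ k) = poly (MU i) t"
    by (simp add: poly_altdef degree_MU)
  moreover have "(\<Sum>k\<le>ns i. (if k = 0 then 1 else 0) * t ^ k) = 1"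
    by (simp add: if_distrib[of "\<lambda>a. a * _"] cong: if_cong)
  ultimately show ?thesis by (auto simp: Pf1_def)
qed

text \<open>Solves MU_i \<open>a_i\<close> + \<open>a_{i+1}\<close> = 0 successively from
  \<open>a_1\<close> = 1, without ever dividing by a value of \<open>MU\<close>.\<close>

definition \<Psi> :: "complex \<Rightarrow> nat \<Rightarrow> complex" where
  "\<Psi> t i = (\<Prod>i'\<in>{1..<i}. - poly (MU i') t)"

context
  fixes j p Qf
  assumes p: "p = wit j Pf1 Qf"
begin

lemma Pf1_row:
  assumes "r < j - 1"
  shows "(\<Sum>i=1..d. poly (PR p r i) t * a i) = (if r < d - 1 then poly (MU (Suc r)) t * a (Suc r) + a (Suc (Suc r))
    else if r = d - 1 then poly (MU d) t * a d else if r = d then a 1 else 0)"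
proof -
  have "(\<Sum>i=1..d. poly (PR p r i) t * a i) = (\<Sum>i=1..d. (if r = d then (if i = 1 then a 1 else 0)
     else (if i = Suc r then poly (MU i) t * a i else 0) + (if i = Suc (Suc r) then a i else 0)))"
    using assms by (intro sum.cong) (auto simp: p poly_PR_wit Pf1_sum)
  also have "\<dots> = (if r < d - 1 then poly (MU (Suc r)) t * a (Suc r) + a (Suc (Suc r))
    else if r = d - 1 then poly (MU d) t * a d else if r = d then a 1 else 0)"
    using d2 by (cases "r = d") (auto simp: sum.distrib)
  finally show ?thesis .
qed

lemma Pf1_kernel:
  assumes j: "d \<le> j" and ker: "\<And>r. r < d - 1 \<Longrightarrow> (\<Sum>i=1..d. poly (PR p r i) t * a i) = 0" and i: "i \<in> {1..d}"
  shows "a i = a 1 * \<Psi> t i"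
proof -
  have "1 \<le> i" "i \<le> d" using i by auto
  then show ?thesis
  proof (induction i rule: dec_induct)
    case base
    show ?case by (simp add: \<Psi>_def)
  next
    case (step n)
    then have n: "n - 1 < d - 1" "n - 1 < j - 1" "Suc (n - 1) = n" using j by auto
    then have "poly (MU n) t * a n + a (Suc n) = 0"
      using ker[OF n(1)] Pf1_row[OF n(2), of t a] by (simp only: n if_True)
    then show ?case using step by (simp add: \<Psi>_def eq_neg_iff_add_eq_0 algebra_simps)
  qed
qed

lemma Pf1_kernel_iff:
  assumes j: "d \<le> j"
  shows "(\<forall>r<d - 1. (\<Sum>i=1..d. poly (PR p r i) t * a i) = 0) \<longleftrightarrow> (\<forall>i\<in>{1..d}. a i = a 1 * \<Psi> t i)"
proof
  assume a: "\<forall>i\<in>{1..d}. a i = a 1 * \<Psi> t i"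
  show "\<forall>r<d - 1. (\<Sum>i=1..d. poly (PR p r i) t * a i) = 0"
  proof (intro allI impI)
    fix r assume r: "r < d - 1"
    have "\<Psi> t (Suc (Suc r)) = - poly (MU (Suc r)) t * \<Psi> t (Suc r)"
      by (simp add: \<Psi>_def)
    moreover have "Suc r \<in> {1..d}" "Suc (Suc r) \<in> {1..d}" using r by auto
    from a[THEN bspec, OF this(1)] a[THEN bspec, OF this(2)]
    have "poly (MU (Suc r)) t * a (Suc r) + a (Suc (Suc r))
      = a 1 * (poly (MU (Suc r)) t * \<Psi> t (Suc r) + \<Psi> t (Suc (Suc r)))"
      by (metis distrib_left mult.left_commute)
    ultimately have "poly (MU (Suc r)) t * a (Suc r) + a (Suc (Suc r)) = 0"
      by simp
    then show "(\<Sum>i=1..d. poly (PR p r i) t * a i) = 0" using Pf1_row[of r t a] r j by simp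
  qed
qed (use Pf1_kernel[OF j] in blast)

text \<open>The first coordinate is injective on the kernel for every \<open>t\<close>, so the first
  \<open>d - 1\<close> rows never lose rank.\<close>

lemma Pf1_unit_row:
  assumes j: "d \<le> j"
  shows "rdet Suc d ((\<lambda>r i. poly (PR p r i) t)(d - 1 := (\<lambda>i. if i = 1 then 1 else 0))) \<noteq> 0" (is "rdet _ _ ?R \<noteq> 0")
proof (rule rdet_nonzeroI[OF bij_Suc])
  fix a assume a: "\<And>r. r < d \<Longrightarrow> (\<Sum>i=1..d. ?R r i * a i) = 0"
  have "(\<Sum>i=1..d. poly (PR p r i) t * a i) = 0" if "r < d - 1" for r
    using a[of r] that by simp
  then have *: "a i = a 1 * \<Psi> t i" if "i \<in> {1..d}" for i using Pf1_kernel[OF j] that by blast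
  have "(\<Sum>i=1..d. (if i = 1 then 1 else 0) * a i) = a 1"
    using d2 by (simp add: if_distrib[of "\<lambda>a. a * _"] cong: if_cong)
  then have "a 1 = 0" using a[of "d - 1"] d2 by simp
  then show "\<forall>i\<in>{1..d}. a i = 0" using * by (metis mult_zero_left)
qed

lemma pa_wit1:
  assumes j: "d \<le> j"
  shows "poly (pa p 1) t \<noteq> 0" "i \<in> {1..d} \<Longrightarrow> poly (pa p i) t = poly (pa p 1) t * \<Psi> t i"
proof -
  show "poly (pa p 1) t \<noteq> 0"
    using Pf1_unit_row[OF j] fun_cong[OF poly_pa[of p t], of 1] by (simp add: cof_def)
  have "(\<Sum>i=1..d. poly (PR p r i) t * poly (pa p i) t) = 0" if "r < d - 1" for r
    using cof_kernel[OF bij_Suc, of "d - 1" r "\<lambda>r i. poly (PR p r i) t"] that d2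
    unfolding poly_pa[symmetric] by simp
  then show "i \<in> {1..d} \<Longrightarrow> poly (pa p i) t = poly (pa p 1) t * \<Psi> t i"
    using Pf1_kernel[OF j, of t "\<lambda>i. poly (pa p i) t"] by blast
qed

text \<open>On the kernel line the last row takes the value MU_d times the last entry of
  \<open>\<Psi>\<close>, up to sign the product of all MU_i, whose roots are the nodes
  \<open>mu\<close>.\<close>

lemma PD_wit1_root:
  assumes j: "d < j"
  shows "poly (PD p) t = 0 \<longleftrightarrow> t \<in> mu ` J"
proof -
  have last: "(\<Sum>i=1..d. poly (PR p (d - 1) i) t * a i) = poly (MU d) t * a d" for a
    using Pf1_row[of "d - 1" t a] j d2 by simp
  have prod: "poly (MU d) t * \<Psi> t d = 0 \<longleftrightarrow> t \<in> mu ` J"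
  proof -
    have "poly (MU d) t * \<Psi> t d = 0 \<longleftrightarrow> (\<exists>i\<in>{1..d}. poly (MU i) t = 0)"
      using d2 by (auto simp: \<Psi>_def) (metis atLeastLessThan_iff le_neq_implies_less One_nat_def)
    also have "\<dots> \<longleftrightarrow> t \<in> mu ` J" by (force simp: poly_MU_0 J_def)
    finally show ?thesis .
  qed
  have "poly (PD p) t = 0 \<longleftrightarrow> (\<exists>a. (\<exists>i\<in>{1..d}. a i \<noteq> 0) \<and> (\<forall>r<d. (\<Sum>i=1..d. poly (PR p r i) t * a i) = 0))"
    unfolding poly_PD rdet_zero_iff[OF bij_Suc] ..
  also have "\<dots> \<longleftrightarrow> (\<exists>a. (\<exists>i\<in>{1..d}. a i \<noteq> 0) \<and> (\<forall>i\<in>{1..d}. a i = a 1 * \<Psi> t i) \<and> poly (MU d) t * a d = 0)"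
  proof -
    have "(\<forall>r<d. Q r) \<longleftrightarrow> (\<forall>r<d - 1. Q r) \<and> Q (d - 1)" for Q
      using d2 by (metis Suc_diff_1 less_Suc_eq less_le_trans pos2)
    then show ?thesis using Pf1_kernel_iff[of t] j last by auto
  qed
  also have "\<dots> \<longleftrightarrow> t \<in> mu ` J"
  proof
    assume "\<exists>a. (\<exists>i\<in>{1..d}. a i \<noteq> 0) \<and> (\<forall>i\<in>{1..d}. a i = a 1 * \<Psi> t i) \<and> poly (MU d) t * a d = 0"
    then obtain a where a: "\<exists>i\<in>{1..d}. a i \<noteq> 0" "\<forall>i\<in>{1..d}. a i = a 1 * \<Psi> t i" "poly (MU d) t * a d = 0" by blast
    then have "a 1 \<noteq> 0" by (metis mult_zero_left)
    moreover have "d \<in> {1..d}" using d2 by simp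
    then have "a d = a 1 * \<Psi> t d" by (rule a(2)[THEN bspec])
    ultimately have "poly (MU d) t * \<Psi> t d = 0" using a(3) by simp
    then show "t \<in> mu ` J" unfolding prod .
  next
    assume "t \<in> mu ` J"
    then have "poly (MU d) t * \<Psi> t d = 0" unfolding prod .
    moreover have "\<Psi> t 1 = 1" by (simp add: \<Psi>_def)
    ultimately show "\<exists>a. (\<exists>i\<in>{1..d}. a i \<noteq> 0) \<and> (\<forall>i\<in>{1..d}. a i = a 1 * \<Psi> t i) \<and> poly (MU d) t * a d = 0"
      using d2 by (intro exI[of _ "\<Psi> t"] conjI bexI[of _ 1]) auto
  qed
  finally show ?thesis .
qed

lemma PD_wit1:
  assumes j: "d < j"
  shows "PD p \<noteq> 0" "card {t. poly (PD p) t = 0} = N"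
proof -
  have roots: "{t. poly (PD p) t = 0} = mu ` J" using PD_wit1_root[OF j] by blast
  then show "card {t. poly (PD p) t = 0} = N"
    using card_image[OF inj_on_subset[OF inj_mu subset_UNIV, of J]] by (simp add: card_J)
  show "PD p \<noteq> 0"
  proof
    assume "PD p = 0"
    then have "mu ` J = UNIV" using roots by simp
    then show False using infinite_UNIV_char_0[where 'a = complex] finite_imageI[OF finite_J, of mu] by simp
  qed
qed

end

end

context scroll begin

subsection \<open>Rows for the second factor, \<open>j \<ge> d\<close>\<close>

lemma J_enum:
  assumes "y \<in> J" "y \<noteq> (d, ns d - 1)"
  obtains r where "r < N - 1" "eJ r = y"
proof -
  have "y \<in> eJ ` {..<N}" using assms(1) eJ(1) by (simp add: bij_betw_def)
  then obtain r where r: "r < N" "eJ r = y" by auto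
  have "r \<noteq> N - 1" using r eJ(2) assms(2) by auto
  then show ?thesis using r that[of r] by simp
qed

lemma eJ_inj: "r < N \<Longrightarrow> r' < N \<Longrightarrow> eJ r = eJ r' \<longleftrightarrow> r = r'"
  using eJ(1) by (auto simp: bij_betw_def inj_on_def)

text \<open>Up to scaling, the only polynomial of degree below \<open>ns d\<close> that vanishes at
  every node of block \<open>d\<close> except the last.\<close>

definition GP :: "complex poly" where
  "GP = (\<Prod>k<ns d - 1. [:- lam (d, k), 1:])"

lemma degree_GP: "degree GP = ns d - 1"
  unfolding GP_def by (subst degree_prod_eq_sum_degree) auto

lemma poly_GP_0: "poly GP t = 0 \<longleftrightarrow> (\<exists>k<ns d - 1. t = lam (d, k))"
  by (auto simp: GP_def poly_prod)

lemma lead_GP: "coeff GP (ns d - 1) = 1"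
proof -
  have "lead_coeff GP = 1" unfolding GP_def by (subst lead_coeff_prod) auto
  then show ?thesis by (simp add: degree_GP)
qed

definition Qw :: "complex \<Rightarrow> nat \<times> nat \<Rightarrow> complex" where
  "Qw \<epsilon> y = (if fst y = 1 then \<epsilon> / poly GP (lam y) else 0)"

text \<open>Row \<open>r\<close>, with \<open>eJ r = (i, k)\<close> and \<open>l = lam (i, k)\<close>, is the functional \<open>f\<^sub>i(l) - w f\<^sub>d(l)\<close>, which on
  \<open>f = (T - t) g\<close> is \<open>(l - t) (g\<^sub>i(l) - w g\<^sub>d(l))\<close>. The weights \<open>w\<close> vanish except for \<open>i = 1\<close>, where they
  make the common kernel of the first \<open>N - 1\<close> functionals in \<open>g\<close> the line through \<open>g\<^sub>d = GP\<close>,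
  \<open>g\<^sub>1 = \<epsilon>\<close>, other \<open>g\<^sub>i = 0\<close>. With \<open>\<epsilon> = 0\<close> the roots of \<open>GP\<close> would be double roots of \<open>ED\<close>.\<close>

definition Qf1 :: "complex \<Rightarrow> nat \<Rightarrow> nat \<times> nat \<Rightarrow> complex" where
  "Qf1 \<epsilon> r y = (if fst y = fst (eJ r) then lam (eJ r) ^ snd y else 0)
     - Qw \<epsilon> (eJ r) * (if fst y = d then lam (eJ r) ^ snd y else 0)"

text \<open>The functional of a row on \<open>g\<close> once its factor \<open>lam y - t\<close> is
  split off; what remains does not depend on \<open>t\<close>.\<close>

definition QL :: "complex \<Rightarrow> (nat \<times> nat \<Rightarrow> complex) \<Rightarrow> nat \<times> nat \<Rightarrow> complex" where
  "QL \<epsilon> g y = ev g (fst y) (lam y) - Qw \<epsilon> y * ev g d (lam y)"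

lemma Qf1_sum:
  assumes "r < N"
  shows "(\<Sum>y\<in>J. Qf1 \<epsilon> r y * g y) = QL \<epsilon> g (eJ r)"
proof -
  have i: "fst (eJ r) \<in> {1..d}" using eJ_in[OF assms] by (cases "eJ r") auto
  have d: "d \<in> {1..d}" using d2 by simp
  show ?thesis
    unfolding QL_def sum_block[OF i, symmetric] sum_block[OF d, symmetric] sum_distrib_left sum_subtractf[symmetric]
    by (intro sum.cong refl) (simp add: Qf1_def algebra_simps)
qed

lemma Qf1_row:
  assumes p: "p = wit j Pf (Qf1 \<epsilon>)" and r: "r < N + d - 1 - j" "r < N"
  shows "(\<Sum>y\<in>J. poly (QR p r y) t * g y) = (lam (eJ r) - t) * QL \<epsilon> g (eJ r)"
  unfolding Qf1_sum[OF r(2), symmetric] sum_distrib_left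
  by (intro sum.cong refl) (auto simp: p poly_QR_wit[OF r(1)] Qf1_def algebra_simps)

text \<open>Block \<open>d\<close> is determined first, because the weights refer to its values: its
  nodes leave a multiple \<open>c\<close> of \<open>GP\<close>. The nodes of block 1 then give the
  constant \<open>c * \<epsilon>\<close>, and the other blocks vanish.\<close>

lemma QL_kernel:
  assumes QL: "\<And>r. r < N - 1 \<Longrightarrow> QL \<epsilon> g (eJ r) = 0"
  obtains c where "\<And>t. ev g d t = c * poly GP t" "\<And>t. ev g 1 t = c * \<epsilon>"
    "\<And>i t. i \<in> {1<..<d} \<Longrightarrow> ev g i t = 0"
proof -
  have QL': "QL \<epsilon> g y = 0" if "y \<in> J" "y \<noteq> (d, ns d - 1)" for y
    using J_enum[OF that] QL by metis
  have d: "d \<in> {1..d}" "d \<noteq> 1" using d2 by auto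
  define c where "c = g (d, ns d - 1)"
  have evd: "ev g d t = poly (smult c GP) t" for t
  proof (rule ev_eq_poly)
    show "coeff (evp g d) k = coeff (smult c GP) k" if "k \<ge> ns d - 1" for k
    proof (cases "k = ns d - 1")
      case True
      then show ?thesis using ns_pos[OF d(1)] using lead_GP by (simp add: coeff_evp c_def)
    next
      case False
      then show ?thesis using that by (simp add: coeff_evp coeff_eq_0 degree_GP)
    qed
    show "ns d - 1 \<le> card ((\<lambda>k. lam (d, k)) ` {..<ns d - 1})"
      by (subst card_image) (auto simp: inj_on_def)
    fix z assume "z \<in> (\<lambda>k. lam (d, k)) ` {..<ns d - 1}"
    then obtain k where k: "k < ns d - 1" "z = lam (d, k)" by blast
    then have "QL \<epsilon> g (d, k) = 0" using d by (intro QL') auto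
    then have "ev g d z = 0" using d k by (simp add: QL_def Qw_def)
    moreover have "poly GP z = 0" using k poly_GP_0 by blast
    ultimately show "ev g d z = poly (smult c GP) z" by simp
  qed
  have ev1: "ev g 1 t = poly [:c * \<epsilon>:] t" for t
  proof (rule ev_eq_poly)
    show "coeff (evp g 1) k = coeff [:c * \<epsilon>:] k" if "k \<ge> ns 1" for k
      using that ns_pos[of 1] d2 by (cases k) (auto simp: coeff_evp)
    show "ns 1 \<le> card ((\<lambda>k. lam (1, k)) ` {..<ns 1})"
      by (subst card_image) (auto simp: inj_on_def)
    fix z assume "z \<in> (\<lambda>k. lam (1, k)) ` {..<ns 1}"
    then obtain k where k: "k < ns 1" "z = lam (1, k)" by blast
    then have "QL \<epsilon> g (1, k) = 0" using d by (intro QL') auto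
    moreover have "poly GP z \<noteq> 0" using k d by (auto simp: poly_GP_0)
    ultimately show "ev g 1 z = poly [:c * \<epsilon>:] z"
      using k evd[of z] by (simp add: QL_def Qw_def)
  qed
  have evi: "ev g i t = poly 0 t" if i: "i \<in> {1<..<d}" for i t
  proof (rule ev_eq_poly)
    show "coeff (evp g i) k = coeff 0 k" if "k \<ge> ns i" for k
      using that by (simp add: coeff_evp)
    show "ns i \<le> card ((\<lambda>k. lam (i, k)) ` {..<ns i})"
      by (subst card_image) (auto simp: inj_on_def)
    fix z assume "z \<in> (\<lambda>k. lam (i, k)) ` {..<ns i}"
    then obtain k where k: "k < ns i" "z = lam (i, k)" by blast
    then have "QL \<epsilon> g (i, k) = 0" using i by (intro QL') auto
    then show "ev g i z = poly 0 z" using k i by (simp add: QL_def Qw_def)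
  qed
  show ?thesis
    by (rule that[of c]) (use evd ev1 evi in simp_all)
qed

definition g0 :: "complex \<Rightarrow> nat \<times> nat \<Rightarrow> complex" where
  "g0 \<epsilon> = (\<lambda>(i, k). if i = d then coeff GP k else if i = 1 \<and> k = 0 then \<epsilon> else 0)"

lemma ev_g0: "i \<in> {1..d} \<Longrightarrow> ev (g0 \<epsilon>) i t = (if i = d then poly GP t else if i = 1 then \<epsilon> else 0)"
proof -
  assume i: "i \<in> {1..d}"
  have "poly (evp (g0 \<epsilon>) i) t = (if i = d then poly GP t else if i = 1 then \<epsilon> else 0)"
  proof -
    have "evp (g0 \<epsilon>) i = (if i = d then GP else if i = 1 then [:\<epsilon>:] else 0)"
    proof (rule poly_eqI)
      fix k show "coeff (evp (g0 \<epsilon>) i) k = coeff (if i = d then GP else if i = 1 then [:\<epsilon>:] else 0) k"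
        using ns_pos[OF i] by (cases k) (auto simp: coeff_evp g0_def coeff_eq_0 degree_GP)
    qed
    then show ?thesis by simp
  qed
  then show ?thesis by (simp add: poly_evp)
qed

lemma g0_nonzero: "g0 \<epsilon> (d, ns d - 1) = 1"
  using lead_GP by (simp add: g0_def)

lemma QL_g0:
  assumes "r < N - 1"
  shows "QL \<epsilon> (g0 \<epsilon>) (eJ r) = 0"
proof -
  obtain i k where ik: "eJ r = (i, k)" by (cases "eJ r")
  have "(i, k) \<in> J" using eJ_in[of r] assms ik by simp
  then have i: "i \<in> {1..d}" "k < ns i" by auto
  have "(i, k) \<noteq> (d, ns d - 1)" using eJ_inj[of r "N - 1"] eJ(2) assms ik by auto
  then have "i = d \<Longrightarrow> poly GP (lam (i, k)) = 0" using i by (auto simp: poly_GP_0)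
  moreover have "i \<noteq> d \<Longrightarrow> poly GP (lam (i, k)) \<noteq> 0" by (auto simp: poly_GP_0)
  ultimately show ?thesis using i d2 by (auto simp: ik QL_def Qw_def ev_g0)
qed

text \<open>With \<open>a = \<Psi> t\<close> and \<open>g = g0 \<epsilon>\<close> the incidence
  expression is \<open>\<epsilon>\<close> plus the value of this polynomial at
  \<open>t\<close>.\<close>

definition HP :: "complex poly" where
  "HP = GP * (\<Prod>i\<in>{1..<d}. - MU i)"

lemma poly_HP: "poly HP t = poly GP t * \<Psi> t d"
  by (simp add: HP_def \<Psi>_def poly_prod)

lemma degree_HP: "degree HP = N - 1"
proof -
  have GP: "GP \<noteq> 0" using lead_GP by auto
  have MU: "MU i \<noteq> 0" for i by (auto simp: MU_def)
  have "degree HP = degree GP + (\<Sum>i\<in>{1..<d}. ns i)"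
    unfolding HP_def using GP MU by (subst degree_mult_eq) (auto simp: degree_prod_eq_sum_degree degree_MU)
  moreover have "{1..d} = insert d {1..<d}" using d2 by auto
  ultimately show ?thesis using ns_pos[of d] d2 by (simp add: degree_GP N_def)
qed

text \<open>Only finitely many values are excluded. Avoiding negated critical values makes the roots
  simple; avoiding the nodes \<open>lam\<close> keeps the two families of roots of \<open>ED\<close>
  apart; avoiding \<open>mu\<close> serves the roots of \<open>PD\<close> when j = d + 1.\<close>

lemma ex_eps:
  obtains \<epsilon> where "card {t. poly (HP + [:\<epsilon>:]) t = 0} = N - 1"
    "\<And>y. y \<in> J \<Longrightarrow> poly (HP + [:\<epsilon>:]) (lam y) \<noteq> 0" "\<And>y. y \<in> J \<Longrightarrow> poly (HP + [:\<epsilon>:]) (mu y) \<noteq> 0"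
proof -
  have N: "N - 1 \<ge> 1" using N_ge_d d2 by simp
  have "pderiv HP \<noteq> 0" using N degree_HP by (simp add: pderiv_eq_0_iff)
  then have "finite ((\<lambda>t. - poly HP t) ` ({t. poly (pderiv HP) t = 0} \<union> lam ` J \<union> mu ` J))"
    using poly_roots_finite[of "pderiv HP"] by simp
  then obtain \<epsilon> where \<epsilon>: "\<epsilon> \<notin> (\<lambda>t. - poly HP t) ` ({t. poly (pderiv HP) t = 0} \<union> lam ` J \<union> mu ` J)"
    using infinite_UNIV_char_0[where 'a = complex] by (metis UNIV_eq_I)
  have H: "poly (HP + [:\<epsilon>:]) t = 0 \<longleftrightarrow> \<epsilon> = - poly HP t" for t
    by (simp add: eq_neg_iff_add_eq_0 add.commute)
  have deg: "degree (HP + [:\<epsilon>:]) = N - 1"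
    using N degree_HP by (subst degree_add_eq_left) auto
  then have "HP + [:\<epsilon>:] \<noteq> 0" using N by auto
  then have "card {t. poly (HP + [:\<epsilon>:]) t = 0} = degree (HP + [:\<epsilon>:])"
    by (subst card_roots_squarefree) (use \<epsilon> H in \<open>auto simp: pderiv_add pderiv_pCons\<close>)
  then show ?thesis
    by (intro that[of \<epsilon>]) (use \<epsilon> H deg in auto)
qed

text \<open>On the line of \<open>QL_kernel\<close> the incidence functional is
  \<open>c * a1\<close> times the value of \<open>HP + [:\<epsilon>:]\<close> at \<open>t\<close>,
  so off the roots it forces \<open>c = 0\<close>.\<close>

lemma \<beta>_kernel:
  assumes QL: "\<And>r. r < N - 1 \<Longrightarrow> QL \<epsilon> g (eJ r) = 0"
    and a: "\<And>i. i \<in> {1..d} \<Longrightarrow> a i = a1 * \<Psi> t i" "a1 \<noteq> 0"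
    and \<beta>: "(\<Sum>y\<in>J. \<rho> t a y * g y) = 0" and t: "poly (HP + [:\<epsilon>:]) t \<noteq> 0"
  shows "\<forall>y\<in>J. g y = 0"
proof -
  obtain c where c: "\<And>t. ev g d t = c * poly GP t" "\<And>t. ev g 1 t = c * \<epsilon>"
    "\<And>i t. i \<in> {1<..<d} \<Longrightarrow> ev g i t = 0" using QL_kernel[OF QL] by blast
  have "{1..d} = insert 1 (insert d {1<..<d})" using d2 by auto
  then have "(\<Sum>y\<in>J. \<rho> t a y * g y) = ev g 1 t * a 1 + ev g d t * a d"
    unfolding sum_\<rho> using d2 c(3) by simp
  also have "\<dots> = c * \<epsilon> * (a1 * \<Psi> t 1) + c * poly GP t * (a1 * \<Psi> t d)"
    using a(1)[of 1] a(1)[of d] c(1,2) d2 by simp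
  also have "\<dots> = c * a1 * poly (HP + [:\<epsilon>:]) t"
    by (simp add: poly_HP \<Psi>_def[of t "Suc 0"] algebra_simps)
  finally have "c = 0" using \<beta> t a(2) by simp
  have "ev g i t = 0" if "i \<in> {1..d}" for i t
  proof -
    have "i = 1 \<or> i = d \<or> i \<in> {1<..<d}" using that by auto
    then show ?thesis using c(1)[of t] c(2)[of t] c(3)[of i t] \<open>c = 0\<close> by auto
  qed
  then show ?thesis using ev_zero_J by blast
qed

lemma \<beta>_g0:
  assumes a: "\<And>i. i \<in> {1..d} \<Longrightarrow> a i = a1 * \<Psi> t i" and t: "poly (HP + [:\<epsilon>:]) t = 0"
  shows "(\<Sum>y\<in>J. \<rho> t a y * g0 \<epsilon> y) = 0"
proof -
  have "{1..d} = insert 1 (insert d {1<..<d})" using d2 by auto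
  then have "(\<Sum>y\<in>J. \<rho> t a y * g0 \<epsilon> y) = ev (g0 \<epsilon>) 1 t * a 1 + ev (g0 \<epsilon>) d t * a d"
    unfolding sum_\<rho> using d2 by (simp add: ev_g0)
  also have "\<dots> = \<epsilon> * (a1 * \<Psi> t 1) + poly GP t * (a1 * \<Psi> t d)"
    using a[of 1] a[of d] d2 by (simp add: ev_g0)
  also have "\<dots> = a1 * poly (HP + [:\<epsilon>:]) t"
    by (simp add: poly_HP \<Psi>_def[of t "Suc 0"] algebra_simps)
  finally show ?thesis using t by simp
qed

text \<open>The determinant vanishes exactly where a factor \<open>lam (eJ r) - t\<close> kills one
  of the first \<open>N - 1\<close> rows or where the incidence row dies on their kernel line: two
  disjoint sets of \<open>N - 1\<close> points.\<close>

lemma ED_wit: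
  assumes p: "p = wit d Pf1 (Qf1 \<epsilon>)" and \<epsilon>: "card {t. poly (HP + [:\<epsilon>:]) t = 0} = N - 1"
    "\<And>y. y \<in> J \<Longrightarrow> poly (HP + [:\<epsilon>:]) (lam y) \<noteq> 0"
  shows "ED p \<noteq> 0" "2 * (N - 1) \<le> card {t. poly (ED p) t = 0}"
proof -
  let ?H = "HP + [:\<epsilon>:]"
  let ?R = "\<lambda>t. (\<lambda>r y. poly (QR p r y) t)(N - 1 := \<rho> t (\<lambda>i. poly (pa p i) t))"
  let ?Z = "(\<lambda>r. lam (eJ r)) ` {..<N - 1} \<union> {t. poly ?H t = 0}"
  have N: "N > 0" using N_ge_d d2 by simp
  have a1: "poly (pa p 1) t \<noteq> 0" for t by (rule pa_wit1(1)[OF p]) simp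
  have a2: "poly (pa p i) t = poly (pa p 1) t * \<Psi> t i" if "i \<in> {1..d}" for i t
    by (rule pa_wit1(2)[OF p _ that]) simp
  have row: "(\<Sum>y\<in>J. ?R t r y * g y) = (lam (eJ r) - t) * QL \<epsilon> g (eJ r)" if "r < N - 1" for t r g
    using Qf1_row[OF p, of r t g] that by simp
  have last: "(\<Sum>y\<in>J. ?R t (N - 1) y * g y) = (\<Sum>y\<in>J. \<rho> t (\<lambda>i. poly (pa p i) t) y * g y)" for t g by simp
  have roots: "{t. poly (ED p) t = 0} = ?Z"
  proof (intro Set.set_eqI iffI)
    fix t assume "t \<in> ?Z"
    then consider r where "r < N - 1" "t = lam (eJ r)" | "poly ?H t = 0" by blast
    then have "poly (ED p) t = 0"
    proof cases
      case 1
      have "?R t r y = 0" if "y \<in> J" for y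
        using row[OF 1(1), of t "\<lambda>z. if z = y then 1 else 0"] 1(2) that
        by (simp add: if_distrib[of "\<lambda>a. _ * a"] cong: if_cong)
      then show ?thesis unfolding poly_ED using 1 by (intro rdet_zero_row[OF eJ(1), of r]) auto
    next
      case 2
      have "(\<Sum>y\<in>J. ?R t r y * g0 \<epsilon> y) = 0" if "r < N" for r
      proof (cases "r = N - 1")
        case True
        then show ?thesis using \<beta>_g0[OF a2 2] by simp
      next
        case False
        then show ?thesis using row[of r t "g0 \<epsilon>"] QL_g0[of r \<epsilon>] that by simp
      qed
      moreover have "(d, ns d - 1) \<in> J" using d2 ns_pos[of d] by simp
      ultimately show ?thesis unfolding poly_ED rdet_zero_iff[OF eJ(1)]
        using g0_nonzero[of \<epsilon>] by (intro exI[of _ "g0 \<epsilon>"] conjI bexI[of _ "(d, ns d - 1)"]) auto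
    qed
    then show "t \<in> {t. poly (ED p) t = 0}" by simp
  next
    fix t assume t: "t \<in> {t. poly (ED p) t = 0}"
    show "t \<in> ?Z"
    proof (rule ccontr)
      assume nt: "t \<notin> ?Z"
      have "poly (ED p) t \<noteq> 0" unfolding poly_ED
      proof (rule rdet_nonzeroI[OF eJ(1)])
        fix g assume g: "\<And>r. r < N \<Longrightarrow> (\<Sum>y\<in>J. ?R t r y * g y) = 0"
        have "QL \<epsilon> g (eJ r) = 0" if "r < N - 1" for r
        proof -
          have "t \<noteq> lam (eJ r)" using nt that by blast
          then show ?thesis using row[OF that, of t g] g[of r] that by simp
        qed
        moreover have "(\<Sum>y\<in>J. \<rho> t (\<lambda>i. poly (pa p i) t) y * g y) = 0"
          using g[of "N - 1"] N by (simp only: last)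
        moreover have "poly ?H t \<noteq> 0" using nt by blast
        ultimately show "\<forall>y\<in>J. g y = 0"
          using a1[of t] a2[of _ t] by (rule_tac \<beta>_kernel[of \<epsilon> g "\<lambda>i. poly (pa p i) t" "poly (pa p 1) t" t])
      qed
      then show False using t by simp
    qed
  qed
  have "?H \<noteq> 0" using \<epsilon>(2)[OF eJ_in[OF N]] by (metis poly_0)
  then have fin: "finite {t. poly ?H t = 0}" by (rule poly_roots_finite)
  show "ED p \<noteq> 0"
  proof
    assume "ED p = 0"
    then have "?Z = UNIV" using roots by simp
    moreover have "finite ?Z" using fin by simp
    ultimately show False using infinite_UNIV_char_0[where 'a = complex] by simp
  qed
  have "card ((\<lambda>r. lam (eJ r)) ` {..<N - 1}) = N - 1"
    by (subst card_image) (auto simp: inj_on_def eJ_inj)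
  moreover have "(\<lambda>r. lam (eJ r)) ` {..<N - 1} \<inter> {t. poly ?H t = 0} = {}"
  proof -
    have "poly ?H (lam (eJ r)) \<noteq> 0" if "r < N - 1" for r
      using that by (intro \<epsilon>(2) eJ_in) simp
    then show ?thesis by blast
  qed
  ultimately have "card ?Z = (N - 1) + (N - 1)"
    using fin \<epsilon>(1) by (subst card_Un_disjoint) auto
  then show "2 * (N - 1) \<le> card {t. poly (ED p) t = 0}" unfolding roots by simp
qed

text \<open>For j = d + 1 only \<open>N - 2\<close> rows on \<open>g\<close> remain, and the
  completing row supplies the missing functional \<open>QL\<close>. At a node \<open>mu\<close> none
  of the factors \<open>lam (eJ r) - t\<close> vanishes.\<close>

lemma B_wit:
  assumes p: "p = wit (Suc d) Pf1 (Qf1 \<epsilon>)" and t: "t \<in> mu ` J" "poly (HP + [:\<epsilon>:]) t \<noteq> 0"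
  shows "rdet eJ N ((\<lambda>r y. poly (QR p r y) t)(N - 2 := \<rho> t (\<lambda>i. poly (pa p i) t), N - 1 := Qf1 \<epsilon> (N - 2))) \<noteq> 0"
    (is "rdet _ _ ?R \<noteq> 0")
proof (rule rdet_nonzeroI[OF eJ(1)])
  have N: "N \<ge> 2" using N_ge_d d2 by simp
  have a1: "poly (pa p 1) t \<noteq> 0" for t by (rule pa_wit1(1)[OF p]) simp
  have a2: "poly (pa p i) t = poly (pa p 1) t * \<Psi> t i" if "i \<in> {1..d}" for i t
    by (rule pa_wit1(2)[OF p _ that]) simp
  fix g assume g: "\<And>r. r < N \<Longrightarrow> (\<Sum>y\<in>J. ?R r y * g y) = 0"
  have "QL \<epsilon> g (eJ r) = 0" if r: "r < N - 1" for r
  proof (cases "r = N - 2")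
    case True
    have "(\<Sum>y\<in>J. Qf1 \<epsilon> (N - 2) y * g y) = 0" using g[of "N - 1"] N by simp
    then show ?thesis using Qf1_sum[of "N - 2" \<epsilon> g] N True by simp
  next
    case False
    then have "(\<Sum>y\<in>J. poly (QR p r y) t * g y) = 0" using g[of r] r by simp
    moreover have "lam (eJ r) - t \<noteq> 0" using t(1) by (auto simp: lam_neq_mu)
    ultimately show ?thesis using Qf1_row[OF p, of r t g] False r by simp
  qed
  moreover have "(\<Sum>y\<in>J. \<rho> t (\<lambda>i. poly (pa p i) t) y * g y) = 0"
    using g[of "N - 2"] N by (auto split: if_splits)
  ultimately show "\<forall>y\<in>J. g y = 0"
    using t(2) a1[of t] a2[of _ t] by (rule_tac \<beta>_kernel[of \<epsilon> g "\<lambda>i. poly (pa p i) t" "poly (pa p 1) t" t])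
qed

end

context scroll begin

subsection \<open>Rows for the second factor, \<open>j < d\<close>\<close>

lemma eJ_onto:
  assumes "y \<in> J"
  obtains r where "r < N" "eJ r = y"
proof -
  have "y \<in> eJ ` {..<N}" using assms eJ(1) by (simp add: bij_betw_def)
  then show ?thesis using that by auto
qed

lemma fst_eJ: "r < N \<Longrightarrow> fst (eJ r) \<in> {1..d}"
  using eJ_in[of r] by (cases "eJ r") auto

definition Qev :: "nat \<Rightarrow> nat \<times> nat \<Rightarrow> complex" where
  "Qev r y = (if fst y = fst (eJ r) then lam (eJ r) ^ snd y else 0)"

text \<open>Subtracting the last evaluation from the others keeps the first \<open>N - 1\<close> rows independent at all
  roots \<open>lam y\<close> of the determinant, so that their cofactors do not vanish there.\<close>

definition Qf2 :: "nat \<Rightarrow> nat \<times> nat \<Rightarrow> complex" where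
  "Qf2 r y = (if r < N - 1 then Qev r y - Qev (N - 1) y else if r = N - 1 then Qev (N - 1) y
     else if snd y = 0 then 1 else 0)"

definition QA :: "complex \<Rightarrow> (nat \<times> nat \<Rightarrow> complex) \<Rightarrow> nat \<Rightarrow> complex" where
  "QA t g r = (lam (eJ r) - t) * ev g (fst (eJ r)) (lam (eJ r))"

lemma Qev_sum: "r < N \<Longrightarrow> (\<Sum>y\<in>J. Qev r y * g y) = ev g (fst (eJ r)) (lam (eJ r))"
  unfolding Qev_def by (rule sum_block[OF fst_eJ])

lemma Qev_step: "Qev r (fst y, Suc (snd y)) - t * Qev r y = (lam (eJ r) - t) * Qev r y"
  by (simp add: Qev_def algebra_simps)

lemma Qf2_row:
  assumes p: "p = wit j Pf Qf2" and r: "r < N + d - 1 - j"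
  shows "(\<Sum>y\<in>J. poly (QR p r y) t * g y) = (if r < N - 1 then QA t g r - QA t g (N - 1)
    else if r = N - 1 then QA t g (N - 1) else - t * (\<Sum>i=1..d. ev g i 0))"
proof -
  have QA: "(\<Sum>y\<in>J. ((lam (eJ r) - t) * Qev r y) * g y) = QA t g r" if "r < N" for r
    unfolding QA_def Qev_sum[OF that, symmetric] sum_distrib_left by (simp add: mult.assoc)
  have N: "N > 0" using N_ge_d d2 by simp
  consider "r < N - 1" | "r = N - 1" | "r \<ge> N" by linarith
  then show ?thesis
  proof cases
    case 1
    have "(\<Sum>y\<in>J. poly (QR p r y) t * g y) =
      (\<Sum>y\<in>J. ((lam (eJ r) - t) * Qev r y) * g y - ((lam (eJ (N - 1)) - t) * Qev (N - 1) y) * g y)"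
    proof (intro sum.cong refl)
      fix y assume y: "y \<in> J"
      have "poly (QR p r y) t = (Qev r (fst y, Suc (snd y)) - t * Qev r y)
        - (Qev (N - 1) (fst y, Suc (snd y)) - t * Qev (N - 1) y)"
        using 1 y by (simp add: p poly_QR_wit[OF r] Qf2_def algebra_simps)
      then show "poly (QR p r y) t * g y = ((lam (eJ r) - t) * Qev r y) * g y - ((lam (eJ (N - 1)) - t) * Qev (N - 1) y) * g y"
        unfolding Qev_step by (simp add: left_diff_distrib)
    qed
    then show ?thesis using 1 N by (simp add: sum_subtractf QA)
  next
    case 2
    have "(\<Sum>y\<in>J. poly (QR p r y) t * g y) = (\<Sum>y\<in>J. ((lam (eJ (N - 1)) - t) * Qev (N - 1) y) * g y)"
    proof (intro sum.cong refl)
      fix y assume y: "y \<in> J"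
      have "poly (QR p r y) t = Qev (N - 1) (fst y, Suc (snd y)) - t * Qev (N - 1) y"
        unfolding p poly_QR_wit[OF r y] using 2 by (simp add: Qf2_def)
      then show "poly (QR p r y) t * g y = ((lam (eJ (N - 1)) - t) * Qev (N - 1) y) * g y"
        unfolding Qev_step by simp
    qed
    then show ?thesis using 2 N by (simp add: QA)
  next
    case 3
    then have nr: "\<not> r < N - 1" "r \<noteq> N - 1" using N by auto
    have "(\<Sum>y\<in>J. poly (QR p r y) t * g y) = (\<Sum>i=1..d. \<Sum>k<ns i. - t * (g (i, k) * 0 ^ k))"
      unfolding sum_J
    proof (intro sum.cong refl)
      fix i k assume "i \<in> {1..d}" "k \<in> {..<ns i}"
      then have ik: "(i, k) \<in> J" by simp
      show "poly (QR p r (i, k)) t * g (i, k) = - t * (g (i, k) * 0 ^ k)"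
        unfolding p poly_QR_wit[OF r ik] Qf2_def by (simp only: nr if_False fst_conv snd_conv) simp
    qed
    also have "\<dots> = - t * (\<Sum>i=1..d. ev g i 0)"
      unfolding ev_def sum_distrib_left ..
    finally show ?thesis by (simp only: nr if_False)
  qed
qed

lemma ev_block_zero:
  assumes r0: "r0 < N" and "\<And>r. r < N \<Longrightarrow> r \<noteq> r0 \<Longrightarrow> ev g (fst (eJ r)) (lam (eJ r)) = 0"
    and i: "i \<in> {1..d}" "i \<noteq> fst (eJ r0)"
  shows "ev g i t = 0"
proof -
  have "ev g i t = poly 0 t"
  proof (rule ev_eq_poly)
    show "coeff (evp g i) k = coeff 0 k" if "k \<ge> ns i" for k
      using that by (simp add: coeff_evp)
    show "ns i \<le> card ((\<lambda>k. lam (i, k)) ` {..<ns i})"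
      by (subst card_image) (auto simp: inj_on_def)
    fix z assume "z \<in> (\<lambda>k. lam (i, k)) ` {..<ns i}"
    then obtain k where k: "k < ns i" "z = lam (i, k)" by blast
    obtain r where r: "r < N" "eJ r = (i, k)" using eJ_onto[of "(i, k)"] k i by auto
    then have "r \<noteq> r0" using i by auto
    then show "ev g i z = poly 0 z" using assms(2)[of r] r k by simp
  qed
  then show ?thesis by simp
qed

text \<open>The block of the omitted node has one zero too few; the extra point \<open>z\<close>
  restores the count whether it is the omitted node itself or no node at all.\<close>

lemma ev_block_zero':
  assumes r0: "r0 < N" and ev: "\<And>r. r < N \<Longrightarrow> r \<noteq> r0 \<Longrightarrow> ev g (fst (eJ r)) (lam (eJ r)) = 0"
    and z: "ev g (fst (eJ r0)) z = 0" "z = lam (eJ r0) \<or> z \<notin> range lam"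
  shows "\<forall>y\<in>J. g y = 0"
proof -
  obtain i0 k0 where ik: "eJ r0 = (i0, k0)" by (cases "eJ r0")
  have "(i0, k0) \<in> J" using eJ_in[OF r0] ik by simp
  then have i0: "i0 \<in> {1..d}" "k0 < ns i0" by auto
  have "ev g i0 t = poly 0 t" for t
  proof (rule ev_eq_poly)
    show "coeff (evp g i0) k = coeff 0 k" if "k \<ge> ns i0" for k
      using that by (simp add: coeff_evp)
    let ?Z = "(\<lambda>k. lam (i0, k)) ` ({..<ns i0} - {k0})"
    have "card ?Z = ns i0 - 1" using i0 by (subst card_image) (auto simp: inj_on_def)
    moreover have "z \<notin> ?Z" using z(2) ik by auto
    ultimately show "ns i0 \<le> card (insert z ?Z)" by simp
    fix w assume "w \<in> insert z ?Z"
    then consider "w = z" | k where "k < ns i0" "k \<noteq> k0" "w = lam (i0, k)" by blast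
    then show "ev g i0 w = poly 0 w"
    proof cases
      case 1
      then show ?thesis using z(1) ik by simp
    next
      case 2
      obtain r where r: "r < N" "eJ r = (i0, k)" using eJ_onto[of "(i0, k)"] 2 i0 by auto
      then have "r \<noteq> r0" using ik 2 by auto
      then show ?thesis using ev[of r] r 2 by simp
    qed
  qed
  then have "ev g i t = 0" if "i \<in> {1..d}" for i t
    using ev_block_zero[OF r0 ev that] ik by (cases "i = i0") auto
  then show ?thesis using ev_zero_J by blast
qed

context
  fixes j p Pf
  assumes p: "p = wit j Pf Qf2" and j: "j < d"
begin

text \<open>The difference rows make all \<open>QA t g r\<close> equal, and the one at
  \<open>r0\<close> is 0 because its factor vanishes. Thus all are 0, even when the critical node is
  the last.\<close>

lemma QA_kernel:
  assumes r0: "r0 < N" "t = lam (eJ r0)" and ker: "\<And>r. r < N - 1 \<Longrightarrow> (\<Sum>y\<in>J. poly (QR p r y) t * g y) = 0"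
    and r: "r < N" "r \<noteq> r0"
  shows "ev g (fst (eJ r)) (lam (eJ r)) = 0"
proof -
  have N: "N > 0" using N_ge_d d2 by simp
  have eq: "QA t g r = QA t g (N - 1)" if "r < N - 1" for r
    using Qf2_row[OF p, of r t g] ker[OF that] that j by simp
  have "QA t g r0 = 0" using r0 by (simp add: QA_def)
  then have "QA t g (N - 1) = 0" using eq[of r0] r0(1) by (cases "r0 = N - 1") auto
  then have "QA t g r = 0" using eq[of r] r(1) by (cases "r = N - 1") auto
  moreover have "lam (eJ r) \<noteq> t" using r r0 eJ_inj by auto
  ultimately show ?thesis by (simp add: QA_def)
qed

lemma QD_wit_root: "poly (QD p) t = 0 \<longleftrightarrow> t \<in> lam ` J"
proof
  have N: "N > 0" using N_ge_d d2 by simp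
  have row: "(\<Sum>y\<in>J. poly (QR p r y) t * g y) = (if r < N - 1 then QA t g r - QA t g (N - 1) else QA t g (N - 1))"
    if "r < N" for r g
    using Qf2_row[OF p, of r t g] that j by auto
  show "t \<in> lam ` J" if "poly (QD p) t = 0"
  proof (rule ccontr)
    assume t: "t \<notin> lam ` J"
    have "poly (QD p) t \<noteq> 0" unfolding poly_QD
    proof (rule rdet_nonzeroI[OF eJ(1)])
      fix g assume g: "\<And>r. r < N \<Longrightarrow> (\<Sum>y\<in>J. poly (QR p r y) t * g y) = 0"
      have last: "QA t g (N - 1) = 0" using g[of "N - 1"] row[of "N - 1" g] N by simp
      have "ev g (fst (eJ r)) (lam (eJ r)) = 0" if r: "r < N" for r
      proof -
        have "QA t g r = 0"
        proof (cases "r < N - 1")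
          case False
          then have "r = N - 1" using r by simp
          then show ?thesis using last by simp
        qed (use g[OF r] row[OF r, of g] last in simp)
        moreover have "lam (eJ r) \<noteq> t" using t eJ_in[OF r] by blast
        ultimately show ?thesis by (simp add: QA_def)
      qed
      then show "\<forall>y\<in>J. g y = 0" using N
        by (intro ev_block_zero'[of 0 g "lam (eJ 0)"]) auto
    qed
    then show False using that by simp
  qed
  assume "t \<in> lam ` J"
  then obtain r0 where r0: "r0 < N" "t = lam (eJ r0)" using eJ_onto by (metis imageE)
  obtain i0 k0 where ik: "eJ r0 = (i0, k0)" by (cases "eJ r0")
  have "(i0, k0) \<in> J" using eJ_in[OF r0(1)] ik by simp
  then have i0: "i0 \<in> {1..d}" "k0 < ns i0" by auto
  \<comment> \<open>The Lagrange polynomial, up to scaling, of the node \<open>lam (i0, k0)\<close>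
    within its block: the only evaluation that is nonzero on it belongs to the row factor that
    vanishes at \<open>t\<close>.\<close>
  define f where "f = (\<Prod>k\<in>{..<ns i0} - {k0}. [:- lam (i0, k), 1:])"
  have deg: "degree f = ns i0 - 1"
    unfolding f_def using i0 by (subst degree_prod_eq_sum_degree) auto
  have "lead_coeff f = 1" unfolding f_def by (subst lead_coeff_prod) auto
  define g where "g = (\<lambda>(i, k). if i = i0 then coeff f k else 0)"
  have evp: "evp g i = (if i = i0 then f else 0)" for i
    using i0 by (intro poly_eqI) (auto simp: coeff_evp g_def coeff_eq_0 deg)
  have "QA t g r = 0" if r: "r < N" for r
  proof (cases "r = r0")
    case False
    obtain i k where r': "eJ r = (i, k)" by (cases "eJ r")
    have "(i, k) \<in> J" using eJ_in[OF r] r' by simp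
    moreover have "i = i0 \<Longrightarrow> k \<noteq> k0" using False eJ_inj[OF r r0(1)] r' ik by auto
    ultimately have "i = i0 \<Longrightarrow> poly f (lam (i, k)) = 0" by (auto simp: f_def poly_prod)
    then have "ev g i (lam (i, k)) = 0" by (auto simp: poly_evp[symmetric] evp)
    then show ?thesis by (simp add: QA_def r')
  qed (simp add: QA_def r0)
  then have "\<forall>r<N. (\<Sum>y\<in>J. poly (QR p r y) t * g y) = 0" using row N by simp
  moreover have "(i0, ns i0 - 1) \<in> J" "g (i0, ns i0 - 1) \<noteq> 0"
    using i0 \<open>lead_coeff f = 1\<close> by (simp_all add: g_def deg)
  ultimately show "poly (QD p) t = 0" unfolding poly_QD rdet_zero_iff[OF eJ(1)] by blast
qed

lemma QD_wit: "QD p \<noteq> 0" "card {t. poly (QD p) t = 0} = N"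
proof -
  have roots: "{t. poly (QD p) t = 0} = lam ` J" using QD_wit_root by blast
  then show "card {t. poly (QD p) t = 0} = N"
    using card_image[OF inj_on_subset[OF inj_lam subset_UNIV, of J]] by (simp add: card_J)
  show "QD p \<noteq> 0"
  proof
    assume "QD p = 0"
    then have "lam ` J = UNIV" using roots by simp
    then show False using infinite_UNIV_char_0[where 'a = complex] finite_imageI[OF finite_J, of lam] by simp
  qed
qed

text \<open>Row \<open>N\<close> reads the sum of the values at 0 with the factor
  \<open>- t\<close>. Since the nodes are nonzero, \<open>t\<close> can be cancelled and 0 is a new
  interpolation point for the one surviving block.\<close>

lemma A_wit2:
  assumes j': "Suc j < d" and t: "poly (QD p) t = 0"
  shows "rdet eJ N ((\<lambda>r y. poly (QR p r y) t)(N - 1 := (\<lambda>y. poly (QR p N y) t))) \<noteq> 0" (is "rdet _ _ ?R \<noteq> 0")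
proof (rule rdet_nonzeroI[OF eJ(1)])
  have N: "N > 0" using N_ge_d d2 by simp
  obtain r0 where r0: "r0 < N" "t = lam (eJ r0)" using t eJ_onto unfolding QD_wit_root by (metis imageE)
  fix g assume g: "\<And>r. r < N \<Longrightarrow> (\<Sum>y\<in>J. ?R r y * g y) = 0"
  have ker: "(\<Sum>y\<in>J. poly (QR p r y) t * g y) = 0" if "r < N - 1" for r
    using g[of r] that by simp
  note ev = QA_kernel[OF r0 ker]
  have "(\<Sum>y\<in>J. poly (QR p N y) t * g y) = 0" using g[of "N - 1"] N by simp
  then have "- t * (\<Sum>i=1..d. ev g i 0) = 0"
  proof -
    have "N < N + d - 1 - j" "\<not> N < N - 1" "N \<noteq> N - 1" using N j' by auto
    then show ?thesis using Qf2_row[OF p, of N t g] \<open>(\<Sum>y\<in>J. poly (QR p N y) t * g y) = 0\<close>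
      by (simp only: if_False)
  qed
  then have "(\<Sum>i=1..d. ev g i 0) = 0" using r0 lam_nonzero by simp
  moreover have "(\<Sum>i=1..d. ev g i 0) = (\<Sum>i=1..d. if i = fst (eJ r0) then ev g i 0 else 0)"
    using ev_block_zero[OF r0(1) ev] by (intro sum.cong) auto
  ultimately have "ev g (fst (eJ r0)) 0 = 0" using fst_eJ[OF r0(1)] by simp
  moreover have "0 \<notin> range lam" using lam_nonzero by (metis imageE)
  ultimately show "\<forall>y\<in>J. g y = 0" using ev by (intro ev_block_zero'[OF r0(1)]) auto
qed

text \<open>At a root the cofactor vector lives in the block of the critical node and is nonzero at
  that node, so the incidence equation reduces to a single coordinate of \<open>a\<close>.\<close>

lemma qg_wit:
  assumes t: "poly (QD p) t = 0"
  obtains i0 where "i0 \<in> {1..d}" "ev (\<lambda>y. poly (qg p y) t) i0 t \<noteq> 0"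
    "\<And>i. i \<in> {1..d} \<Longrightarrow> i \<noteq> i0 \<Longrightarrow> ev (\<lambda>y. poly (qg p y) t) i t = 0"
proof -
  have N: "N > 0" using N_ge_d d2 by simp
  obtain r0 where r0: "r0 < N" "t = lam (eJ r0)" using t eJ_onto unfolding QD_wit_root by (metis imageE)
  let ?R = "\<lambda>r y. poly (QR p r y) t"
  define g where "g = (\<lambda>y. poly (qg p y) t)"
  have g: "g = cof eJ N ?R (N - 1)" unfolding g_def by (rule poly_qg)
  have ker: "(\<Sum>y\<in>J. ?R r y * g y) = 0" if "r < N - 1" for r
    using cof_kernel[OF eJ(1), of "N - 1" r ?R] that by (simp add: g)
  note ev = QA_kernel[OF r0 ker]
  \<comment> \<open>Expanded along its last row, this determinant is the value of the cofactor
    vector at the critical node.\<close>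
  have "rdet eJ N (?R(N - 1 := Qev r0)) \<noteq> 0"
  proof (rule rdet_nonzeroI[OF eJ(1)])
    fix h assume h: "\<And>r. r < N \<Longrightarrow> (\<Sum>y\<in>J. (?R(N - 1 := Qev r0)) r y * h y) = 0"
    have "(\<Sum>y\<in>J. ?R r y * h y) = 0" if "r < N - 1" for r using h[of r] that by simp
    note ev' = QA_kernel[OF r0 this]
    have "ev h (fst (eJ r0)) (lam (eJ r0)) = 0"
      using h[of "N - 1"] N Qev_sum[OF r0(1), of h] by simp
    then show "\<forall>y\<in>J. h y = 0" by (intro ev_block_zero'[OF r0(1) ev']) auto
  qed
  then have "(\<Sum>y\<in>J. Qev r0 y * g y) \<noteq> 0"
    using rdet_expand_row[OF eJ(1), of "N - 1" ?R "Qev r0"] N by (simp add: g)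
  then have "ev g (fst (eJ r0)) t \<noteq> 0" using Qev_sum[OF r0(1), of g] r0 by simp
  then show ?thesis
    using that[of "fst (eJ r0)"] fst_eJ[OF r0(1)] ev_block_zero[OF r0(1) ev] unfolding g_def by blast
qed

end

text \<open>Differences of consecutive entries; together with \<open>cD\<close>, the first
  \<open>d - 2\<close> of them leave only constant vectors \<open>a\<close>.\<close>

definition Pf2 :: "nat \<Rightarrow> nat \<times> nat \<Rightarrow> complex" where
  "Pf2 r = (\<lambda>(i, k). if k = 0 then (if i = Suc r then 1 else if i = Suc (Suc r) then -1 else 0) else 0)"

definition cD :: "nat \<Rightarrow> complex" where
  "cD i = (if i = d - 1 then 1 else if i = d then -1 else 0)"

text \<open>The difference rows and \<open>cD\<close> make \<open>a\<close> constant, and the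
  incidence row has exactly one nonzero coefficient by \<open>qg_wit\<close>, so that constant is
  0.\<close>

lemma D_wit:
  assumes p: "p = wit (d - 1) Pf2 Qf2" and t: "poly (QD p) t = 0"
  shows "rdet Suc d ((\<lambda>r i. poly (PR p r i) t)(d - 2 := (\<lambda>i. poly (\<sigma>P p i) t), d - 1 := cD)) \<noteq> 0"
    (is "rdet _ _ ?R \<noteq> 0")
proof (rule rdet_nonzeroI[OF bij_Suc])
  have j: "d - 1 < d" using d2 by simp
  obtain i0 where i0: "i0 \<in> {1..d}" "ev (\<lambda>y. poly (qg p y) t) i0 t \<noteq> 0"
    "\<And>i. i \<in> {1..d} \<Longrightarrow> i \<noteq> i0 \<Longrightarrow> ev (\<lambda>y. poly (qg p y) t) i t = 0"
    using qg_wit[OF p j t] by blast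
  fix a assume a: "\<And>r. r < d \<Longrightarrow> (\<Sum>i=1..d. ?R r i * a i) = 0"
  have diff: "(\<Sum>i=1..d. (if i = Suc r then 1 else if i = Suc (Suc r) then -1 else 0) * a i) = a (Suc r) - a (Suc (Suc r))"
    if "r < d - 1" for r
  proof -
    have "(\<Sum>i=1..d. (if i = Suc r then 1 else if i = Suc (Suc r) then -1 else 0) * a i)
      = (\<Sum>i=1..d. (if i = Suc r then a i else 0) - (if i = Suc (Suc r) then a i else 0))"
      by (intro sum.cong) auto
    moreover have "Suc r \<in> {1..d}" "Suc (Suc r) \<in> {1..d}" using that by auto
    ultimately show ?thesis by (simp only: sum_subtractf sum.delta finite_atLeastAtMost if_True)
  qed
  have step: "a (Suc r) = a (Suc (Suc r))" if r: "r < d - 1" for r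
  proof (cases "r = d - 2")
    case True
    have "(\<Sum>i=1..d. cD i * a i) = 0" using a[of "d - 1"] d2 by simp
    moreover have "cD = (\<lambda>i. if i = Suc r then 1 else if i = Suc (Suc r) then -1 else 0)"
      using True d2 by (auto simp: cD_def fun_eq_iff)
    ultimately show ?thesis using diff[OF r] by simp
  next
    case False
    then have r': "r < d - 2" using r by simp
    have "poly (PR p r i) t = (if i = Suc r then 1 else if i = Suc (Suc r) then -1 else 0)" if "i \<in> {1..d}" for i
    proof -
      have "poly (PR p r i) t = (\<Sum>k\<le>ns i. Pf2 r (i, k) * t ^ k)"
        unfolding p using r' that by (intro poly_PR_wit) auto
      also have "\<dots> = (\<Sum>k\<le>ns i. if k = 0 then (if i = Suc r then 1 else if i = Suc (Suc r) then -1 else 0) else 0)"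
        by (intro sum.cong) (auto simp: Pf2_def)
      finally show ?thesis by simp
    qed
    then have "(\<Sum>i=1..d. poly (PR p r i) t * a i) = a (Suc r) - a (Suc (Suc r))"
      unfolding diff[OF r, symmetric] by (intro sum.cong) auto
    moreover have "(\<Sum>i=1..d. poly (PR p r i) t * a i) = 0" proof -
      have "r < d" "r \<noteq> d - 1" "r \<noteq> d - 2" using r' by auto
      then show ?thesis using a[of r] by simp
    qed
    ultimately show ?thesis by simp
  qed
  have const: "a i = a 1" if "1 \<le> i" "i \<le> d" for i
    using that
  proof (induction i rule: dec_induct)
    case (step n)
    then show ?case using \<open>\<And>r. r < d - 1 \<Longrightarrow> a (Suc r) = a (Suc (Suc r))\<close>[of "n - 1"] by simp
  qed simp
  have "(\<Sum>i=1..d. poly (\<sigma>P p i) t * a i) = 0" using a[of "d - 2"] d2 by (auto split: if_splits)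
  moreover have "(\<Sum>i=1..d. poly (\<sigma>P p i) t * a i)
    = (\<Sum>i=1..d. if i = i0 then ev (\<lambda>y. poly (qg p y) t) i0 t * a i0 else 0)"
    using i0(3) fun_cong[OF poly_\<sigma>P[of p t]] by (intro sum.cong) auto
  ultimately have "a i0 = 0" using i0(1,2) by simp
  then have "a 1 = 0" using const[of i0] i0(1) by simp
  then show "\<forall>i\<in>{1..d}. a i = 0" using const by (metis atLeastAtMost_iff)
qed

end

lemma polyfun_fun_upd:
  assumes "(\<lambda>p. R p r y) \<in> polyfun" "(\<lambda>p. w p y) \<in> polyfun"
  shows "(\<lambda>p. ((R p)(r0 := w p)) r y) \<in> polyfun"
  using assms by (cases "r = r0") auto

context scroll begin

subsection \<open>No solutions over the point at infinity\<close>

definition PfI :: "nat \<Rightarrow> nat \<times> nat \<Rightarrow> complex" where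
  "PfI r y = (if fst y = Suc r then 1 else 0)"

definition QfI :: "nat \<Rightarrow> nat \<times> nat \<Rightarrow> complex" where
  "QfI r y = (if y = eJ r then 1 else 0)"

lemma PfI_row: "r < j - 1 \<Longrightarrow> r < d \<Longrightarrow> (\<Sum>i=1..d. PI (wit j PfI QfI) r i * a i) = a (Suc r)"
proof -
  assume r: "r < j - 1" "r < d"
  have "(\<Sum>i=1..d. PI (wit j PfI QfI) r i * a i) = (\<Sum>i=1..d. if i = Suc r then a i else 0)"
    using r(1) by (intro sum.cong) (auto simp: PI_wit PfI_def)
  then show ?thesis using r(2) by simp
qed

lemma QfI_row: "r < N + d - 1 - j \<Longrightarrow> r < N \<Longrightarrow> (\<Sum>y\<in>J. QI (wit j PfI QfI) r y * g y) = g (eJ r)"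
proof -
  assume r: "r < N + d - 1 - j" "r < N"
  have "(\<Sum>y\<in>J. QI (wit j PfI QfI) r y * g y) = (\<Sum>y\<in>J. if y = eJ r then g y else 0)"
    using r(1) by (intro sum.cong) (auto simp: QI_wit QfI_def)
  then show ?thesis using eJ_in[OF r(2)] by simp
qed

lemma polyfun_PI: "(\<lambda>p. PI p r i) \<in> polyfun" and polyfun_QI: "(\<lambda>p. QI p r y) \<in> polyfun"
  unfolding PI_def QI_def by (rule polyfun.coord)+

lemma zero_on_Suc: "(\<And>r. r < d \<Longrightarrow> a (Suc r) = 0) \<Longrightarrow> \<forall>i\<in>{1..d}. a i = (0 :: complex)"
proof
  fix i assume *: "\<And>r. r < d \<Longrightarrow> a (Suc r) = 0" and "i \<in> {1..d}"
  then have "i - 1 < d" "Suc (i - 1) = i" by auto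
  then show "a i = 0" using *[of "i - 1"] by simp
qed

text \<open>Over the single point [0:1] there are N + d - 1 equations on a product of projective
  spaces of dimension N + d - 2. For j > d, \<open>d\<close> of them already act on \<open>a\<close>
  alone.\<close>

lemma generically_no_solI_P:
  assumes j: "d < j"
  shows "generically (param_space I j) (\<lambda>p. \<forall>a g. \<not> solI j p a g)"
proof -
  have "rdet Suc d (PI (wit j PfI QfI)) \<noteq> 0"
  proof (rule rdet_nonzeroI[OF bij_Suc])
    fix a assume "\<And>r. r < d \<Longrightarrow> (\<Sum>i=1..d. PI (wit j PfI QfI) r i * a i) = 0"
    then show "\<forall>i\<in>{1..d}. a i = 0" using PfI_row[of _ j a] j by (intro zero_on_Suc) auto
  qed
  then have "generically (param_space I j) (\<lambda>p. rdet Suc d (PI p) \<noteq> 0)"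
    by (intro generically_nonzero[OF _ wit_in] polyfun_rdet_const polyfun_PI)
  then show ?thesis
  proof (rule generically_mono)
    fix p :: "bool \<times> nat \<times> nat \<times> nat \<Rightarrow> complex"
    assume "rdet Suc d (PI p) \<noteq> 0"
    then show "\<forall>a g. \<not> solI j p a g"
      unfolding rdet_zero_iff[OF bij_Suc] solI_def using j by (metis less_diff_conv less_trans_Suc Suc_eq_plus1 less_SucI Suc_lessI)
  qed
qed

lemma generically_no_solI_Q:
  assumes j: "j < d"
  shows "generically (param_space I j) (\<lambda>p. \<forall>a g. \<not> solI j p a g)"
proof -
  have rows: "r < N + d - 1 - j" if "r < N" for r using that j by simp
  have "rdet eJ N (QI (wit j PfI QfI)) \<noteq> 0"
  proof (rule rdet_nonzeroI[OF eJ(1)])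
    fix g assume "\<And>r. r < N \<Longrightarrow> (\<Sum>y\<in>J. QI (wit j PfI QfI) r y * g y) = 0"
    then show "\<forall>y\<in>J. g y = 0" using QfI_row[of _ j g] rows eJ_onto by metis
  qed
  then have "generically (param_space I j) (\<lambda>p. rdet eJ N (QI p) \<noteq> 0)"
    by (intro generically_nonzero[OF _ wit_in] polyfun_rdet_const polyfun_QI)
  then show ?thesis
  proof (rule generically_mono)
    fix p :: "bool \<times> nat \<times> nat \<times> nat \<Rightarrow> complex"
    assume "rdet eJ N (QI p) \<noteq> 0"
    then show "\<forall>a g. \<not> solI j p a g"
      unfolding rdet_zero_iff[OF eJ(1)] solI_def using rows by blast
  qed
qed

text \<open>Here \<open>a\<close> is eliminated through cofactors. At the witness they are supported
  at \<open>d\<close>, so the incidence row reads the one entry of \<open>g\<close> that the first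
  \<open>N - 1\<close> unit rows leave free.\<close>

lemma generically_no_solI_PQ:
  "generically (param_space I d) (\<lambda>p. \<forall>a g. \<not> solI d p a g)"
proof -
  let ?E = "\<lambda>p. rdet eJ N ((QI p)(N - 1 := \<rho>I (cof Suc d (PI p) (d - 1))))"
  have N: "N > 0" using N_ge_d d2 by simp
  define p0 where "p0 = wit d PfI QfI"
  have "?E p0 \<noteq> 0"
  proof (rule rdet_nonzeroI[OF eJ(1)])
    let ?a = "cof Suc d (PI p0) (d - 1)"
    have a0: "?a i = 0" if "i \<in> {1..<d}" for i
    proof -
      have "i - 1 < d - 1" "i - 1 < d" "Suc (i - 1) = i" using that by auto
      then show ?thesis
        using cof_kernel[OF bij_Suc, of "d - 1" "i - 1" "PI p0"] PfI_row[of "i - 1" d ?a] d2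
        by (simp add: p0_def)
    qed
    have ad: "?a d \<noteq> 0" unfolding cof_def
    proof (rule rdet_nonzeroI[OF bij_Suc])
      fix a assume a: "\<And>r. r < d \<Longrightarrow> (\<Sum>i=1..d. ((PI p0)(d - 1 := (\<lambda>z. if z = d then 1 else 0))) r i * a i) = 0"
      have "(\<Sum>i=1..d. (if i = d then 1 else 0) * a i) = a d"
        using d2 by (simp add: if_distrib[of "\<lambda>a. a * _"] cong: if_cong)
      then have "a d = 0" using a[of "d - 1"] d2 by simp
      moreover have "a (Suc r) = 0" if "r < d - 1" for r
        using a[of r] PfI_row[of r d a] that by (simp add: p0_def)
      ultimately show "\<forall>i\<in>{1..d}. a i = 0"
        by (intro zero_on_Suc) (metis Suc_lessI Suc_diff_1 diff_Suc_1 less_diff_conv Suc_eq_plus1)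
    qed
    fix g assume g: "\<And>r. r < N \<Longrightarrow> (\<Sum>y\<in>J. ((QI p0)(N - 1 := \<rho>I ?a)) r y * g y) = 0"
    have g1: "g (eJ r) = 0" if "r < N - 1" for r
      using g[of r] QfI_row[of r d g] that by (simp add: p0_def)
    have "(\<Sum>i=1..d. ?a i * g (i, ns i - 1)) = 0"
      using g[of "N - 1"] N by (simp add: sum_\<rho>I)
    moreover have "{1..d} = insert d {1..<d}" using d2 by auto
    ultimately have "?a d * g (d, ns d - 1) = 0" using a0 by simp
    then have "g (eJ (N - 1)) = 0" using ad eJ(2) by simp
    then have "g (eJ r) = 0" if "r < N" for r using g1[of r] that by (cases "r = N - 1") auto
    then show "\<forall>y\<in>J. g y = 0" using eJ_onto by metis
  qed
  moreover have "?E \<in> polyfun"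
  proof (intro polyfun_rdet_const polyfun_fun_upd polyfun_QI)
    fix y :: "nat \<times> nat"
    show "(\<lambda>p. \<rho>I (cof Suc d (PI p) (d - 1)) y) \<in> polyfun"
      unfolding \<rho>I_def cof_def
      by (intro polyfun_if polyfun_rdet_const polyfun_fun_upd polyfun_PI polyfun.const)
  qed
  ultimately have "generically (param_space I d) (\<lambda>p. ?E p \<noteq> 0)"
    using wit_in[of d PfI QfI] unfolding p0_def by (intro generically_nonzero)
  then show ?thesis
  proof (rule generically_mono)
    fix p :: "bool \<times> nat \<times> nat \<times> nat \<Rightarrow> complex"
    assume E: "?E p \<noteq> 0"
    let ?a = "cof Suc d (PI p) (d - 1)"
    show "\<forall>a g. \<not> solI d p a g"
    proof (intro allI notI)
      fix a g assume s: "solI d p a g"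
      have nz: "\<exists>i\<in>{1..d}. ?a i \<noteq> 0"
      proof (rule ccontr)
        assume "\<not> ?thesis"
        then have "\<rho>I ?a y = 0" if "y \<in> J" for y using that by (cases y) (auto simp: \<rho>I_def)
        then show False using E N by (auto intro!: rdet_zero_row[OF eJ(1), of "N - 1"])
      qed
      have "\<exists>c. \<forall>i\<in>{1..d}. a i = c * ?a i"
        using s d2 by (intro kernel_cof[OF bij_Suc _ nz]) (auto simp: solI_def)
      then obtain c where c: "\<And>i. i \<in> {1..d} \<Longrightarrow> a i = c * ?a i" by blast
      then have "c \<noteq> 0" using s by (auto simp: solI_def)
      have "0 = (\<Sum>i=1..d. a i * g (i, ns i - 1))" using s by (simp add: solI_def sum_\<rho>I)
      also have "\<dots> = c * (\<Sum>i=1..d. ?a i * g (i, ns i - 1))"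
        unfolding sum_distrib_left using c by (intro sum.cong refl) simp
      finally have "(\<Sum>y\<in>J. \<rho>I ?a y * g y) = 0" using \<open>c \<noteq> 0\<close> by (simp add: sum_\<rho>I)
      then have "\<forall>r<N. (\<Sum>y\<in>J. ((QI p)(N - 1 := \<rho>I ?a)) r y * g y) = 0"
        using s by (auto simp: solI_def)
      then show False using E s unfolding rdet_zero_iff[OF eJ(1)] solI_def by blast
    qed
  qed
qed

subsection \<open>The five ranges of \<open>j\<close>\<close>

text \<open>At least \<open>d + 1\<close> rows act on \<open>a\<close>. A solution annihilates both
  the determinant of the first \<open>d\<close> rows and the one with row \<open>d\<close> in place
  of row \<open>d - 1\<close>; generically these share no root.\<close>

lemma polar_degree_high:
  assumes j: "Suc d < j"
  shows "has_polar_degree I C j 0"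
proof (rule has_polar_degreeI[OF generically_no_solI_P])
  show "d < j" using j by simp
  let ?G = "\<lambda>p. rdet Suc d ((PR p)(d - 1 := PR p d))"
  define p0 where "p0 = wit j Pf1 (\<lambda>_ _. 0)"
  have "poly (?G p0) t \<noteq> 0" for t
  proof -
    \<comment> \<open>Row \<open>d\<close> of \<open>Pf1\<close> reads the first coordinate, so it
      completes the first \<open>d - 1\<close> rows at every \<open>t\<close>.\<close>
    have "poly (PR p0 d i) t = (if i = 1 then 1 else 0)" if "i \<in> {1..d}" for i
      using j that unfolding p0_def by (subst poly_PR_wit) (auto simp: Pf1_sum)
    then have "poly (?G p0) t = rdet Suc d ((\<lambda>r i. poly (PR p0 r i) t)(d - 1 := (\<lambda>i. if i = 1 then 1 else 0)))"
      unfolding poly_rdet poly_fun_upd by (intro rdet_cong[OF bij_Suc]) simp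
    then show ?thesis using Pf1_unit_row[OF p0_def] j by simp
  qed
  then have "generically (param_space I j) (\<lambda>p. PD p \<noteq> 0 \<and> degree (PD p) = N \<and>
      (\<forall>t. poly (PD p) t = 0 \<longrightarrow> poly (?G p) t \<noteq> 0))"
    using PD_wit1[OF p0_def] j wit_in[of j Pf1 "\<lambda>_ _. 0"]
    by (intro generically_no_common_root[of _ _ _ _ p0] polyfam_PD degree_PD
          polyfam_rdet polyfam_fun_upd polyfam_PR) (auto simp: p0_def)
  then show "generically (param_space I j) (\<lambda>p. count_sols j p 0)"
  proof (rule generically_mono)
    fix p assume p: "PD p \<noteq> 0 \<and> degree (PD p) = N \<and> (\<forall>t. poly (PD p) t = 0 \<longrightarrow> poly (?G p) t \<noteq> 0)"
    have "\<not> sol j p t a g" for t a g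
    proof
      assume s: "sol j p t a g"
      then have rows: "(\<Sum>i=1..d. poly (PR p r i) t * a i) = 0" if "r < Suc d" for r
        using that j by (simp add: sol_def)
      have nz: "\<exists>i\<in>{1..d}. a i \<noteq> 0" using s by (simp add: sol_def)
      have "poly (PD p) t = 0" unfolding poly_PD rdet_zero_iff[OF bij_Suc]
        using nz rows by (intro exI[of _ a]) auto
      moreover have "poly (?G p) t = 0" unfolding poly_rdet poly_fun_upd rdet_zero_iff[OF bij_Suc]
        using nz rows by (intro exI[of _ a]) auto
      ultimately show False using p by blast
    qed
    then show "count_sols j p 0"
      unfolding count_sols_def by (intro exI[of _ "{}"]) simp
  qed
qed

text \<open>The mirror image on \<open>g\<close>, where at least \<open>N + 1\<close> rows act on
  \<open>N\<close> unknowns.\<close>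

lemma polar_degree_low:
  assumes j: "Suc j < d"
  shows "has_polar_degree I C j 0"
proof (rule has_polar_degreeI[OF generically_no_solI_Q])
  show "j < d" using j by simp
  let ?G = "\<lambda>p. rdet eJ N ((QR p)(N - 1 := QR p N))"
  define p0 where "p0 = wit j (\<lambda>_ _. 0) Qf2"
  have "poly (?G p0) t \<noteq> 0" if "poly (QD p0) t = 0" for t
    using A_wit2[OF p0_def _ j that] j unfolding poly_rdet poly_fun_upd by simp
  then have "generically (param_space I j) (\<lambda>p. QD p \<noteq> 0 \<and> degree (QD p) = N \<and>
      (\<forall>t. poly (QD p) t = 0 \<longrightarrow> poly (?G p) t \<noteq> 0))"
    using QD_wit[OF p0_def] j wit_in[of j "\<lambda>_ _. 0" Qf2]
    by (intro generically_no_common_root[of _ _ _ _ p0] polyfam_QD degree_QD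
          polyfam_rdet polyfam_fun_upd polyfam_QR) (auto simp: p0_def)
  then show "generically (param_space I j) (\<lambda>p. count_sols j p 0)"
  proof (rule generically_mono)
    fix p assume p: "QD p \<noteq> 0 \<and> degree (QD p) = N \<and> (\<forall>t. poly (QD p) t = 0 \<longrightarrow> poly (?G p) t \<noteq> 0)"
    have "\<not> sol j p t a g" for t a g
    proof
      assume s: "sol j p t a g"
      then have rows: "(\<Sum>y\<in>J. poly (QR p r y) t * g y) = 0" if "r < Suc N" for r
        using that j by (simp add: sol_def)
      have nz: "\<exists>y\<in>J. g y \<noteq> 0" using s by (simp add: sol_def)
      have "poly (QD p) t = 0" unfolding poly_QD rdet_zero_iff[OF eJ(1)]
        using nz rows by (intro exI[of _ g]) auto
      moreover have "poly (?G p) t = 0" unfolding poly_rdet poly_fun_upd rdet_zero_iff[OF eJ(1)]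
        using nz rows by (intro exI[of _ g]) auto
      ultimately show False using p by blast
    qed
    then show "count_sols j p 0"
      unfolding count_sols_def by (intro exI[of _ "{}"]) simp
  qed
qed

text \<open>Simplicity of the roots of \<open>PD\<close> gives the count \<open>N\<close>; the
  auxiliary determinant, nonzero at these roots, gives one pair over each through
  \<open>bilinear_system\<close>.\<close>

lemma polar_degree_Suc_d: "has_polar_degree I C (Suc d) N"
proof (rule has_polar_degreeI[OF generically_no_solI_P])
  show "d < Suc d" by simp
  have N: "N \<ge> 2" using N_ge_d d2 by simp
  obtain \<epsilon> where \<epsilon>: "card {t. poly (HP + [:\<epsilon>:]) t = 0} = N - 1"
    "\<And>y. y \<in> J \<Longrightarrow> poly (HP + [:\<epsilon>:]) (lam y) \<noteq> 0" "\<And>y. y \<in> J \<Longrightarrow> poly (HP + [:\<epsilon>:]) (mu y) \<noteq> 0"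
    by (rule ex_eps) (rule that)
  let ?G = "\<lambda>p. rdet eJ N ((QR p)(N - 2 := \<rho>P p, N - 1 := (\<lambda>y. [:Qf1 \<epsilon> (N - 2) y:])))"
  have poly_G: "poly (?G p) t = rdet eJ N ((\<lambda>r y. poly (QR p r y) t)
      (N - 2 := \<rho> t (\<lambda>i. poly (pa p i) t), N - 1 := Qf1 \<epsilon> (N - 2)))" for p t
    unfolding poly_rdet poly_fun_upd poly_\<rho>P by simp
  define p0 where "p0 = wit (Suc d) Pf1 (Qf1 \<epsilon>)"
  have p0: "p0 \<in> param_space I (Suc d)" unfolding p0_def by (rule wit_in)
  have "poly (?G p0) t \<noteq> 0" if "poly (PD p0) t = 0" for t
  proof -
    have "t \<in> mu ` J" using that PD_wit1_root[OF p0_def] by simp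
    then show ?thesis unfolding poly_G using \<epsilon>(3) by (intro B_wit[OF p0_def]) auto
  qed
  then have "generically (param_space I (Suc d)) (\<lambda>p. PD p \<noteq> 0 \<and> degree (PD p) = N \<and>
      (\<forall>t. poly (PD p) t = 0 \<longrightarrow> poly (?G p) t \<noteq> 0))"
    using PD_wit1[OF p0_def] p0
    by (intro generically_no_common_root[of _ _ _ _ p0] polyfam_PD degree_PD
          polyfam_rdet polyfam_fun_upd polyfam_QR polyfam_\<rho>P polyfam_const) auto
  moreover have "generically (param_space I (Suc d)) (\<lambda>p. PD p \<noteq> 0 \<and> degree (PD p) = N \<and>
      card {t. poly (PD p) t = 0} = N \<and> (\<forall>t. poly (PD p) t = 0 \<longrightarrow> poly (pderiv (PD p)) t \<noteq> 0))"
    using PD_wit1[OF p0_def] p0 by (intro generically_simple_roots[of _ _ _ p0] polyfam_PD degree_PD) auto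
  ultimately show "generically (param_space I (Suc d)) (\<lambda>p. count_sols (Suc d) p N)"
  proof (rule generically_mono[OF generically_conj[OF _ _ param_space_affine]])
    fix p assume p: "(PD p \<noteq> 0 \<and> degree (PD p) = N \<and> (\<forall>t. poly (PD p) t = 0 \<longrightarrow> poly (?G p) t \<noteq> 0)) \<and>
      (PD p \<noteq> 0 \<and> degree (PD p) = N \<and> card {t. poly (PD p) t = 0} = N \<and>
        (\<forall>t. poly (PD p) t = 0 \<longrightarrow> poly (pderiv (PD p)) t \<noteq> 0))"
    let ?Z = "{t. poly (PD p) t = 0}"
    have sol: "sol (Suc d) p t a g \<longleftrightarrow> (\<exists>i\<in>{1..d}. a i \<noteq> 0) \<and> (\<exists>y\<in>J. g y \<noteq> 0) \<and>
       (\<forall>r<d. (\<Sum>i=1..d. poly (PR p r i) t * a i) = 0) \<and>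
       (\<forall>r<N - 2. (\<Sum>y\<in>J. poly (QR p r y) t * g y) = 0) \<and> (\<Sum>y\<in>J. \<rho> t a y * g y) = 0" for t a g
    proof -
      have "N + d - 1 - Suc d = N - 2" "Suc d - 1 = d" by auto
      then show ?thesis unfolding sol_def by (simp only:)
    qed
    have "t \<in> ?Z" if "sol (Suc d) p t a g" for t a g
      using that unfolding sol mem_Collect_eq poly_PD rdet_zero_iff[OF bij_Suc] by blast
    moreover have "unique_sol (Suc d) p t" if t: "t \<in> ?Z" for t
      unfolding unique_sol_def sol
    proof (rule bilinear_system[OF bij_Suc eJ(1)])
      show "rdet Suc d (\<lambda>r i. poly (PR p r i) t) = 0" using t by (simp add: poly_PD)
      show "rdet eJ N ((\<lambda>r y. poly (QR p r y) t)(N - 2 := \<rho> t (cof Suc d (\<lambda>r i. poly (PR p r i) t) (d - 1)),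
          N - 1 := Qf1 \<epsilon> (N - 2))) \<noteq> 0"
        using p t unfolding poly_G poly_pa by blast
      fix a a' :: "nat \<Rightarrow> complex" and c y assume "\<And>x. x \<in> {1..d} \<Longrightarrow> a' x = c * a x" "y \<in> J"
      then show "\<rho> t a' y = c * \<rho> t a y" by (cases y) (simp add: \<rho>_def)
    qed (use N d2 in auto)
    moreover have "finite ?Z" using p by (intro poly_roots_finite) simp
    ultimately show "count_sols (Suc d) p N"
      using p unfolding count_sols_def by (intro exI[of _ ?Z]) simp
  qed
qed

lemma polar_degree_pred_d: "has_polar_degree I C (d - 1) N"
proof (rule has_polar_degreeI[OF generically_no_solI_Q])
  show j: "d - 1 < d" using d2 by simp
  have N: "N \<ge> 2" using N_ge_d d2 by simp
  let ?G = "\<lambda>p. rdet Suc d ((PR p)(d - 2 := \<sigma>P p, d - 1 := (\<lambda>i. [:cD i:])))"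
  have poly_G: "poly (?G p) t = rdet Suc d ((\<lambda>r i. poly (PR p r i) t)
      (d - 2 := (\<lambda>i. poly (\<sigma>P p i) t), d - 1 := cD))" for p t
    unfolding poly_rdet poly_fun_upd by simp
  define p0 where "p0 = wit (d - 1) Pf2 Qf2"
  have p0: "p0 \<in> param_space I (d - 1)" unfolding p0_def by (rule wit_in)
  have "poly (?G p0) t \<noteq> 0" if "poly (QD p0) t = 0" for t
    unfolding poly_G using D_wit[OF p0_def that] .
  then have "generically (param_space I (d - 1)) (\<lambda>p. QD p \<noteq> 0 \<and> degree (QD p) = N \<and>
      (\<forall>t. poly (QD p) t = 0 \<longrightarrow> poly (?G p) t \<noteq> 0))"
    using QD_wit[OF p0_def j] p0
    by (intro generically_no_common_root[of _ _ _ _ p0] polyfam_QD degree_QD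
          polyfam_rdet polyfam_fun_upd polyfam_PR polyfam_\<sigma>P polyfam_const) auto
  moreover have "generically (param_space I (d - 1)) (\<lambda>p. QD p \<noteq> 0 \<and> degree (QD p) = N \<and>
      card {t. poly (QD p) t = 0} = N \<and> (\<forall>t. poly (QD p) t = 0 \<longrightarrow> poly (pderiv (QD p)) t \<noteq> 0))"
    using QD_wit[OF p0_def j] p0 by (intro generically_simple_roots[of _ _ _ p0] polyfam_QD degree_QD) auto
  ultimately show "generically (param_space I (d - 1)) (\<lambda>p. count_sols (d - 1) p N)"
  proof (rule generically_mono[OF generically_conj[OF _ _ param_space_affine]])
    fix p assume p: "(QD p \<noteq> 0 \<and> degree (QD p) = N \<and> (\<forall>t. poly (QD p) t = 0 \<longrightarrow> poly (?G p) t \<noteq> 0)) \<and>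
      (QD p \<noteq> 0 \<and> degree (QD p) = N \<and> card {t. poly (QD p) t = 0} = N \<and>
        (\<forall>t. poly (QD p) t = 0 \<longrightarrow> poly (pderiv (QD p)) t \<noteq> 0))"
    let ?Z = "{t. poly (QD p) t = 0}"
    have sol: "sol (d - 1) p t a g \<longleftrightarrow> (\<exists>y\<in>J. g y \<noteq> 0) \<and> (\<exists>i\<in>{1..d}. a i \<noteq> 0) \<and>
       (\<forall>r<N. (\<Sum>y\<in>J. poly (QR p r y) t * g y) = 0) \<and>
       (\<forall>r<d - 2. (\<Sum>i=1..d. poly (PR p r i) t * a i) = 0) \<and> (\<Sum>i=1..d. ev g i t * a i) = 0" for t a g
    proof -
      have "N + d - 1 - (d - 1) = N" "d - 1 - 1 = d - 2" using d2 by auto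
      then show ?thesis unfolding sol_def sum_\<rho> by (simp only:) blast
    qed
    have "t \<in> ?Z" if "sol (d - 1) p t a g" for t a g
      using that unfolding sol mem_Collect_eq poly_QD rdet_zero_iff[OF eJ(1)] by blast
    moreover have "unique_sol (d - 1) p t" if t: "t \<in> ?Z" for t
    proof -
      have "\<exists>g0 a0. sol (d - 1) p t a0 g0 \<and> (\<forall>g a. sol (d - 1) p t a g \<longrightarrow>
          (\<exists>c. \<forall>y\<in>J. g y = c * g0 y) \<and> (\<exists>c. \<forall>i\<in>{1..d}. a i = c * a0 i))"
        unfolding sol
      proof (rule bilinear_system[OF eJ(1) bij_Suc, where \<rho> = "\<lambda>g i. ev g i t"])
        show "rdet eJ N (\<lambda>r y. poly (QR p r y) t) = 0" using t by (simp add: poly_QD)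
        show "rdet Suc d ((\<lambda>r i. poly (PR p r i) t)
            (d - 2 := (\<lambda>i. ev (cof eJ N (\<lambda>r y. poly (QR p r y) t) (N - 1)) i t), d - 1 := cD)) \<noteq> 0"
          using p t unfolding poly_G poly_\<sigma>P poly_qg by blast
        fix g g' :: "nat \<times> nat \<Rightarrow> complex" and c i
        assume "\<And>y. y \<in> J \<Longrightarrow> g' y = c * g y" "i \<in> {1..d}"
        then show "ev g' i t = c * ev g i t" unfolding ev_def sum_distrib_left
          by (intro sum.cong refl) simp
      qed (use N d2 in auto)
      then show ?thesis unfolding unique_sol_def by blast
    qed
    moreover have "finite ?Z" using p by (intro poly_roots_finite) simp
    ultimately show "count_sols (d - 1) p N"
      using p unfolding count_sols_def by (intro exI[of _ ?Z]) simp
  qed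
qed

text \<open>The bordered matrix leaves no room for a completing row, so uniqueness of
  \<open>g\<close> comes from \<open>simple_root_kernel\<close>, while uniqueness of
  \<open>a\<close> needs its cofactor vector to be nonzero.\<close>

lemma polar_degree_d: "has_polar_degree I C d (2 * (N - 1))"
proof (rule has_polar_degreeI[OF generically_no_solI_PQ])
  have N: "N \<ge> 2" using N_ge_d d2 by simp
  obtain \<epsilon> where \<epsilon>: "card {t. poly (HP + [:\<epsilon>:]) t = 0} = N - 1"
    "\<And>y. y \<in> J \<Longrightarrow> poly (HP + [:\<epsilon>:]) (lam y) \<noteq> 0" "\<And>y. y \<in> J \<Longrightarrow> poly (HP + [:\<epsilon>:]) (mu y) \<noteq> 0"
    by (rule ex_eps) (rule that)
  let ?u = "\<lambda>i. if i = 1 then 1 else 0 :: complex"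
  \<comment> \<open>This determinant is the first entry of \<open>pa\<close>; keeping it off the
    roots of \<open>ED\<close> ensures that a(t) is nonzero there.\<close>
  let ?G = "\<lambda>p. rdet Suc d ((PR p)(d - 1 := (\<lambda>i. [:?u i:])))"
  have poly_G: "poly (?G p) t = rdet Suc d ((\<lambda>r i. poly (PR p r i) t)(d - 1 := ?u))" for p t
    unfolding poly_rdet poly_fun_upd by simp
  define p0 where "p0 = wit d Pf1 (Qf1 \<epsilon>)"
  have p0: "p0 \<in> param_space I d" unfolding p0_def by (rule wit_in)
  note wit = ED_wit[OF p0_def \<epsilon>(1,2)]
  have "poly (?G p0) t \<noteq> 0" for t
    unfolding poly_G using Pf1_unit_row[OF p0_def] by simp
  then have "generically (param_space I d) (\<lambda>p. ED p \<noteq> 0 \<and> degree (ED p) = 2 * (N - 1) \<and>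
      (\<forall>t. poly (ED p) t = 0 \<longrightarrow> poly (?G p) t \<noteq> 0))"
    by (intro generically_no_common_root[of _ _ _ _ p0] polyfam_ED degree_ED wit p0
          polyfam_rdet polyfam_fun_upd polyfam_PR polyfam_const)
  moreover have "generically (param_space I d) (\<lambda>p. ED p \<noteq> 0 \<and> degree (ED p) = 2 * (N - 1) \<and>
      card {t. poly (ED p) t = 0} = 2 * (N - 1) \<and> (\<forall>t. poly (ED p) t = 0 \<longrightarrow> poly (pderiv (ED p)) t \<noteq> 0))"
    by (intro generically_simple_roots[of _ _ _ p0] polyfam_ED degree_ED wit p0)
  ultimately show "generically (param_space I d) (\<lambda>p. count_sols d p (2 * (N - 1)))"
  proof (rule generically_mono[OF generically_conj[OF _ _ param_space_affine]])
    fix p assume p: "(ED p \<noteq> 0 \<and> degree (ED p) = 2 * (N - 1) \<and> (\<forall>t. poly (ED p) t = 0 \<longrightarrow> poly (?G p) t \<noteq> 0)) \<and>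
      (ED p \<noteq> 0 \<and> degree (ED p) = 2 * (N - 1) \<and> card {t. poly (ED p) t = 0} = 2 * (N - 1) \<and>
        (\<forall>t. poly (ED p) t = 0 \<longrightarrow> poly (pderiv (ED p)) t \<noteq> 0))"
    let ?Z = "{t. poly (ED p) t = 0}"
    let ?a = "\<lambda>t i. poly (pa p i) t"
    let ?E = "\<lambda>t. (\<lambda>r y. poly (QR p r y) t)(N - 1 := \<rho> t (?a t))"
    have rows: "N + d - 1 - d = N - 1" by simp
    \<comment> \<open>Where a(t) vanishes the bordering row is zero, so \<open>ED\<close> vanishes
      too and no solution is missed.\<close>
    have zero: "t \<in> ?Z" if "\<forall>i\<in>{1..d}. ?a t i = 0" for t
    proof -
      have "\<rho> t (?a t) y = 0" if "y \<in> J" for y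
        using \<open>\<forall>i\<in>{1..d}. ?a t i = 0\<close> that by (cases y) (simp add: \<rho>_def)
      then have "rdet eJ N (?E t) = 0" using N by (intro rdet_zero_row[OF eJ(1), of "N - 1"]) auto
      then show ?thesis by (simp add: poly_ED)
    qed
    have ker: "(\<exists>c. c \<noteq> 0 \<and> (\<forall>i\<in>{1..d}. a i = c * ?a t i)) \<and> (\<forall>r<N. (\<Sum>y\<in>J. ?E t r y * g y) = 0)"
      if s: "sol d p t a g" and nz: "\<exists>i\<in>{1..d}. ?a t i \<noteq> 0" for t a g
    proof -
      have "\<exists>c. \<forall>i\<in>{1..d}. a i = c * ?a t i"
        using kernel_cof[OF bij_Suc, of "\<lambda>r i. poly (PR p r i) t" a] s nz d2
        unfolding poly_pa[symmetric] by (simp add: sol_def)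
      then obtain c where c: "\<forall>i\<in>{1..d}. a i = c * ?a t i" by blast
      then have "c \<noteq> 0" using s by (auto simp: sol_def)
      have "0 = (\<Sum>y\<in>J. \<rho> t a y * g y)" using s by (simp add: sol_def)
      also have "\<dots> = c * (\<Sum>y\<in>J. \<rho> t (?a t) y * g y)"
        unfolding sum_distrib_left
      proof (intro sum.cong refl)
        fix y assume "y \<in> J"
        then have "a (fst y) = c * ?a t (fst y)" using c by (cases y) auto
        then show "\<rho> t a y * g y = c * (\<rho> t (?a t) y * g y)" by (simp add: \<rho>_def)
      qed
      finally have "(\<Sum>y\<in>J. \<rho> t (?a t) y * g y) = 0" using \<open>c \<noteq> 0\<close> by simp
      then have "\<forall>r<N. (\<Sum>y\<in>J. ?E t r y * g y) = 0" using s by (simp add: sol_def)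
      then show ?thesis using c \<open>c \<noteq> 0\<close> by blast
    qed
    have "t \<in> ?Z" if s: "sol d p t a g" for t a g
    proof (cases "\<exists>i\<in>{1..d}. ?a t i \<noteq> 0")
      case True
      then have "rdet eJ N (?E t) = 0"
        using ker[OF s] s unfolding rdet_zero_iff[OF eJ(1)] sol_def by blast
      then show ?thesis by (simp add: poly_ED)
    qed (use zero in blast)
    moreover have "unique_sol d p t" if t: "t \<in> ?Z" for t
    proof -
      have "poly (?G p) t \<noteq> 0" using p t by blast
      then have "(\<Sum>i=1..d. ?u i * ?a t i) \<noteq> 0"
        unfolding poly_G using rdet_expand_row[OF bij_Suc, of "d - 1" "\<lambda>r i. poly (PR p r i) t" ?u] d2
        unfolding poly_pa[symmetric] by simp
      then have nz: "\<exists>i\<in>{1..d}. ?a t i \<noteq> 0" by (metis (no_types, lifting) mult_zero_right sum.neutral)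
      have "rdet eJ N (?E t) = 0" using t by (simp add: poly_ED)
      then obtain g0 where g0: "\<exists>y\<in>J. g0 y \<noteq> 0" "\<forall>r<N. (\<Sum>y\<in>J. ?E t r y * g0 y) = 0"
        unfolding rdet_zero_iff[OF eJ(1)] by blast
      have "(\<Sum>i=1..d. poly (PR p r i) t * ?a t i) = 0" if "r < d - 1" for r
        using cof_kernel[OF bij_Suc, of "d - 1" r "\<lambda>r i. poly (PR p r i) t"] that d2
        unfolding poly_pa[symmetric] by simp
      moreover have "(\<Sum>y\<in>J. poly (QR p r y) t * g0 y) = 0" if "r < N - 1" for r
        using g0(2)[rule_format, of r] that by simp
      moreover have "(\<Sum>y\<in>J. \<rho> t (?a t) y * g0 y) = 0"
        using g0(2)[rule_format, of "N - 1"] N by simp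
      ultimately have "sol d p t (?a t) g0"
        unfolding sol_def rows using nz g0(1) by blast
      moreover have "(\<exists>c. \<forall>i\<in>{1..d}. a i = c * ?a t i) \<and> (\<exists>c. \<forall>y\<in>J. g y = c * g0 y)"
        if s: "sol d p t a g" for a g
      proof -
        have E: "(\<lambda>r y. poly (((QR p)(N - 1 := \<rho>P p)) r y) t) = ?E t"
          unfolding poly_fun_upd poly_\<rho>P ..
        have E': "poly (((QR p)(N - 1 := \<rho>P p)) r y) t = ?E t r y" for r y
          using fun_cong[OF fun_cong[OF E]] .
        have "poly (ED p) t = 0" "poly (pderiv (ED p)) t \<noteq> 0" using t p by auto
        then have "\<exists>c. \<forall>y\<in>J. g y = c * g0 y"
          unfolding ED_def using ker[OF s nz] g0
          by (intro simple_root_kernel[OF eJ(1)]) (auto simp only: E')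
        then show ?thesis using ker[OF s nz] by blast
      qed
      ultimately show ?thesis unfolding unique_sol_def by blast
    qed
    moreover have "finite ?Z" using p by (intro poly_roots_finite) simp
    ultimately show "count_sols d p (2 * (N - 1))"
      using p unfolding count_sols_def by (intro exI[of _ ?Z]) simp
  qed
qed

end

theorem mainTheorem1:
  fixes d :: nat and ns :: "nat \<Rightarrow> nat" and j :: nat
  assumes "d \<ge> 2"
    and "\<forall>i\<in>{1..d}. ns i > 0"
    and "1 \<le> j" and "j \<le> (\<Sum>i=1..d. ns i) + d - 1"
  shows "has_polar_degree (scroll_coords d ns) (scroll_cone d ns) j
           (if j = d - 1 \<or> j = d + 1 then (\<Sum>i=1..d. ns i)
            else if j = d then 2 * ((\<Sum>i=1..d. ns i) - 1)
            else 0)"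
proof -
  interpret scroll d ns by unfold_locales (use assms in auto)
  consider "j = d - 1" | "j = d + 1" | "j = d" | "Suc j < d" | "Suc d < j" by linarith
  then show ?thesis
  proof cases
    case 1 then show ?thesis using polar_degree_pred_d by (simp add: N_def)
  next
    case 2 then show ?thesis using polar_degree_Suc_d by (simp add: N_def)
  next
    case 3
    then have "j \<noteq> d - 1" "j \<noteq> d + 1" using d2 by auto
    then show ?thesis using 3 polar_degree_d by (simp add: N_def)
  next
    case 4
    then have "j \<noteq> d - 1" "j \<noteq> d + 1" "j \<noteq> d" by auto
    then show ?thesis using polar_degree_low[OF 4] by simp
  next
    case 5
    then have "j \<noteq> d - 1" "j \<noteq> d + 1" "j \<noteq> d" by auto
    then show ?thesis using polar_degree_high[OF 5] by simp
  qed
qed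

end
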